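(* For every $n\ge1$, $\mathcal B(n)\subseteq\mathcal{AF}_n$, and the map $\Phi$ restricted to $\mathcal B(n)$ is a bijection from $\mathcal B(n)$ onto $\mathcal A(n)$.
   Context: Dyck paths: a Dyck path of semilength $n$ is a lattice path from $(0,0)$ to $(n,n)$ with unit north steps $\mathsf N$ and east steps $\mathsf E$ that never goes below $y=x$; $\mathcal D(n)$ is their set. Row $j$ is the strip $j-1\le y\le j$, column $i$ the strip $i-1\le x\le i$. For a path let $x_j$ be the $x$-coordinate of its north step in row $j$ and $h_i$ the $y$-coordinate of its east step in column $i$; set $h_0=0$. Area $\mathbf a(\pi)=\sum_j((j-1)-x_j)$. Bounce points: $b_0=0$, $b_k=h_{b_{k-1}+1}$ until $b_m=n$; bounce composition $\alpha_k=b_k-b_{k-1}$; $p_{n,\alpha}=\mathsf N^{\alpha_1}\mathsf E^{\alpha_1}\cdots\mathsf N^{\alpha_m}\mathsf E^{\alpha_m}$; bounce $\mathbf b(\pi)=\sum_{k=1}^m(n-b_k)$; $\mathcal C(n)=\{p_{n,\alpha}:\alpha\text{ composition of }n\}$. Let $\mathbf{ab}(\pi)=\mathbf a(\pi)+\mathbf b(\pi)$. $\mathcal B(n)$ (bounce-minimal paths) is the set of $\pi\in\mathcal D(n)$ such that $\mathbf b(\tau)\ge\mathbf b(\pi)$ for every $\tau\in\mathcal D(n)$ with $\mathbf{ab}(\tau)=\mathbf{ab}(\pi)$; $\mathcal A(n)$ (area-minimal paths) is the set of $\pi\in\mathcal D(n)$ such that $\mathbf a(\tau)\ge\mathbf a(\pi)$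 for every $\tau\in\mathcal D(n)$ with $\mathbf{ab}(\tau)=\mathbf{ab}(\pi)$. Operators act on the right on $\mathcal D(n)\cup\{\bot\}$, composed left to right, fixing $\bot$; $X^{-k}=(X^{-1})^k$, $X^0=\mathrm{id}$. $A_i$ / $A_i^{-1}$ replace $x_i$ by $x_i\mp1$; $C_i$ / $C_i^{-1}$ replace $h_i$ by $h_i\pm1$; result $\bot$ if not a Dyck path. For bounce points $b_0,\dots,b_m$ and $1\le i\le m-1$, with $s=b_{i+1}-h_{b_i}$: $\pi\cdot S_i=\bot$ if $h_{b_{i-1}}=b_i$, else $\pi\cdot A_{b_i}^{-s}C_{b_i}^{s}$ ($S_i=\bot$ for $i\ge m$); each factor in a product uses the bounce points of the current path. For bounce composition $\alpha$ of length $\ell$, $1\le i<\ell$, $k\ge0$: $c_j=\max\{0,\alpha_i-\alpha_{i+j}\}$, $m$ the largest integer in $[0,\ell-i]$ with $\sum_{j\le m}c_j\le k$, $d=k-\sum_{j\le m}c_j$, and $\pi\cdot B_{i,k}=\pi\cdot S_i^{c_1}\cdots S_{i+m-1}^{c_m}S_{i+m}^{d}$. Partitions: $\mathrm{Par}_n$, conjugate $\lambda'$, $\bar\lambda_i$ the $i$-th largest distinct part, $\ell(\bar\lambda)$ the number of distinct parts, $m_\lambda(j)$ the multiplicity of $j$. With $\ell=\ell(\bar\lambda)$: $\mathcal I_{bnc}(\lambda)=\{(i,r):1\le i\le\ell-1,\ 1\le r\le m_\lambda(\bar\lambda_{\ell-i})\}$, $\mathrm{bnc}_\lambda(i,r)=1-r+\sum_{j=1}^{\ell-i}m_\lambda(\bar\lambda_j)$,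 $\mathrm{row}_\lambda(i,r)=r+\sum_{j=1}^i m_\lambda(\bar\lambda_j)\bar\lambda_j$. For $f:\mathcal I_{bnc}(\lambda')\to\mathbb Z_{\ge0}$: $p_{n,\lambda}\cdot A^f=p_{n,\lambda}\cdot\prod A_{\mathrm{row}_\lambda(i,r)}^{f(i,r)}$, $p_{n,\lambda'}\cdot B_f=p_{n,\lambda'}\cdot\prod B_{\mathrm{bnc}_{\lambda'}(i,r),f(i,r)}$, products over $(i,r)\in\mathcal I_{bnc}(\lambda')$ ordered by $i$ then $r$ ascending. $\mathcal F_n$ is the set of $(f,\lambda)$ with $\lambda\in\mathrm{Par}_n$, $\bar\lambda_i>f(i,1)\ge\cdots\ge f(i,m_{\lambda'}(\bar{\lambda'}_{\ell-i}))$ for $1\le i\le\ell-1$, and $p_{n,\lambda'}\cdot B_f\in\mathcal C(n)$. $\mathcal{AF}_n=\{p_{n,\lambda}\cdot A^f:(f,\lambda)\in\mathcal F_n\}$, $\mathcal{BF}_n=\{p_{n,\lambda'}\cdot B_f:(f,\lambda)\in\mathcal F_n\}$, and $\Phi:\mathcal{AF}_n\to\mathcal{BF}_n$ is the map $\Phi(p_{n,\lambda}\cdot A^f)=p_{n,\lambda'}\cdot B_f$. *)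

theory Defs
  imports Main "HOL-Library.FuncSet"
begin

section \<open>Dyck paths and their statistics\<close>

datatype step = North | East

type_synonym path = "step list"

definition semilength :: "path \<Rightarrow> nat" where
  "semilength \<pi> = count_list \<pi> North"

definition Dyck :: "nat \<Rightarrow> path set" where
  "Dyck n = {\<pi>. count_list \<pi> North = n \<and> count_list \<pi> East = n \<and>
     (\<forall>k \<le> length \<pi>. count_list (take k \<pi>) East \<le> count_list (take k \<pi>) North)}"

text \<open>0-based index in the word \<open>\<pi>\<close> of the \<open>j\<close>-th occurrence (\<open>j = 1, 2, \<dots>\<close>) of the step \<open>s\<close>.\<close>

definition step_index :: "step \<Rightarrow> path \<Rightarrow> nat \<Rightarrow> nat" where
  "step_index s \<pi> j = filter (\<lambda>k. \<pi> ! k = s) [0..<length \<pi>] ! (j - 1)"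

text \<open>The north step in row \<open>j\<close> is the \<open>j\<close>-th north step, the east step in column \<open>i\<close> is the
  \<open>i\<close>-th east step.  The values are meaningful for \<open>1 \<le> i, j \<le> n\<close>, and \<open>h\<^sub>0 = 0\<close>.\<close>

definition xcoord :: "path \<Rightarrow> nat \<Rightarrow> nat" where
  "xcoord \<pi> j = count_list (take (step_index North \<pi> j) \<pi>) East"

definition height :: "path \<Rightarrow> nat \<Rightarrow> nat" where
  "height \<pi> i = (if i = 0 then 0 else count_list (take (step_index East \<pi> i) \<pi>) North)"

definition area :: "path \<Rightarrow> int" where
  "area \<pi> = (\<Sum>j = 1..semilength \<pi>. (int j - 1) - int (xcoord \<pi> j))"

text \<open>\<open>bpt \<pi> k\<close> is \<open>b\<^sub>k\<close>; it is only used for \<open>k \<le> num_bounces \<pi>\<close>, the \<open>m\<close> with \<open>b\<^sub>m = n\<close>.\<close>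

fun bpt :: "path \<Rightarrow> nat \<Rightarrow> nat" where
  "bpt \<pi> 0 = 0"
| "bpt \<pi> (Suc k) = height \<pi> (bpt \<pi> k + 1)"

definition num_bounces :: "path \<Rightarrow> nat" where
  "num_bounces \<pi> = (LEAST m. bpt \<pi> m = semilength \<pi>)"

definition bounce_comp :: "path \<Rightarrow> nat list" where
  "bounce_comp \<pi> = map (\<lambda>k. bpt \<pi> k - bpt \<pi> (k - 1)) [1..<Suc (num_bounces \<pi>)]"

definition bounce :: "path \<Rightarrow> int" where
  "bounce \<pi> = (\<Sum>k = 1..num_bounces \<pi>. int (semilength \<pi>) - int (bpt \<pi> k))"

definition ab :: "path \<Rightarrow> int" where
  "ab \<pi> = area \<pi> + bounce \<pi>"

definition comp_path :: "nat list \<Rightarrow> path" where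
  "comp_path \<alpha> = concat (map (\<lambda>a. replicate a North @ replicate a East) \<alpha>)"

definition compositions :: "nat \<Rightarrow> nat list set" where
  "compositions n = {\<alpha>. 0 \<notin> set \<alpha> \<and> sum_list \<alpha> = n}"

definition comp_paths :: "nat \<Rightarrow> path set" where
  "comp_paths n = comp_path ` compositions n"

definition bounce_minimal :: "nat \<Rightarrow> path set" where
  "bounce_minimal n = {\<pi> \<in> Dyck n. \<forall>\<tau> \<in> Dyck n. ab \<tau> = ab \<pi> \<longrightarrow> bounce \<tau> \<ge> bounce \<pi>}"

definition area_minimal :: "nat \<Rightarrow> path set" where
  "area_minimal n = {\<pi> \<in> Dyck n. \<forall>\<tau> \<in> Dyck n. ab \<tau> = ab \<pi> \<longrightarrow> area \<tau> \<ge> area \<pi>}"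


section \<open>Operators\<close>

text \<open>\<open>None\<close> plays the role of \<open>\<bottom>\<close>.  Operators are functions on \<open>path option\<close>, so the right action
  \<open>\<pi> \<cdot> X Y\<close> is \<open>Y (X (Some \<pi>))\<close> and \<open>X\<^sup>k\<close> is \<open>X ^^ k\<close>.

  \<open>shift_row d i \<pi>\<close> is the Dyck path obtained from \<open>\<pi>\<close> by replacing \<open>x\<^sub>i\<close> by \<open>x\<^sub>i + d\<close>, and
  \<open>shift_col d i \<pi>\<close> the one obtained by replacing \<open>h\<^sub>i\<close> by \<open>h\<^sub>i + d\<close>.  A path is determined by
  its \<open>x\<^sub>j\<close>, and likewise by its \<open>h\<^sub>j\<close>, so the descriptions are unique.\<close>

definition shift_row :: "int \<Rightarrow> nat \<Rightarrow> path \<Rightarrow> path option" where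
  "shift_row d i \<pi> =
     (let n = semilength \<pi>;
          P = (\<lambda>\<tau>. \<tau> \<in> Dyck n \<and>
                (\<forall>j \<in> {1..n}. int (xcoord \<tau> j) = int (xcoord \<pi> j) + (if j = i then d else 0)))
      in if i \<in> {1..n} \<and> (\<exists>\<tau>. P \<tau>) then Some (THE \<tau>. P \<tau>) else None)"

definition shift_col :: "int \<Rightarrow> nat \<Rightarrow> path \<Rightarrow> path option" where
  "shift_col d i \<pi> =
     (let n = semilength \<pi>;
          P = (\<lambda>\<tau>. \<tau> \<in> Dyck n \<and>
                (\<forall>j \<in> {1..n}. int (height \<tau> j) = int (height \<pi> j) + (if j = i then d else 0)))
      in if i \<in> {1..n} \<and> (\<exists>\<tau>. P \<tau>) then Some (THE \<tau>. P \<tau>) else None)"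

definition opA :: "nat \<Rightarrow> path option \<Rightarrow> path option" where
  "opA i p = Option.bind p (shift_row (- 1) i)"

definition opA_inv :: "nat \<Rightarrow> path option \<Rightarrow> path option" where
  "opA_inv i p = Option.bind p (shift_row 1 i)"

definition opC :: "nat \<Rightarrow> path option \<Rightarrow> path option" where
  "opC i p = Option.bind p (shift_col 1 i)"

definition opS :: "nat \<Rightarrow> path option \<Rightarrow> path option" where
  "opS i p = Option.bind p (\<lambda>\<pi>.
     if 1 \<le> i \<and> i < num_bounces \<pi> \<and> height \<pi> (bpt \<pi> (i - 1)) \<noteq> bpt \<pi> i
     then let s = bpt \<pi> (i + 1) - height \<pi> (bpt \<pi> i)
          in (opC (bpt \<pi> i) ^^ s) ((opA_inv (bpt \<pi> i) ^^ s) (Some \<pi>))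
     else None)"

text \<open>The truncated subtraction in \<open>c\<close> is \<open>max {0, \<alpha>\<^sub>i - \<alpha>\<^sub>i\<^sub>+\<^sub>j}\<close> (lists are 0-based).  For \<open>i\<close> outside
  \<open>{1..<\<ell>}\<close>, where \<open>B\<^sub>i\<^sub>,\<^sub>k\<close> is not defined, the value is \<open>\<bottom>\<close>.\<close>

definition opB :: "nat \<Rightarrow> nat \<Rightarrow> path option \<Rightarrow> path option" where
  "opB i k p = Option.bind p (\<lambda>\<pi>.
     let \<alpha> = bounce_comp \<pi>; l = length \<alpha>
     in if 1 \<le> i \<and> i < l
        then let c = (\<lambda>j. \<alpha> ! (i - 1) - \<alpha> ! (i + j - 1));
                 m = Max {m. m \<le> l - i \<and> (\<Sum>j = 1..m. c j) \<le> k};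
                 d = k - (\<Sum>j = 1..m. c j)
             in (opS (i + m) ^^ d) (fold (\<lambda>j. opS (i + j - 1) ^^ c j) [1..<Suc m] (Some \<pi>))
        else None)"


section \<open>Partitions\<close>

definition Par :: "nat \<Rightarrow> nat list set" where
  "Par n = {l. sorted_wrt (\<ge>) l \<and> 0 \<notin> set l \<and> sum_list l = n}"

definition conjugate :: "nat list \<Rightarrow> nat list" where
  "conjugate l = (if l = [] then [] else map (\<lambda>i. length (filter (\<lambda>a. i \<le> a) l)) [1..<Suc (hd l)])"

definition num_dparts :: "nat list \<Rightarrow> nat" where
  "num_dparts l = card (set l)"

definition dpart :: "nat list \<Rightarrow> nat \<Rightarrow> nat" where
  "dpart l i = rev (sorted_list_of_set (set l)) ! (i - 1)"

definition dmult :: "nat list \<Rightarrow> nat \<Rightarrow> nat" where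
  "dmult l i = count_list l (dpart l i)"

text \<open>The index set \<open>\<I>\<^sub>b\<^sub>n\<^sub>c\<close>, listed by ascending \<open>i\<close>, then ascending \<open>r\<close>.\<close>

definition bnc_list :: "nat list \<Rightarrow> (nat \<times> nat) list" where
  "bnc_list l = concat (map (\<lambda>i. map (\<lambda>r. (i, r)) [1..<Suc (dmult l (num_dparts l - i))])
                         [1..<num_dparts l])"

definition I_bnc :: "nat list \<Rightarrow> (nat \<times> nat) set" where
  "I_bnc l = {(i, r). 1 \<le> i \<and> i < num_dparts l \<and> 1 \<le> r \<and> r \<le> dmult l (num_dparts l - i)}"

lemma set_bnc_list: "set (bnc_list l) = I_bnc l"
  by (force simp: bnc_list_def I_bnc_def simp del: upt_Suc)

definition bnc :: "nat list \<Rightarrow> nat \<Rightarrow> nat \<Rightarrow> nat" where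
  "bnc l i r = (\<Sum>j = 1..num_dparts l - i. dmult l j) + 1 - r"

definition row :: "nat list \<Rightarrow> nat \<Rightarrow> nat \<Rightarrow> nat" where
  "row l i r = r + (\<Sum>j = 1..i. dmult l j * dpart l j)"


section \<open>The sets \<open>\<F>\<^sub>n\<close> and \<open>\<A>\<F>\<^sub>n\<close> and the map \<open>\<Phi>\<close>\<close>

text \<open>\<open>A_prod f \<lambda>\<close> is \<open>p\<^sub>n\<^sub>,\<^sub>\<lambda> \<cdot> A\<^sup>f\<close> and \<open>B_prod f \<lambda>\<close> is \<open>p\<^sub>n\<^sub>,\<^sub>\<lambda>\<^sub>' \<cdot> B\<^sub>f\<close>.\<close>

definition A_prod :: "(nat \<times> nat \<Rightarrow> nat) \<Rightarrow> nat list \<Rightarrow> path option" where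
  "A_prod f l =
     fold (\<lambda>(i, r). opA (row l i r) ^^ f (i, r)) (bnc_list (conjugate l)) (Some (comp_path l))"

definition B_prod :: "(nat \<times> nat \<Rightarrow> nat) \<Rightarrow> nat list \<Rightarrow> path option" where
  "B_prod f l =
     fold (\<lambda>(i, r). opB (bnc (conjugate l) i r) (f (i, r))) (bnc_list (conjugate l))
       (Some (comp_path (conjugate l)))"

definition F_set :: "nat \<Rightarrow> ((nat \<times> nat \<Rightarrow> nat) \<times> nat list) set" where
  "F_set n = {(f, l). l \<in> Par n \<and> f \<in> I_bnc (conjugate l) \<rightarrow>\<^sub>E UNIV \<and>
     (\<forall>i \<in> {1..<num_dparts l}.
        f (i, 1) < dpart l i \<and>
        (\<forall>r \<in> {1..<dmult (conjugate l) (num_dparts l - i)}. f (i, r) \<ge> f (i, r + 1))) \<and>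
     B_prod f l \<in> Some ` comp_paths n}"

definition AF :: "nat \<Rightarrow> path set" where
  "AF n = {\<pi>. \<exists>(f, l) \<in> F_set n. A_prod f l = Some \<pi>}"

definition Phi :: "nat \<Rightarrow> path \<Rightarrow> path" where
  "Phi n \<pi> = (THE \<sigma>. \<exists>(f, l) \<in> F_set n. A_prod f l = Some \<pi> \<and> B_prod f l = Some \<sigma>)"

end

theory Submission
  imports Defs "HOL-Library.Multiset"
begin

text \<open>
  Let \<open>\<alpha>\<close> be the bounce composition of a path \<open>\<pi>\<close>.  Then \<open>b(\<pi>) = \<Sum> (k - 1) \<alpha>\<^sub>k\<close>, and \<open>a(\<pi>)\<close> is
  \<open>\<Sum> (\<alpha>\<^sub>k choose 2)\<close> plus the number \<open>e\<close> of cells between \<open>\<pi>\<close> and its bounce path, so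
  \<open>D = (n choose 2) - ab(\<pi>)\<close> is \<open>\<delta>(\<alpha>) - e\<close> for a function \<open>\<delta>\<close> of \<open>\<alpha>\<close>.  Hence \<open>\<pi>\<close> is bounce-minimal iff
  \<open>\<alpha>\<close> has least bounce among the compositions with \<open>\<delta> \<ge> D\<close>; moving one cell to the preceding part
  shows that such an \<open>\<alpha>\<close> is a partition \<open>\<lambda>\<close> all of whose gaps \<open>\<lambda>\<^sub>i - \<lambda>\<^sub>i\<^sub>+\<^sub>1\<close> exceed \<open>e\<close>.  Likewise the
  area-minimal paths are the \<open>p\<^sub>\<alpha>\<close> with \<open>\<alpha>\<close> of least area among the compositions with
  \<open>\<delta> \<ge> \<delta>(\<alpha>)\<close>.  Conjugation exchanges bounce and area of partition paths and preserves \<open>\<delta>\<close>, so the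
  area-minimal \<open>\<alpha>\<close> are rearrangements of \<open>\<lambda>'\<close> of inversion weight \<open>e\<close>.  Every part size of \<open>\<lambda>'\<close> below the
  largest occurs more than \<open>e\<close> times, so in such a rearrangement a part only ever passes parts smaller
  by one.  Both the cells above \<open>p\<^sub>\<lambda>\<close> and these rearrangements are therefore recorded by the
  same tuples \<open>f\<close> of small partitions, and each \<open>B\<^sub>i\<^sub>,\<^sub>k\<close> acts by \<open>k\<close> swaps of adjacent parts.\<close>


section \<open>Dyck paths and their coordinates\<close>

text \<open>The competitors satisfy \<delta> \<ge> D and not \<delta> = D, so equality has to be
  recovered on both sides: an optimal \<lambda> gets its e surplus cells placed in a single row, and
  the least area is shown to be attained with \<delta> = D exactly, which leaves no room for cells
  above the bounce path. The gap condition works twice because the value i occurs \<lambda>_i -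
  \<lambda>_{i+1} times in \<lambda>'. A total of e moves therefore cannot use up a level of equal
  parts of \<lambda>', and e cells, stacked in weakly decreasing rows of a block, cannot leave the
  rows indexed by \<I>_bnc. The number e is the total of f on either side, since every swap of b + 1
  with a following b raises bounce and inversion weight by one. As \<Phi> is given by a definite
  description, (f, \<lambda>) must be recoverable from the path: \<lambda> is its bounce composition
  and f its number of extra cells row by row. Injectivity needs a second decoding, of f from the
  rearrangement, obtained by undoing the moves one at a time.\<close>

text \<open>Structural replacement for the index-based \<open>xcoord\<close> and
  \<open>height\<close>: for each occurrence of \<open>s\<close> it records how many other steps
  come before, starting the count at \<open>c\<close>. The free offset is what inductions along the
  path generalize over.\<close>

primrec coords :: "step \<Rightarrow> nat \<Rightarrow> path \<Rightarrow> nat list" where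
  "coords s c [] = []"
| "coords s c (t # p) = (if t = s then c # coords s c p else coords s (Suc c) p)"

lemma length_coords: "length (coords s c p) = count_list p s"
  by (induction p arbitrary: c) auto

lemma coords_append:
  assumes "t \<noteq> s"
  shows "coords s c (p @ q) = coords s c p @ coords s (c + count_list p t) q"
  using assms
proof (induction p arbitrary: c)
  case (Cons a p)
  then show ?case by (cases a; cases s; cases t) auto
qed simp

lemma coords_ge: "x \<in> set (coords s c p) \<Longrightarrow> c \<le> x"
proof (induction p arbitrary: c)
  case (Cons a p)
  then show ?case by (fastforce split: if_splits)
qed simp

lemma coords_le:
  assumes "t \<noteq> s" "x \<in> set (coords s c p)"
  shows "x \<le> c + count_list p t"
  using assms
proof (induction p arbitrary: c)
  case (Cons a p)
  then show ?case by (cases a; cases s; cases t) (fastforce split: if_splits)+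
qed simp

lemma sorted_coords: "sorted (coords s c p)"
  by (induction p arbitrary: c) (auto dest: coords_ge)

lemma filter_index_Cons:
  "filter (\<lambda>k. (a # p) ! k = s) [0..<length (a # p)] =
     (if a = s then [0] else []) @ map Suc (filter (\<lambda>k. p ! k = s) [0..<length p])"
proof -
  have "[0..<length (a # p)] = 0 # map Suc [0..<length p]"
    by (simp add: upt_conv_Cons map_Suc_upt del: upt_Suc)
  then show ?thesis by (simp add: filter_map comp_def del: upt_Suc)
qed

lemma length_filter_index: "length (filter (\<lambda>k. p ! k = s) [0..<length p]) = count_list p s"
proof (induction p)
  case (Cons a p)
  then show ?case unfolding filter_index_Cons by simp
qed simp

text \<open>Bridge from positions to recursion: \<open>k\<close> is the position that
  \<open>step_index\<close> selects for the occurrence numbered \<open>j + 1\<close>.\<close>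

lemma counts_before_index:
  assumes "j < count_list p s" "t \<noteq> s"
  defines "k \<equiv> filter (\<lambda>k. p ! k = s) [0..<length p] ! j"
  shows "count_list (take k p) s = j \<and> c + count_list (take k p) t = coords s c p ! j"
  using assms(1,2) unfolding k_def
proof (induction p arbitrary: j c)
  case (Cons a p)
  have len: "length (filter (\<lambda>k. p ! k = s) [0..<length p]) = count_list p s"
    by (rule length_filter_index)
  show ?case
  proof (cases "a = s")
    case True
    show ?thesis
    proof (cases j)
      case 0
      then show ?thesis using True unfolding filter_index_Cons by simp
    next
      case (Suc j')
      then have "j' < count_list p s" using Cons.prems True by simp
      with Cons.IH[OF this Cons.prems(2), of c] show ?thesis
        using True Suc len Cons.prems(2) unfolding filter_index_Cons by simp
    qed
  next
    case False
    then have j: "j < count_list p s" using Cons.prems by simp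
    have "a = t" using False Cons.prems(2) by (cases a; cases s; cases t) auto
    with Cons.IH[OF j Cons.prems(2), of "Suc c"] show ?thesis
      using False len j unfolding filter_index_Cons by simp
  qed
qed simp

lemma xcoord_coords: "j < count_list p North \<Longrightarrow> xcoord p (Suc j) = coords North 0 p ! j"
  using counts_before_index[of j p North East 0] by (simp add: xcoord_def step_index_def)

lemma height_coords: "j < count_list p East \<Longrightarrow> height p (Suc j) = coords East 0 p ! j"
  using counts_before_index[of j p East North 0] by (simp add: height_def step_index_def)

text \<open>Both sides say that the north step numbered \<open>j + 1\<close> comes before the east
  step numbered \<open>i + 1\<close>. This single equivalence converts between row and column
  descriptions everywhere below.\<close>

lemma coords_galois:
  assumes "i < count_list p East" "j < count_list p North"
  shows "coords North c p ! j \<le> c + i \<longleftrightarrow> d + j < coords East d p ! i"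
  using assms
proof (induction p arbitrary: i j c d)
  case (Cons a p)
  show ?case
  proof (cases a)
    case North
    have i: "i < count_list p East" using Cons.prems North by simp
    show ?thesis
    proof (cases j)
      case 0
      have "Suc d \<le> coords East (Suc d) p ! i"
        by (rule coords_ge[of _ East _ p]) (simp add: i length_coords)
      then show ?thesis using North 0 by simp
    next
      case (Suc j')
      then show ?thesis using Cons.IH[OF i, of j' c "Suc d"] Cons.prems North by simp
    qed
  next
    case East
    have j: "j < count_list p North" using Cons.prems East by simp
    show ?thesis
    proof (cases i)
      case 0
      have "Suc c \<le> coords North (Suc c) p ! j"
        by (rule coords_ge[of _ North _ p]) (simp add: j length_coords)
      then show ?thesis using East 0 by simp
    next
      case (Suc i')
      then show ?thesis using Cons.IH[of i' j "Suc c" d] j Cons.prems East by simp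
    qed
  qed
qed simp

text \<open>East steps after the last north step leave no trace in the list; the second assumption
  fixes their number.\<close>

lemma coords_North_inj:
  assumes "coords North c p = coords North c q" "count_list p East = count_list q East"
  shows "p = q"
  using assms
proof (induction p arbitrary: c q)
  case Nil
  then have "count_list q North = 0" "count_list q East = 0"
    using length_coords[of North c q] by auto
  then show ?case
  proof (cases q)
    case (Cons a q')
    then show ?thesis using Nil \<open>count_list q North = 0\<close> by (cases a) auto
  qed simp
next
  case (Cons a p)
  show ?case
  proof (cases q)
    case Nil
    then show ?thesis using Cons.prems by (cases a) auto
  next
    case (Cons b q')
    show ?thesis
    proof (cases a; cases b)
      assume "a = North" "b = East"
      then have "c \<in> set (coords North (Suc c) q')"
        using Cons.prems \<open>q = b # q'\<close> by (metis coords.simps(2) list.set_intros(1) step.distinct(1))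
      then show ?thesis using coords_ge by fastforce
    next
      assume "a = East" "b = North"
      then have "c \<in> set (coords North (Suc c) p)"
        using Cons.prems \<open>q = b # q'\<close> by (metis coords.simps(2) list.set_intros(1) step.distinct(1))
      then show ?thesis using coords_ge by fastforce
    qed (use Cons.prems Cons.IH \<open>q = b # q'\<close> in auto)
  qed
qed

lemma coords_replicate:
  "coords s c (replicate a s @ p) = replicate a c @ coords s c p"
  "t \<noteq> s \<Longrightarrow> coords s c (replicate a t @ p) = coords s (c + a) p"
  by (induction a arbitrary: c) auto

lemma count_list_replicate: "count_list (replicate a x) y = (if x = y then a else 0)"
  by (induction a) auto

lemma ex_path_coords:
  assumes "sorted xs" "\<forall>x \<in> set xs. c \<le> x \<and> x \<le> m" "c \<le> m"
  shows "\<exists>p. coords North c p = xs \<and> c + count_list p East = m"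
  using assms
proof (induction xs arbitrary: c)
  case Nil
  then show ?case
    using coords_replicate(2)[of East North c "m - c" "[]"]
    by (intro exI[of _ "replicate (m - c) East"]) (simp add: count_list_replicate)
next
  case (Cons x xs)
  have "\<exists>p. coords North x p = xs \<and> x + count_list p East = m"
    using Cons.prems by (intro Cons.IH) auto
  then obtain p where p: "coords North x p = xs" "x + count_list p East = m" by blast
  have "c \<le> x" using Cons.prems by simp
  then show ?case using p
    by (intro exI[of _ "replicate (x - c) East @ North # p"])
      (simp add: coords_replicate count_list_replicate)
qed

text \<open>Along a run of east steps the prefix condition is hardest at the end of the run, that
  is, just before the next north step, where it becomes a bound on one coordinate, or at the end of
  the path, where both counts are n.\<close>

lemma Dyck_iff_coords:
  "p \<in> Dyck n \<longleftrightarrow> count_list p North = n \<and> count_list p East = n \<and>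
     (\<forall>j<n. coords North 0 p ! j \<le> j)"
proof (intro iffI conjI allI impI)
  assume p: "p \<in> Dyck n"
  then show N: "count_list p North = n" and "count_list p East = n" by (auto simp: Dyck_def)
  fix j assume j: "j < n"
  let ?k = "filter (\<lambda>k. p ! k = North) [0..<length p] ! j"
  have c: "count_list (take ?k p) North = j \<and> 0 + count_list (take ?k p) East = coords North 0 p ! j"
    using j N by (intro counts_before_index) auto
  have "?k \<in> set (filter (\<lambda>k. p ! k = North) [0..<length p])"
    using j N by (intro nth_mem) (simp only: length_filter_index)
  then have "?k \<le> length p" by simp
  then have "count_list (take ?k p) East \<le> count_list (take ?k p) North"
    using p by (simp add: Dyck_def)
  then show "coords North 0 p ! j \<le> j" using c by simp
next
  assume p: "count_list p North = n \<and> count_list p East = n \<and> (\<forall>j<n. coords North 0 p ! j \<le> j)"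
  have "count_list (take k p) East \<le> count_list (take k p) North" for k
  proof -
    let ?a = "take k p" and ?b = "drop k p"
    have eq: "count_list p s = count_list ?a s + count_list ?b s" for s
      by (metis append_take_drop_id count_list_append)
    show ?thesis
    proof (cases "count_list ?b North = 0")
      case True
      then show ?thesis using p eq[of North] eq[of East] by simp
    next
      case False
      let ?m = "count_list ?a North"
      have "coords North 0 p = coords North 0 ?a @ coords North (0 + count_list ?a East) ?b"
        by (metis append_take_drop_id coords_append step.distinct(1))
      then have "coords North 0 p ! ?m = coords North (count_list ?a East) ?b ! 0"
        by (simp add: nth_append length_coords)
      moreover have "count_list ?a East \<le> coords North (count_list ?a East) ?b ! 0"
        using False by (intro coords_ge[of _ North _ ?b] nth_mem) (simp add: length_coords)
      moreover have "coords North 0 p ! ?m \<le> ?m" using p eq[of North] False by auto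
      ultimately show ?thesis by simp
    qed
  qed
  then show "p \<in> Dyck n" using p by (simp add: Dyck_def)
qed

lemma Dyck_semilength: "p \<in> Dyck n \<Longrightarrow> semilength p = n"
  by (simp add: Dyck_def semilength_def)

lemma nat1_Suc: "j \<in> {1..n} \<Longrightarrow> \<exists>i. j = Suc i \<and> i < (n::nat)"
  by (cases j) auto

lemma Dyck_xcoord_less:
  assumes "p \<in> Dyck n" "j \<in> {1..n}"
  shows "xcoord p j < j"
  using assms nat1_Suc[OF assms(2)] by (auto simp: Dyck_iff_coords xcoord_coords le_imp_less_Suc)

lemma Dyck_xcoord_mono:
  assumes "p \<in> Dyck n" "1 \<le> i" "i \<le> j" "j \<le> n"
  shows "xcoord p i \<le> xcoord p j"
proof -
  obtain i' j' where "i = Suc i'" "j = Suc j'" using assms by (cases i; cases j) auto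
  then show ?thesis using assms sorted_coords[of North 0 p]
    by (auto simp: Dyck_iff_coords xcoord_coords length_coords intro: sorted_nth_mono)
qed

lemma Dyck_galois:
  assumes "p \<in> Dyck n" "i \<in> {1..n}" "j \<in> {1..n}"
  shows "xcoord p j < i \<longleftrightarrow> j \<le> height p i"
proof -
  obtain i' j' where "i = Suc i'" "i' < n" "j = Suc j'" "j' < n"
    using nat1_Suc[OF assms(2)] nat1_Suc[OF assms(3)] by auto
  then show ?thesis using assms(1) coords_galois[of i' p j' 0 0]
    by (auto simp: Dyck_iff_coords xcoord_coords height_coords)
qed

lemma Dyck_height_le:
  assumes "p \<in> Dyck n" "i \<in> {1..n}"
  shows "height p i \<le> n"
proof -
  obtain i' where i: "i = Suc i'" "i' < n" using nat1_Suc[OF assms(2)] by auto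
  have "coords East 0 p ! i' \<le> 0 + count_list p North"
    using assms(1) i by (intro coords_le nth_mem) (auto simp: length_coords Dyck_iff_coords)
  then show ?thesis using assms(1) i by (simp add: Dyck_iff_coords height_coords)
qed

lemma Dyck_height_ge:
  assumes "p \<in> Dyck n" "i \<in> {1..n}"
  shows "i \<le> height p i"
  using Dyck_galois[OF assms assms(2)] Dyck_xcoord_less[OF assms] by simp

lemma Dyck_eqI:
  assumes "p \<in> Dyck n" "q \<in> Dyck n" "\<And>j. j \<in> {1..n} \<Longrightarrow> xcoord p j = xcoord q j"
  shows "p = q"
proof -
  have "coords North 0 p = coords North 0 q"
  proof (rule nth_equalityI)
    show "length (coords North 0 p) = length (coords North 0 q)"
      using assms by (simp add: length_coords Dyck_iff_coords)
    fix i assume "i < length (coords North 0 p)"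
    then show "coords North 0 p ! i = coords North 0 q ! i"
      using assms(1,2) assms(3)[of "Suc i"]
      by (simp add: length_coords Dyck_iff_coords xcoord_coords)
  qed
  then show ?thesis using assms coords_North_inj by (simp add: Dyck_iff_coords)
qed

lemma ex_Dyck_xcoord:
  assumes "\<And>i j. 1 \<le> i \<Longrightarrow> i \<le> j \<Longrightarrow> j \<le> n \<Longrightarrow> x i \<le> x j"
    and "\<And>j. j \<in> {1..n} \<Longrightarrow> x j < j"
  shows "\<exists>p \<in> Dyck n. \<forall>j \<in> {1..n}. xcoord p j = x j"
proof -
  let ?xs = "map x [1..<Suc n]"
  have "sorted ?xs" using assms(1) by (auto simp: sorted_iff_nth_mono simp del: upt_Suc)
  moreover have "\<forall>y \<in> set ?xs. 0 \<le> y \<and> y \<le> n"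
  proof
    fix y assume "y \<in> set ?xs"
    then obtain j where "y = x j" "j \<in> {1..n}" by auto
    then show "0 \<le> y \<and> y \<le> n" using assms(2)[of j] by simp
  qed
  ultimately obtain p where p: "coords North 0 p = ?xs" "count_list p East = n"
    using ex_path_coords[of ?xs 0 n] by (metis add_0 le0)
  have N: "count_list p North = n"
    using length_coords[of North 0 p] p by (simp del: upt_Suc)
  have nth: "coords North 0 p ! j = x (Suc j)" if "j < n" for j
    using that p by (simp del: upt_Suc)
  have "coords North 0 p ! j \<le> j" if "j < n" for j
    using nth[OF that] assms(2)[of "Suc j"] that by simp
  then have "p \<in> Dyck n" using N p by (simp add: Dyck_iff_coords)
  moreover have "xcoord p j = x j" if "j \<in> {1..n}" for j
    using nat1_Suc[OF that] N nth by (auto simp: xcoord_coords)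
  ultimately show ?thesis by blast
qed

lemma Dyck_heightI:
  assumes "p \<in> Dyck n" "i \<in> {1..n}" "H \<le> n"
    and "\<And>j. j \<in> {1..n} \<Longrightarrow> xcoord p j < i \<longleftrightarrow> j \<le> H"
  shows "height p i = H"
proof (rule antisym)
  have ge: "1 \<le> height p i" using Dyck_height_ge[OF assms(1,2)] assms(2) by simp
  then show "height p i \<le> H"
    using Dyck_galois[OF assms(1,2), of "height p i"] assms(4)[of "height p i"]
      Dyck_height_le[OF assms(1,2)] by simp
  show "H \<le> height p i"
    using Dyck_galois[OF assms(1,2), of H] assms(3) assms(4)[of H] by (cases H) auto
qed

lemma Dyck_height_mono:
  assumes "p \<in> Dyck n" "1 \<le> i" "i \<le> j" "j \<le> n"
  shows "height p i \<le> height p j"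
proof -
  have "1 \<le> height p i" "height p i \<le> n"
    using Dyck_height_ge[OF assms(1), of i] Dyck_height_le[OF assms(1), of i] assms by auto
  then show ?thesis
    using Dyck_galois[OF assms(1), of i "height p i"] Dyck_galois[OF assms(1), of j "height p i"]
      assms by auto
qed

lemma Dyck_eqI_height:
  assumes "p \<in> Dyck n" "q \<in> Dyck n" "\<And>j. j \<in> {1..n} \<Longrightarrow> height p j = height q j"
  shows "p = q"
proof (rule Dyck_eqI[OF assms(1,2)])
  fix j assume j: "j \<in> {1..n}"
  have le: "xcoord a j \<le> xcoord b j"
    if "a \<in> Dyck n" "b \<in> Dyck n" "\<And>j. j \<in> {1..n} \<Longrightarrow> height a j = height b j" for a b
  proof -
    have "xcoord b j < j" using Dyck_xcoord_less[OF that(2) j] .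
    then have i: "Suc (xcoord b j) \<in> {1..n}" using j by auto
    show ?thesis
      using Dyck_galois[OF that(1) i j] Dyck_galois[OF that(2) i j] that(3)[OF i] by auto
  qed
  show "xcoord p j = xcoord q j" using le[of p q] le[of q p] assms by auto
qed

lemma ex_Dyck_height:
  assumes "\<And>i j. 1 \<le> i \<Longrightarrow> i \<le> j \<Longrightarrow> j \<le> n \<Longrightarrow> h i \<le> h j"
    and "\<And>j. j \<in> {1..n} \<Longrightarrow> j \<le> h j \<and> h j \<le> n"
  shows "\<exists>p \<in> Dyck n. \<forall>j \<in> {1..n}. height p j = h j"
proof -
  \<comment> \<open>The dual row coordinates: the north step in row \<open>j\<close> comes after
    exactly those east steps whose height is below \<open>j\<close>.\<close>
  let ?x = "\<lambda>j. card {i \<in> {1..n}. h i < j}"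
  have "\<exists>p \<in> Dyck n. \<forall>j \<in> {1..n}. xcoord p j = ?x j"
  proof (rule ex_Dyck_xcoord)
    fix i j :: nat assume "i \<le> j"
    then show "?x i \<le> ?x j" by (intro card_mono) auto
  next
    fix j assume j: "j \<in> {1..n}"
    have "{i \<in> {1..n}. h i < j} \<subseteq> {1..<j}" using assms(2) by fastforce
    then have "?x j \<le> card {1..<j}" by (intro card_mono) auto
    then show "?x j < j" using j by auto
  qed
  then obtain p where p: "p \<in> Dyck n" "\<And>j. j \<in> {1..n} \<Longrightarrow> xcoord p j = ?x j" by blast
  have "height p i = h i" if i: "i \<in> {1..n}" for i
  proof (rule Dyck_heightI[OF p(1) i])
    show "h i \<le> n" using assms(2) i by simp
    fix j assume j: "j \<in> {1..n}"
    show "xcoord p j < i \<longleftrightarrow> j \<le> h i"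
    proof
      assume "xcoord p j < i"
      show "j \<le> h i"
      proof (rule ccontr)
        assume "\<not> j \<le> h i"
        then have "{1..i} \<subseteq> {i \<in> {1..n}. h i < j}" using assms(1)[of _ i] i by fastforce
        then have "card {1..i} \<le> ?x j" by (intro card_mono) auto
        then show False using \<open>xcoord p j < i\<close> p(2)[OF j] by simp
      qed
    next
      assume "j \<le> h i"
      then have "{i \<in> {1..n}. h i < j} \<subseteq> {1..<i}"
        using assms(1)[of i] i by (force simp: not_less[symmetric])
      then have "?x j \<le> card {1..<i}" by (intro card_mono) auto
      then show "xcoord p j < i" using p(2)[OF j] i by auto
    qed
  qed
  then show ?thesis using p(1) by blast
qed


section \<open>Statistics of compositions\<close>

text \<open>For a composition \<open>\<alpha>\<close> of \<open>n\<close> these are the bounce, the area, and \<open>n choose 2\<close> minus their sum, of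
  the path \<open>comp_path \<alpha>\<close>.\<close>

primrec comp_bounce :: "nat list \<Rightarrow> nat" where
  "comp_bounce [] = 0"
| "comp_bounce (a # \<alpha>) = comp_bounce \<alpha> + sum_list \<alpha>"

definition comp_area :: "nat list \<Rightarrow> nat" where
  "comp_area \<alpha> = sum_list (map (\<lambda>a. a choose 2) \<alpha>)"

primrec comp_deficit :: "nat list \<Rightarrow> nat" where
  "comp_deficit [] = 0"
| "comp_deficit (a # \<alpha>) = (a - 1) * sum_list \<alpha> + comp_deficit \<alpha>"

lemma choose_two_add: "(a + b) choose 2 = (a choose 2) + (b choose 2) + a * (b::nat)"
  by (induction a) (simp_all add: numeral_2_eq_2)

lemma choose_two_Suc: "Suc a choose 2 = (a choose 2) + a"
  by (simp add: numeral_2_eq_2)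

text \<open>Counts pairs of cells. Pairs inside one part give the area; the \<alpha>_i \<alpha>_j
  pairs between parts i < j split into (\<alpha>_i - 1) \<alpha>_j for the deficit and \<alpha>_j
  for the bounce. Positivity keeps the truncated \<alpha>_i - 1 exact.\<close>

lemma comp_stats_sum:
  assumes "0 \<notin> set \<alpha>"
  shows "comp_bounce \<alpha> + comp_area \<alpha> + comp_deficit \<alpha> = sum_list \<alpha> choose 2"
  using assms
proof (induction \<alpha>)
  case (Cons a \<alpha>)
  then have "a * sum_list \<alpha> = (a - 1) * sum_list \<alpha> + sum_list \<alpha>"
    by (cases a) auto
  then show ?case using Cons by (simp add: choose_two_add comp_area_def)
qed (simp_all add: comp_area_def)

lemma comp_bounce_append: "comp_bounce (xs @ ys) = comp_bounce xs + comp_bounce ys + length xs * sum_list ys"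
  by (induction xs) (auto simp: algebra_simps)

lemma comp_area_append: "comp_area (xs @ ys) = comp_area xs + comp_area ys"
  by (simp add: comp_area_def)

lemma comp_area_simps: "comp_area [] = 0" "comp_area (a # \<alpha>) = (a choose 2) + comp_area \<alpha>"
  by (simp_all add: comp_area_def)

lemma comp_area_mset_eq: "mset \<alpha> = mset \<beta> \<Longrightarrow> comp_area \<alpha> = comp_area \<beta>"
  unfolding comp_area_def by (metis mset_map sum_mset_sum_list)

section \<open>Inversion weight: the effect of rearranging parts on the bounce\<close>

primrec inv_weight :: "nat list \<Rightarrow> nat" where
  "inv_weight [] = 0"
| "inv_weight (a # \<alpha>) = inv_weight \<alpha> + sum_list (map (\<lambda>b. b - a) \<alpha>)"

primrec min_weight :: "nat list \<Rightarrow> nat" where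
  "min_weight [] = 0"
| "min_weight (a # \<alpha>) = min_weight \<alpha> + sum_list (map (\<lambda>b. min a b) \<alpha>)"

lemma comp_bounce_eq: "comp_bounce \<alpha> = min_weight \<alpha> + inv_weight \<alpha>"
proof (induction \<alpha>)
  case (Cons a \<alpha>)
  have "sum_list \<alpha> = sum_list (map (\<lambda>b. min a b) \<alpha>) + sum_list (map (\<lambda>b. b - a) \<alpha>)"
    by (induction \<alpha>) auto
  then show ?case using Cons by simp
qed simp

text \<open>Since \<open>min\<close> is symmetric, summing over all ordered pairs counts each pair
  twice and adds the diagonal. The right-hand side depends only on the multiset of parts, so all
  dependence of the bounce on the order sits in \<open>inv_weight\<close>.\<close>

lemma min_weight_double: "2 * min_weight \<alpha> + sum_list \<alpha> = sum_list (map (\<lambda>a. sum_list (map (\<lambda>b. min a b) \<alpha>)) \<alpha>)"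
proof (induction \<alpha>)
  case (Cons a \<alpha>)
  have "sum_list (map (\<lambda>x. sum_list (map (\<lambda>b. min x b) (a # \<alpha>))) \<alpha>)
      = sum_list (map (\<lambda>x. min a x) \<alpha>) + sum_list (map (\<lambda>x. sum_list (map (\<lambda>b. min x b) \<alpha>)) \<alpha>)"
    by (simp add: sum_list_addf min.commute)
  then show ?case using Cons by simp
qed simp

lemma sum_list_map_mset_eq:
  fixes g :: "'a \<Rightarrow> nat"
  shows "mset \<alpha> = mset \<beta> \<Longrightarrow> sum_list (map g \<alpha>) = sum_list (map g \<beta>)"
  by (metis mset_map sum_mset_sum_list)

lemma sum_list_mset_eq: "mset \<alpha> = mset (\<beta> :: nat list) \<Longrightarrow> sum_list \<alpha> = sum_list \<beta>"
  by (metis sum_mset_sum_list)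

lemma min_weight_mset_eq:
  assumes "mset \<alpha> = mset \<beta>"
  shows "min_weight \<alpha> = min_weight \<beta>"
proof -
  have "sum_list (map (\<lambda>a. sum_list (map (\<lambda>b. min a b) \<alpha>)) \<alpha>)
      = sum_list (map (\<lambda>a. sum_list (map (\<lambda>b. min a b) \<beta>)) \<alpha>)"
    by (intro arg_cong[where f = sum_list] map_cong refl sum_list_map_mset_eq assms)
  also have "\<dots> = sum_list (map (\<lambda>a. sum_list (map (\<lambda>b. min a b) \<beta>)) \<beta>)"
    by (intro sum_list_map_mset_eq assms)
  finally show ?thesis using min_weight_double[of \<alpha>] min_weight_double[of \<beta>] sum_list_mset_eq[OF assms] by simp
qed

lemma inv_weight_sorted: "sorted_wrt (\<ge>) \<mu> \<Longrightarrow> inv_weight \<mu> = 0"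
  by (induction \<mu>) auto

lemma comp_bounce_mset_eq_sorted:
  assumes "mset \<alpha> = mset \<mu>" "sorted_wrt (\<ge>) \<mu>"
  shows "comp_bounce \<alpha> = comp_bounce \<mu> + inv_weight \<alpha>"
  using min_weight_mset_eq[OF assms(1)] inv_weight_sorted[OF assms(2)] comp_bounce_eq[of \<alpha>] comp_bounce_eq[of \<mu>] by simp

lemma inv_weight_append:
  "inv_weight (xs @ ys) = inv_weight xs + inv_weight ys + sum_list (map (\<lambda>a. sum_list (map (\<lambda>b. b - a) ys)) xs)"
  by (induction xs) auto

lemma count_list_le_sum_list:
  assumes "g v \<ge> (1::nat)"
  shows "count_list xs v \<le> sum_list (map g xs)"
  using assms by (induction xs) auto

text \<open>Cut the list before \<open>b\<close>: each \<open>v\<close> on the left forms a weighted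
  pair with \<open>b\<close>, each \<open>v\<close> on the right one with \<open>a\<close>, and
  these pairs are all distinct.\<close>

lemma count_le_inv_weight:
  assumes "a < v" "v < b"
  shows "count_list (x @ a # y @ b # z) v \<le> inv_weight (x @ a # y @ b # z)"
proof -
  let ?p = "x @ a # y" and ?q = "b # z"
  have 1: "count_list z v \<le> sum_list (map (\<lambda>q. q - a) z)"
    using assms by (intro count_list_le_sum_list) auto
  have 2: "count_list ?p v \<le> sum_list (map (\<lambda>p. b - p) ?p)"
    using assms by (intro count_list_le_sum_list) auto
  have 3: "sum_list (map (\<lambda>q. q - a) z) \<le> sum_list (map (\<lambda>p. sum_list (map (\<lambda>q. q - p) z)) ?p)"
    by simp
  have "sum_list (map (\<lambda>p. sum_list (map (\<lambda>q. q - p) ?q)) ?p)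
      = sum_list (map (\<lambda>p. b - p) ?p) + sum_list (map (\<lambda>p. sum_list (map (\<lambda>q. q - p) z)) ?p)"
    by (simp add: sum_list_addf)
  then have "count_list ?p v + count_list ?q v \<le> inv_weight (?p @ ?q)"
    using 1 2 3 assms(2) unfolding inv_weight_append by simp
  then show ?thesis using assms by simp
qed

lemma not_sorted_wrt_split:
  assumes "\<not> sorted_wrt P xs"
  obtains x a y b z where "xs = x @ a # y @ b # z" "\<not> P a b"
  using assms
proof (induction xs arbitrary: thesis)
  case (Cons c xs)
  show ?case
  proof (cases "sorted_wrt P xs")
    case True
    then obtain b where "b \<in> set xs" "\<not> P c b" using Cons.prems by auto
    then show ?thesis using Cons.prems(1)[of "[]" c] by (metis append_Nil split_list)
  next
    case False
    then show ?thesis using Cons.IH Cons.prems(1) by (metis append_Cons)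
  qed
qed simp

text \<open>If some later part exceeded \<open>a\<close> by two or more, every copy of
  \<open>Suc a\<close> would add to the inversion weight, contrary to its large
  multiplicity.\<close>

lemma sorted_wrt_near:
  assumes "\<And>v. v \<in> {1..<L} \<Longrightarrow> inv_weight \<alpha> < count_list \<alpha> v" "set \<alpha> \<subseteq> {1..L}"
  shows "sorted_wrt (\<lambda>a b. b \<le> Suc a) \<alpha>"
proof (rule ccontr)
  assume "\<not> sorted_wrt (\<lambda>a b. b \<le> Suc a) \<alpha>"
  then obtain x a y b z where *: "\<alpha> = x @ a # y @ b # z" "\<not> b \<le> Suc a"
    by (rule not_sorted_wrt_split) blast
  then have "count_list \<alpha> (Suc a) \<le> inv_weight \<alpha>" using count_le_inv_weight[of a "Suc a" b x y z] by simp
  moreover have "Suc a \<in> {1..<L}" using * assms(2) by auto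
  ultimately show False using assms(1) by fastforce
qed

section \<open>Compositions of least bounce or least area with deficit at least D\<close>

definition bounce_optimal :: "nat \<Rightarrow> nat \<Rightarrow> nat list \<Rightarrow> bool" where
  "bounce_optimal n D l \<longleftrightarrow> l \<in> compositions n \<and> D \<le> comp_deficit l \<and>
     (\<forall>\<alpha> \<in> compositions n. D \<le> comp_deficit \<alpha> \<longrightarrow> comp_bounce l \<le> comp_bounce \<alpha>)"

definition area_optimal :: "nat \<Rightarrow> nat \<Rightarrow> nat list \<Rightarrow> bool" where
  "area_optimal n D \<beta> \<longleftrightarrow> \<beta> \<in> compositions n \<and> D \<le> comp_deficit \<beta> \<and>
     (\<forall>\<alpha> \<in> compositions n. D \<le> comp_deficit \<alpha> \<longrightarrow> comp_area \<beta> \<le> comp_area \<alpha>)"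

lemma comp_stats: "\<alpha> \<in> compositions n \<Longrightarrow> comp_bounce \<alpha> + comp_area \<alpha> + comp_deficit \<alpha> = n choose 2"
  using comp_stats_sum by (auto simp: compositions_def)

lemma ex_bounce_optimal:
  assumes "\<alpha> \<in> compositions n" "D \<le> comp_deficit \<alpha>"
  shows "\<exists>l. bounce_optimal n D l \<and> comp_bounce l \<le> comp_bounce \<alpha>"
proof -
  let ?P = "\<lambda>\<alpha>. \<alpha> \<in> compositions n \<and> D \<le> comp_deficit \<alpha>"
  have "?P (arg_min comp_bounce ?P) \<and> (\<forall>y. ?P y \<longrightarrow> comp_bounce (arg_min comp_bounce ?P) \<le> comp_bounce y)"
    by (rule arg_min_nat_lemma[of ?P \<alpha>]) (use assms in blast)
  then show ?thesis using assms unfolding bounce_optimal_def by blast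
qed

text \<open>Moving one cell from a part \<open>b\<close> to the part \<open>a\<close> before it lowers the bounce and lowers the
  deficit by at most \<open>a - b\<close>.\<close>

lemma bounce_optimal_gap_aux:
  assumes "bounce_optimal n D (w @ a # b # u)"
  shows "comp_deficit (w @ a # b # u) + b < D + a"
proof (rule ccontr)
  let ?l = "w @ a # b # u"
  assume neg: "\<not> comp_deficit ?l + b < D + a"
  have l: "?l \<in> compositions n" using assms by (simp add: bounce_optimal_def)
  then have pos: "a \<ge> 1" "b \<ge> 1" by (auto simp: compositions_def)
  have st: "comp_bounce ?l + comp_area ?l + comp_deficit ?l = n choose 2" using l by (rule comp_stats)
  obtain a' where a': "a = Suc a'" using pos by (cases a) auto
  obtain b' where b': "b = Suc b'" using pos by (cases b) auto
  show False
  proof (cases "b' = 0")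
    case True
    \<comment> \<open>Here \<open>b = 1\<close>, so the part disappears and all later parts advance
      by one place. The bounce drops by a further \<open>sum_list u\<close>, which goes to the
      deficit.\<close>
    let ?m = "w @ Suc a # u"
    have m: "?m \<in> compositions n" using l True b' by (auto simp: compositions_def)
    have st': "comp_bounce ?m + comp_area ?m + comp_deficit ?m = n choose 2" using m by (rule comp_stats)
    have comp_bounce: "comp_bounce ?l = comp_bounce ?m + 1 + sum_list u"
      using True b' by (simp add: comp_bounce_append)
    have "comp_area ?m = comp_area ?l + a"
      using True b' by (simp add: comp_area_append comp_area_simps choose_two_Suc numeral_2_eq_2)
    then have "comp_deficit ?m + a = comp_deficit ?l + 1 + sum_list u" using st st' comp_bounce by simp
    then have "D \<le> comp_deficit ?m" using neg True b' by simp
    then have "comp_bounce ?l \<le> comp_bounce ?m" using assms m unfolding bounce_optimal_def by blast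
    then show False using comp_bounce by simp
  next
    case False
    let ?m = "w @ Suc a # b' # u"
    have m: "?m \<in> compositions n" using l False b' by (auto simp: compositions_def)
    have st': "comp_bounce ?m + comp_area ?m + comp_deficit ?m = n choose 2" using m by (rule comp_stats)
    have comp_bounce: "comp_bounce ?l = comp_bounce ?m + 1"
      using b' by (simp add: comp_bounce_append)
    have "comp_area ?m + b' = comp_area ?l + a"
      using b' by (simp add: comp_area_append comp_area_simps choose_two_Suc)
    then have "comp_deficit ?m + a = comp_deficit ?l + b" using st st' comp_bounce b' by simp
    then have "D \<le> comp_deficit ?m" using neg by simp
    then have "comp_bounce ?l \<le> comp_bounce ?m" using assms m unfolding bounce_optimal_def by blast
    then show False using comp_bounce by simp
  qed
qed

lemma bounce_optimal_gap:
  assumes "bounce_optimal n D l" "Suc i < length l"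
  shows "comp_deficit l + l ! Suc i < D + l ! i"
proof -
  have "l = take i l @ l ! i # l ! Suc i # drop (Suc (Suc i)) l"
    using assms(2) by (metis Cons_nth_drop_Suc Suc_lessD append_take_drop_id)
  then show ?thesis using bounce_optimal_gap_aux[of n D "take i l" "l ! i" "l ! Suc i" "drop (Suc (Suc i)) l"] assms(1)
    by simp
qed

lemma bounce_optimal_strict:
  assumes "bounce_optimal n D l"
  shows "sorted_wrt (>) l"
proof -
  have "l ! Suc i < l ! i" if "Suc i < length l" for i
    using bounce_optimal_gap[OF assms that] assms by (simp add: bounce_optimal_def)
  then show ?thesis by (subst sorted_wrt_iff_nth_Suc_transp) (auto intro: transpI)
qed

text \<open>Splitting a last part a \<ge> 2 into 1, a - 1 turns a - 1 units of area into bounce and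
  leaves the deficit unchanged.\<close>

lemma area_optimal_last:
  assumes "area_optimal n D \<alpha>" "\<alpha> \<noteq> []"
  shows "last \<alpha> = 1"
proof (rule ccontr)
  assume neg: "last \<alpha> \<noteq> 1"
  obtain w a where w: "\<alpha> = w @ [a]" using assms(2) by (metis append_butlast_last_id)
  have c: "w @ [a] \<in> compositions n" using assms w by (simp add: area_optimal_def)
  then have "a \<noteq> 0" by (auto simp: compositions_def)
  moreover have "a \<noteq> 1" using neg w by simp
  ultimately obtain b where b: "a = Suc (Suc b)" by (metis One_nat_def not0_implies_Suc)
  let ?m = "w @ [1, Suc b]"
  have m: "?m \<in> compositions n" using c b by (auto simp: compositions_def)
  have comp_bounce: "comp_bounce ?m = comp_bounce (w @ [a]) + Suc b" using b by (simp add: comp_bounce_append)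
  have comp_area: "comp_area (w @ [a]) = comp_area ?m + Suc b"
    using b by (simp add: comp_area_append comp_area_simps choose_two_Suc numeral_2_eq_2)
  have "comp_deficit ?m = comp_deficit (w @ [a])" using comp_stats[OF c] comp_stats[OF m] comp_bounce comp_area by simp
  then have "comp_area (w @ [a]) \<le> comp_area ?m" using assms(1) m w unfolding area_optimal_def by simp
  then show False using comp_area by simp
qed

text \<open>A minimizer ends with \<open>1\<close>, so its last part \<open>a > 1\<close> is followed by \<open>1\<close>.  Replacing \<open>a, 1\<close> by
  \<open>a - 1, 2\<close> changes the area by \<open>2 - a\<close> and the deficit by \<open>a - 3\<close>, so \<open>a = 2\<close> and the deficit can
  be lowered by one.\<close>

lemma area_optimal_ex_exact:
  assumes "\<alpha> \<in> compositions n" "D \<le> comp_deficit \<alpha>"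
  shows "\<exists>\<beta>. area_optimal n D \<beta> \<and> comp_deficit \<beta> = D"
proof -
  let ?P = "\<lambda>\<alpha>. \<alpha> \<in> compositions n \<and> D \<le> comp_deficit \<alpha>"
  have "?P (arg_min comp_area ?P) \<and> (\<forall>y. ?P y \<longrightarrow> comp_area (arg_min comp_area ?P) \<le> comp_area y)"
    by (rule arg_min_nat_lemma[of ?P \<alpha>]) (use assms in blast)
  then have "area_optimal n D (arg_min comp_area ?P)" unfolding area_optimal_def by blast
  \<comment> \<open>A second minimization: among the compositions of least area, one of least
    deficit. The exchange below would lower a deficit above D once more.\<close>
  then have "area_optimal n D (arg_min comp_deficit (area_optimal n D)) \<and>
      (\<forall>y. area_optimal n D y \<longrightarrow> comp_deficit (arg_min comp_deficit (area_optimal n D)) \<le> comp_deficit y)"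
    by (rule arg_min_nat_lemma)
  then obtain \<beta> where \<beta>: "area_optimal n D \<beta>" "\<And>y. area_optimal n D y \<Longrightarrow> comp_deficit \<beta> \<le> comp_deficit y" by blast
  have "comp_deficit \<beta> = D"
  proof (rule ccontr)
    assume "comp_deficit \<beta> \<noteq> D"
    then have gt: "D < comp_deficit \<beta>" using \<beta>(1) by (simp add: area_optimal_def)
    have c: "\<beta> \<in> compositions n" using \<beta>(1) by (simp add: area_optimal_def)
    have "\<exists>a \<in> set \<beta>. a \<noteq> 1"
    proof (rule ccontr)
      assume "\<not> (\<exists>a \<in> set \<beta>. a \<noteq> 1)"
      then have "comp_deficit \<beta> = 0" by (induction \<beta>) auto
      then show False using gt by simp
    qed
    then obtain w a u where w: "\<beta> = w @ a # u" "a \<noteq> 1" "\<forall>b \<in> set u. b = 1"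
      using split_list_last_prop[of \<beta> "\<lambda>a. a \<noteq> 1"] by auto
    have "u \<noteq> []" using area_optimal_last[OF \<beta>(1)] w by auto
    then obtain u' where u: "u = 1 # u'" using w(3) by (cases u) auto
    have "a \<noteq> 0" using c w by (auto simp: compositions_def)
    then obtain b where b: "a = Suc (Suc b)" using w(2) by (metis One_nat_def not0_implies_Suc)
    let ?m = "w @ Suc b # 2 # u'"
    have m: "?m \<in> compositions n" using c w u b by (auto simp: compositions_def)
    have comp_bounce: "comp_bounce ?m = comp_bounce \<beta> + 1" using w u b by (simp add: comp_bounce_append)
    have comp_area: "comp_area ?m + b = comp_area \<beta>"
      using w u b by (simp add: comp_area_append comp_area_simps choose_two_Suc numeral_2_eq_2)
    have comp_deficit: "comp_deficit ?m + 1 = comp_deficit \<beta> + b" using comp_stats[OF c] comp_stats[OF m] comp_bounce comp_area by simp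
    then have D: "D \<le> comp_deficit ?m" using gt by simp
    then have "comp_area \<beta> \<le> comp_area ?m" using \<beta>(1) m unfolding area_optimal_def by blast
    then have "b = 0" using comp_area by simp
    then have "area_optimal n D ?m" using \<beta>(1) m D comp_area unfolding area_optimal_def by simp
    then have "comp_deficit \<beta> \<le> comp_deficit ?m" by (rule \<beta>(2))
    then show False using comp_deficit \<open>b = 0\<close> by simp
  qed
  then show ?thesis using \<beta>(1) by blast
qed

section \<open>Conjugation\<close>

text \<open>The conjugate part with index \<open>t\<close>, as a function on all numbers: it
  vanishes beyond the largest part of \<open>l\<close>.\<close>

definition count_ge :: "nat list \<Rightarrow> nat \<Rightarrow> nat" where
  "count_ge l t = length (filter (\<lambda>a. t \<le> a) l)"

lemma sorted_ge_le_hd: "sorted_wrt (\<ge>) l \<Longrightarrow> a \<in> set l \<Longrightarrow> a \<le> hd (l :: nat list)"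
  by (cases l) auto

lemma conjugate_count_ge:
  "l \<noteq> [] \<Longrightarrow> conjugate l = map (count_ge l) [1..<Suc (hd l)]"
  by (simp add: conjugate_def count_ge_def[abs_def])

text \<open>The cells of the Young diagram, weighted by their column, summed by columns and by rows.
  The weight t - 1 relates bounce to area, the weight 1 gives the size.\<close>

lemma sum_count_ge:
  assumes "\<forall>a \<in> set l. a \<le> H"
  shows "(\<Sum>t = 1..H. g t * count_ge l t) = sum_list (map (\<lambda>a. \<Sum>t = 1..a. g t) l)"
  using assms
proof (induction l)
  case (Cons a l)
  have "(\<Sum>t = 1..H. g t * count_ge (a # l) t) = (\<Sum>t = 1..H. (if t \<le> a then g t else 0) + g t * count_ge l t)"
    by (intro sum.cong) (auto simp: count_ge_def)
  also have "\<dots> = (\<Sum>t = 1..H. if t \<le> a then g t else 0) + (\<Sum>t = 1..H. g t * count_ge l t)"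
    by (rule sum.distrib)
  also have "(\<Sum>t = 1..H. if t \<le> a then g t else 0) = (\<Sum>t \<in> {t \<in> {1..H}. t \<le> a}. g t)"
    by (rule sum.inter_filter[symmetric]) simp
  also have "{t \<in> {1..H}. t \<le> a} = {1..a}" using Cons.prems by auto
  finally show ?case using Cons by simp
qed (simp add: count_ge_def)

lemma sum_list_map_upt: "sum_list (map g [1..<Suc H]) = (\<Sum>t = 1..H. g t :: nat)"
  by (induction H) auto

lemma comp_bounce_map_upt: "comp_bounce (map g [1..<Suc H]) = (\<Sum>t = 1..H. (t - 1) * g t)"
  by (induction H) (auto simp: comp_bounce_append)

lemma sum_pred: "(\<Sum>t = 1..a. t - 1) = a choose 2"
  by (induction a) (simp_all add: choose_two_Suc)

lemma comp_bounce_conjugate: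
  assumes "sorted_wrt (\<ge>) l"
  shows "comp_bounce (conjugate l) = comp_area l"
proof (cases "l = []")
  case False
  then have "comp_bounce (conjugate l) = (\<Sum>t = 1..hd l. (t - 1) * count_ge l t)"
    unfolding conjugate_count_ge[OF False] comp_bounce_map_upt by simp
  also have "\<dots> = sum_list (map (\<lambda>a. \<Sum>t = 1..a. t - 1) l)"
    by (rule sum_count_ge) (use assms sorted_ge_le_hd in blast)
  finally show ?thesis unfolding comp_area_def sum_pred .
qed (simp add: conjugate_def comp_area_def)

lemma sum_list_conjugate:
  assumes "sorted_wrt (\<ge>) l"
  shows "sum_list (conjugate l) = sum_list l"
proof (cases "l = []")
  case False
  then have "sum_list (conjugate l) = (\<Sum>t = 1..hd l. 1 * count_ge l t)"
    unfolding conjugate_count_ge[OF False] sum_list_map_upt by simp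
  also have "\<dots> = sum_list (map (\<lambda>a. \<Sum>t = 1..a. 1) l)"
    by (rule sum_count_ge) (use assms sorted_ge_le_hd in blast)
  finally show ?thesis by simp
qed (simp add: conjugate_def)

lemma count_ge_antimono: "s \<le> t \<Longrightarrow> count_ge l t \<le> count_ge l s"
  by (induction l) (auto simp: count_ge_def)

text \<open>Both sides say that the diagram has a cell in row \<open>i + 1\<close> and column
  \<open>t\<close>; by sortedness the rows reaching column \<open>t\<close> form an initial
  segment.\<close>

lemma count_ge_galois:
  assumes "sorted_wrt (\<ge>) l" "i < length l"
  shows "i < count_ge l t \<longleftrightarrow> t \<le> l ! i"
  using assms
proof (induction l arbitrary: i)
  case (Cons a l)
  show ?case
  proof (cases "t \<le> a")
    case True
    then show ?thesis using Cons by (cases i) (auto simp: count_ge_def)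
  next
    case False
    then have "\<forall>b \<in> set (a # l). \<not> t \<le> b" using Cons.prems(1) by fastforce
    then have "count_ge (a # l) t = 0" "\<not> t \<le> (a # l) ! i"
      using nth_mem[OF Cons.prems(2)] by (auto simp: count_ge_def filter_empty_conv)
    then show ?thesis by simp
  qed
qed simp

lemma count_ge_le_length: "count_ge l t \<le> length l"
  by (simp add: count_ge_def)

lemma conjugate_Par:
  assumes "l \<in> Par n"
  shows "conjugate l \<in> Par n"
proof (cases "l = []")
  case False
  have l: "sorted_wrt (\<ge>) l" "0 \<notin> set l" using assms by (auto simp: Par_def)
  have "sorted_wrt (\<ge>) (conjugate l)"
    using count_ge_antimono False by (auto simp: conjugate_count_ge sorted_wrt_iff_nth_less simp del: upt_Suc)
  moreover have "0 \<notin> set (conjugate l)"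
  proof
    assume "0 \<in> set (conjugate l)"
    then have "0 \<in> count_ge l ` {1..hd l}" using False
      by (simp add: conjugate_count_ge atLeastLessThanSuc_atLeastAtMost del: upt_Suc)
    then obtain t where t: "t \<le> hd l" "count_ge l t = 0" by auto
    then show False using count_ge_galois[OF l(1), of 0 t] False by (simp add: hd_conv_nth)
  qed
  ultimately show ?thesis using sum_list_conjugate[OF l(1)] assms by (simp add: Par_def)
qed (use assms in \<open>simp add: conjugate_def\<close>)

lemma conjugate_conjugate:
  assumes "l \<in> Par n"
  shows "conjugate (conjugate l) = l"
proof (cases "l = []")
  case False
  have l: "sorted_wrt (\<ge>) l" "0 \<notin> set l" using assms by (auto simp: Par_def)
  have hd: "1 \<le> hd l" using l(2) False by (cases l) auto
  have ne: "conjugate l \<noteq> []" using False hd by (simp add: conjugate_def)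
  have hd': "hd (conjugate l) = length l"
  proof -
    have "hd (conjugate l) = count_ge l 1" using False hd by (simp add: conjugate_count_ge upt_conv_Cons del: upt_Suc)
    also have "filter (\<lambda>a. 1 \<le> a) l = l" using l(2) by (auto simp: filter_id_conv Suc_le_eq intro: gr0I)
    then have "count_ge l 1 = length l" by (simp add: count_ge_def)
    finally show ?thesis .
  qed
  show ?thesis
  proof (rule nth_equalityI)
    show "length (conjugate (conjugate l)) = length l"
      using ne hd' by (simp add: conjugate_count_ge del: upt_Suc)
    fix i assume "i < length (conjugate (conjugate l))"
    then have i: "i < length l" using ne hd' by (simp add: conjugate_count_ge del: upt_Suc)
    have le: "l ! i \<le> hd l" using l(1) i sorted_ge_le_hd by simp
    have "conjugate (conjugate l) ! i = count_ge (conjugate l) (Suc i)"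
      using ne hd' i by (simp add: conjugate_count_ge del: upt_Suc)
    also have "\<dots> = length (filter (\<lambda>t. i < count_ge l t) [1..<Suc (hd l)])"
      using False by (simp add: count_ge_def conjugate_count_ge filter_map comp_def Suc_le_eq del: upt_Suc)
    also have "\<dots> = card ({t. i < count_ge l t} \<inter> set [1..<Suc (hd l)])"
      by (rule distinct_length_filter) (rule distinct_upt)
    also have "{t. i < count_ge l t} \<inter> set [1..<Suc (hd l)] = {t. t \<le> l ! i} \<inter> {1..<Suc (hd l)}"
      by (simp only: count_ge_galois[OF l(1) i] set_upt)
    also have "\<dots> = {1..l ! i}" using le by auto
    finally show "conjugate (conjugate l) ! i = l ! i" by simp
  qed
qed (simp add: conjugate_def)

lemma Par_compositions: "l \<in> Par n \<Longrightarrow> l \<in> compositions n"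
  by (simp add: Par_def compositions_def)

lemma comp_area_conjugate: "l \<in> Par n \<Longrightarrow> comp_area (conjugate l) = comp_bounce l"
  using comp_bounce_conjugate[of "conjugate l"] conjugate_conjugate[of l n] conjugate_Par[of l n]
  by (simp add: Par_def)

lemma comp_deficit_conjugate:
  assumes "l \<in> Par n"
  shows "comp_deficit (conjugate l) = comp_deficit l"
  using comp_stats[OF Par_compositions[OF assms]] comp_area_conjugate[OF assms]
    comp_stats[OF Par_compositions[OF conjugate_Par[OF assms]]] comp_bounce_conjugate[of l] assms
  by (simp add: Par_def)

section \<open>Passing between the two optimization problems by sorting and conjugation\<close>

lemma rev_sort_Par: "\<alpha> \<in> compositions n \<Longrightarrow> rev (sort \<alpha>) \<in> Par n"
  using sum_list_mset_eq[of "rev (sort \<alpha>)" \<alpha>]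
  by (auto simp: Par_def compositions_def sorted_wrt_rev)

lemma comp_deficit_rev_sort:
  assumes "\<alpha> \<in> compositions n"
  shows "comp_deficit (rev (sort \<alpha>)) = comp_deficit \<alpha> + inv_weight \<alpha>"
proof -
  note P = rev_sort_Par[OF assms]
  have "comp_bounce \<alpha> = comp_bounce (rev (sort \<alpha>)) + inv_weight \<alpha>"
    using P by (intro comp_bounce_mset_eq_sorted) (auto simp: Par_def)
  moreover have "comp_area (rev (sort \<alpha>)) = comp_area \<alpha>" by (intro comp_area_mset_eq) simp
  ultimately show ?thesis
    using comp_stats[OF assms] comp_stats[OF Par_compositions[OF P]] by simp
qed

lemma bounce_optimal_Par:
  assumes "bounce_optimal n D l"
  shows "l \<in> Par n"
proof -
  have "sorted_wrt (\<ge>) l"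
    by (rule sorted_wrt_mono_rel[OF _ bounce_optimal_strict[OF assms]]) simp
  then show ?thesis using assms by (auto simp: bounce_optimal_def compositions_def Par_def)
qed

text \<open>Sorting \<alpha> keeps its area and does not lower its deficit; conjugating then turns
  this area into the bounce of a competitor of \<open>l\<close>.\<close>

lemma bounce_optimal_comp_bounce_le_comp_area:
  assumes "bounce_optimal n D l" "\<alpha> \<in> compositions n" "D \<le> comp_deficit \<alpha>"
  shows "comp_bounce l \<le> comp_area \<alpha>"
proof -
  let ?m = "rev (sort \<alpha>)"
  note P = rev_sort_Par[OF assms(2)]
  have "D \<le> comp_deficit (conjugate ?m)" using comp_deficit_conjugate[OF P] comp_deficit_rev_sort[OF assms(2)] assms(3) by simp
  then have "comp_bounce l \<le> comp_bounce (conjugate ?m)"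
    using assms(1) Par_compositions[OF conjugate_Par[OF P]] by (simp add: bounce_optimal_def)
  also have "\<dots> = comp_area ?m" using comp_bounce_conjugate P by (simp add: Par_def)
  also have "\<dots> = comp_area \<alpha>" by (intro comp_area_mset_eq) simp
  finally show ?thesis .
qed

text \<open>Recovers \<lambda> from an area-optimal \<alpha>. Any competitor is beaten by an optimal
  partition \<open>l\<close>; the conjugate of \<open>l\<close> has the bounce of \<open>l\<close>
  as its area and the same deficit, so \<alpha> has no larger area, and that area is the bounce
  claimed to be least.\<close>

lemma area_optimal_imp_bounce_optimal:
  assumes "area_optimal n D \<alpha>"
  shows "bounce_optimal n D (conjugate (rev (sort \<alpha>)))"
  unfolding bounce_optimal_def
proof (intro conjI ballI impI)
  let ?m = "rev (sort \<alpha>)"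
  have \<alpha>: "\<alpha> \<in> compositions n" "D \<le> comp_deficit \<alpha>" using assms by (auto simp: area_optimal_def)
  note P = rev_sort_Par[OF \<alpha>(1)]
  show "conjugate ?m \<in> compositions n" using P by (intro Par_compositions conjugate_Par)
  show "D \<le> comp_deficit (conjugate ?m)" using comp_deficit_conjugate[OF P] comp_deficit_rev_sort[OF \<alpha>(1)] \<alpha>(2) by simp
  fix \<beta> assume \<beta>: "\<beta> \<in> compositions n" "D \<le> comp_deficit \<beta>"
  obtain l where l: "bounce_optimal n D l" "comp_bounce l \<le> comp_bounce \<beta>" using ex_bounce_optimal[OF \<beta>] by blast
  note L = bounce_optimal_Par[OF l(1)]
  have "comp_bounce (conjugate ?m) = comp_area ?m" using comp_bounce_conjugate P by (simp add: Par_def)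
  also have "\<dots> = comp_area \<alpha>" by (intro comp_area_mset_eq) simp
  also have "\<dots> \<le> comp_area (conjugate l)"
    using assms Par_compositions[OF conjugate_Par[OF L]] comp_deficit_conjugate[OF L] l(1)
    by (simp add: area_optimal_def bounce_optimal_def)
  also have "\<dots> = comp_bounce l" by (rule comp_area_conjugate[OF L])
  finally show "comp_bounce (conjugate ?m) \<le> comp_bounce \<beta>" using l(2) by simp
qed

lemma bounce_optimal_imp_area_optimal:
  assumes "bounce_optimal n D l" "mset \<alpha> = mset (conjugate l)" "comp_deficit \<alpha> = D"
  shows "area_optimal n D \<alpha>"
proof -
  note L = bounce_optimal_Par[OF assms(1)]
  have "comp_area \<alpha> = comp_bounce l" using comp_area_mset_eq[OF assms(2)] comp_area_conjugate[OF L] by simp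
  moreover have "\<alpha> \<in> compositions n"
    using Par_compositions[OF conjugate_Par[OF L]] sum_list_mset_eq[OF assms(2)] mset_eq_setD[OF assms(2)]
    by (simp add: compositions_def)
  ultimately show ?thesis using bounce_optimal_comp_bounce_le_comp_area[OF assms(1)] assms(3) by (simp add: area_optimal_def)
qed


section \<open>Composition paths and bounce compositions\<close>

abbreviation psum :: "nat list \<Rightarrow> nat \<Rightarrow> nat" where
  "psum \<alpha> k \<equiv> sum_list (take k \<alpha>)"

text \<open>Row coordinates of \<open>comp_path\<close>, with rows counted from 1. They are computed
  from the composition alone, because they also serve as the reference for other paths with that
  bounce composition.\<close>

primrec comp_xcoord :: "nat list \<Rightarrow> nat \<Rightarrow> nat" where
  "comp_xcoord [] j = 0"
| "comp_xcoord (a # \<alpha>) j = (if j \<le> a then 0 else a + comp_xcoord \<alpha> (j - a))"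

lemma comp_xcoord_ge: "psum \<alpha> k < j \<Longrightarrow> psum \<alpha> k \<le> comp_xcoord \<alpha> j"
proof (induction \<alpha> arbitrary: j k)
  case (Cons a \<alpha>)
  show ?case
  proof (cases k)
    case (Suc k')
    then have "psum \<alpha> k' < j - a" "\<not> j \<le> a" using Cons.prems by auto
    then show ?thesis using Cons.IH[of k' "j - a"] Suc by simp
  qed simp
qed simp

lemma comp_xcoord_le: "j \<le> psum \<alpha> (Suc k) \<Longrightarrow> comp_xcoord \<alpha> j \<le> psum \<alpha> k"
proof (induction \<alpha> arbitrary: j k)
  case (Cons a \<alpha>)
  show ?case
  proof (cases k)
    case 0
    then show ?thesis using Cons.prems by simp
  next
    case (Suc k')
    then show ?thesis using Cons.IH[of "j - a" k'] Cons.prems by simp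
  qed
qed simp

lemma comp_xcoord_block: "psum \<alpha> k < j \<Longrightarrow> j \<le> psum \<alpha> (Suc k) \<Longrightarrow> comp_xcoord \<alpha> j = psum \<alpha> k"
  using comp_xcoord_ge comp_xcoord_le by (simp add: antisym)

lemma comp_xcoord_less: "1 \<le> j \<Longrightarrow> comp_xcoord \<alpha> j < j"
proof (induction \<alpha> arbitrary: j)
  case (Cons a \<alpha>)
  show ?case
  proof (cases "j \<le> a")
    case False
    then have "comp_xcoord \<alpha> (j - a) < j - a" by (intro Cons.IH) simp
    then show ?thesis using False by simp
  qed (use Cons.prems in simp)
qed simp

lemma psum_Suc: "k < length \<alpha> \<Longrightarrow> psum \<alpha> (Suc k) = psum \<alpha> k + \<alpha> ! k"
  by (simp add: take_Suc_conv_app_nth)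

lemma psum_mono: "i \<le> k \<Longrightarrow> psum \<alpha> i \<le> psum (\<alpha> :: nat list) k"
  using sum_list_append[of "take i \<alpha>" "take (k - i) (drop i \<alpha>)"]
  by (simp add: take_add[symmetric])

lemma psum_le: "psum \<alpha> k \<le> sum_list (\<alpha> :: nat list)"
  using sum_list_append[of "take k \<alpha>" "drop k \<alpha>"] by simp

lemma psum_less:
  assumes "0 \<notin> set \<alpha>" "i < k" "k \<le> length \<alpha>"
  shows "psum \<alpha> i < psum \<alpha> k"
proof -
  have "\<alpha> ! i > 0" using assms by (metis gr0I less_le_trans nth_mem)
  then have "psum \<alpha> i < psum \<alpha> (Suc i)" using assms by (simp add: psum_Suc)
  also have "\<dots> \<le> psum \<alpha> k" using assms(2) by (intro psum_mono) simp
  finally show ?thesis .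
qed

lemma ex_block:
  assumes "1 \<le> j" "j \<le> sum_list \<alpha>"
  obtains k where "k < length \<alpha>" "psum \<alpha> k < j" "j \<le> psum \<alpha> (Suc k)"
  using assms
proof (induction \<alpha> arbitrary: j thesis)
  case (Cons a \<alpha>)
  show ?case
  proof (cases "j \<le> a")
    case True
    then show ?thesis using Cons.prems(1)[of 0] Cons.prems(2) by simp
  next
    case False
    have "\<exists>k. k < length \<alpha> \<and> psum \<alpha> k < j - a \<and> j - a \<le> psum \<alpha> (Suc k)"
      by (rule Cons.IH[of "j - a"]) (use False Cons.prems(2,3) in auto)
    then show ?thesis using Cons.prems(1)[of "Suc k" for k] False by force
  qed
qed simp

lemma comp_xcoord_mono:
  assumes "1 \<le> i" "i \<le> j" "j \<le> sum_list \<alpha>"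
  shows "comp_xcoord \<alpha> i \<le> comp_xcoord \<alpha> j"
proof -
  obtain k where k: "psum \<alpha> k < i" "i \<le> psum \<alpha> (Suc k)"
    using ex_block[of i \<alpha>] assms by auto
  then show ?thesis using comp_xcoord_block[OF k] comp_xcoord_ge[of k \<alpha> j] assms by simp
qed

lemma comp_path_simps:
  "comp_path [] = []"
  "comp_path (a # \<alpha>) = replicate a North @ replicate a East @ comp_path \<alpha>"
  by (simp_all add: comp_path_def)

lemma count_comp_path: "count_list (comp_path \<alpha>) s = sum_list \<alpha>"
  by (induction \<alpha>; cases s) (auto simp: comp_path_simps count_list_replicate)

lemma coords_comp_path:
  "j < sum_list \<alpha> \<Longrightarrow> coords North c (comp_path \<alpha>) ! j = c + comp_xcoord \<alpha> (Suc j)"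
proof (induction \<alpha> arbitrary: j c)
  case (Cons a \<alpha>)
  show ?case
  proof (cases "j < a")
    case True
    then show ?thesis by (simp add: comp_path_simps coords_replicate nth_append)
  next
    case False
    then show ?thesis using Cons.IH[of "j - a" "c + a"] Cons.prems
      by (simp add: comp_path_simps coords_replicate nth_append Suc_diff_le)
  qed
qed simp

lemma comp_path_Dyck: "\<alpha> \<in> compositions n \<Longrightarrow> comp_path \<alpha> \<in> Dyck n"
  using comp_xcoord_less[of "Suc j" \<alpha> for j]
  by (auto simp: Dyck_iff_coords compositions_def count_comp_path coords_comp_path less_Suc_eq_le)

lemma xcoord_comp_path:
  assumes "\<alpha> \<in> compositions n" "j \<in> {1..n}"
  shows "xcoord (comp_path \<alpha>) j = comp_xcoord \<alpha> j"
  using nat1_Suc[OF assms(2)] assms(1)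
  by (auto simp: compositions_def xcoord_coords count_comp_path coords_comp_path)

lemma height_comp_path:
  assumes "\<alpha> \<in> compositions n" "k < length \<alpha>" "psum \<alpha> k < i" "i \<le> psum \<alpha> (Suc k)"
  shows "height (comp_path \<alpha>) i = psum \<alpha> (Suc k)"
proof (rule Dyck_heightI[OF comp_path_Dyck[OF assms(1)]])
  have s: "sum_list \<alpha> = n" using assms(1) by (simp add: compositions_def)
  show "psum \<alpha> (Suc k) \<le> n" using psum_le[of "Suc k" \<alpha>] s by simp
  then show "i \<in> {1..n}" using assms by simp
  fix j assume j: "j \<in> {1..n}"
  show "xcoord (comp_path \<alpha>) j < i \<longleftrightarrow> j \<le> psum \<alpha> (Suc k)"
    using xcoord_comp_path[OF assms(1) j] comp_xcoord_le[of j k \<alpha>] comp_xcoord_ge[of "Suc k" \<alpha> j] assms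
    by (cases "j \<le> psum \<alpha> (Suc k)") auto
qed

lemma bpt_psum:
  assumes "\<And>k. k < length \<alpha> \<Longrightarrow> height p (psum \<alpha> k + 1) = psum \<alpha> (Suc k)" "k \<le> length \<alpha>"
  shows "bpt p k = psum \<alpha> k"
  using assms(2)
proof (induction k)
  case (Suc k)
  then show ?case using assms(1)[of k] by simp
qed simp

lemma bounce_compI:
  assumes "p \<in> Dyck n" "\<alpha> \<in> compositions n"
    and h: "\<And>k. k < length \<alpha> \<Longrightarrow> height p (psum \<alpha> k + 1) = psum \<alpha> (Suc k)"
  shows "bounce_comp p = \<alpha>" "num_bounces p = length \<alpha>"
proof -
  have s: "sum_list \<alpha> = n" "0 \<notin> set \<alpha>" using assms(2) by (auto simp: compositions_def)
  have b: "bpt p k = psum \<alpha> k" if "k \<le> length \<alpha>" for k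
    using bpt_psum[of \<alpha> p k, OF h that] .
  show nb: "num_bounces p = length \<alpha>"
    unfolding num_bounces_def
  proof (rule Least_equality)
    show "bpt p (length \<alpha>) = semilength p" using b s Dyck_semilength[OF assms(1)] by simp
    fix m assume m: "bpt p m = semilength p"
    show "length \<alpha> \<le> m"
    proof (rule ccontr)
      assume "\<not> length \<alpha> \<le> m"
      then show False using psum_less[OF s(2), of m "length \<alpha>"] b[of m] m s Dyck_semilength[OF assms(1)]
        by simp
    qed
  qed
  show "bounce_comp p = \<alpha>"
  proof (rule nth_equalityI)
    show "length (bounce_comp p) = length \<alpha>" by (simp add: bounce_comp_def nb del: upt_Suc)
    fix i assume "i < length (bounce_comp p)"
    then have i: "i < length \<alpha>" by (simp add: bounce_comp_def nb del: upt_Suc)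
    then have "bounce_comp p ! i = bpt p (Suc i) - bpt p i"
      by (simp add: bounce_comp_def nb del: upt_Suc bpt.simps)
    then show "bounce_comp p ! i = \<alpha> ! i" using b[of i] b[of "Suc i"] i
      by (simp add: psum_Suc del: bpt.simps)
  qed
qed

lemma bounce_comp_props:
  assumes "p \<in> Dyck n"
  shows "bounce_comp p \<in> compositions n" "length (bounce_comp p) = num_bounces p"
    "\<And>k. k \<le> num_bounces p \<Longrightarrow> bpt p k = psum (bounce_comp p) k"
proof -
  have step: "bpt p k < bpt p (Suc k) \<and> bpt p (Suc k) \<le> n" if "bpt p k < n" for k
    using Dyck_height_ge[OF assms, of "bpt p k + 1"] Dyck_height_le[OF assms, of "bpt p k + 1"] that
    by simp
  have ex: "\<exists>m. bpt p m = n"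
  proof (rule ccontr)
    assume neg: "\<nexists>m. bpt p m = n"
    \<comment> \<open>Each bounce point below n is followed by a strictly larger one, so a sequence
      that never hits n would be unbounded below n.\<close>
    have "k \<le> bpt p k \<and> bpt p k < n" for k
    proof (induction k)
      case 0
      then show ?case using neg by (metis bpt.simps(1) gr0I le0)
    next
      case (Suc k)
      then show ?case using step[of k] neg by (metis Suc_leI le_less_trans le_neq_implies_less)
    qed
    then show False by (metis not_less)
  qed
  have nbeq: "num_bounces p = (LEAST m. bpt p m = n)"
    by (simp add: num_bounces_def Dyck_semilength[OF assms])
  have last: "bpt p (num_bounces p) = n" unfolding nbeq using ex by (rule LeastI_ex)
  have neq: "bpt p k \<noteq> n" if "k < num_bounces p" for k
    using that unfolding nbeq by (rule not_less_Least)
  have lt: "bpt p k < n" if "k < num_bounces p" for k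
    using that
  proof (induction k)
    case 0
    then show ?case using neq[OF 0] by simp
  next
    case (Suc k)
    then have "bpt p k < n" by simp
    then show ?case using step[of k] neq[OF Suc.prems] by linarith
  qed
  show len: "length (bounce_comp p) = num_bounces p" by (simp add: bounce_comp_def del: upt_Suc)
  have nth: "bounce_comp p ! k = bpt p (Suc k) - bpt p k" if "k < num_bounces p" for k
    using that by (simp add: bounce_comp_def del: upt_Suc bpt.simps)
  show b: "bpt p k = psum (bounce_comp p) k" if "k \<le> num_bounces p" for k
    using that
  proof (induction k)
    case (Suc k)
    then have "bpt p k < bpt p (Suc k)" using step[of k] lt[of k] by (simp del: bpt.simps)
    then show ?case using Suc nth[of k] by (simp add: psum_Suc len del: bpt.simps)
  qed simp
  have "0 \<notin> set (bounce_comp p)"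
  proof
    assume "0 \<in> set (bounce_comp p)"
    then obtain k where k: "k < num_bounces p" "bounce_comp p ! k = 0"
      by (metis in_set_conv_nth len)
    then show False using nth[OF k(1)] step[OF lt[OF k(1)]] by simp
  qed
  moreover have "sum_list (bounce_comp p) = n" using b[of "num_bounces p"] last len by simp
  ultimately show "bounce_comp p \<in> compositions n" by (simp add: compositions_def)
qed

lemma height_bounce_comp:
  assumes "p \<in> Dyck n" "k < length (bounce_comp p)"
  shows "height p (psum (bounce_comp p) k + 1) = psum (bounce_comp p) (Suc k)"
  using bounce_comp_props(3)[OF assms(1), of k] bounce_comp_props(3)[OF assms(1), of "Suc k"]
    bounce_comp_props(2)[OF assms(1)] assms(2) by simp

lemma bounce_comp_comp_path:
  assumes "\<alpha> \<in> compositions n"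
  shows "bounce_comp (comp_path \<alpha>) = \<alpha>" "num_bounces (comp_path \<alpha>) = length \<alpha>"
    "\<And>k. k \<le> length \<alpha> \<Longrightarrow> bpt (comp_path \<alpha>) k = psum \<alpha> k"
proof -
  have h: "height (comp_path \<alpha>) (psum \<alpha> k + 1) = psum \<alpha> (Suc k)" if "k < length \<alpha>" for k
    using psum_less[of \<alpha> k "Suc k"] that assms
    by (intro height_comp_path[OF assms that]) (auto simp: compositions_def)
  show "bounce_comp (comp_path \<alpha>) = \<alpha>" "num_bounces (comp_path \<alpha>) = length \<alpha>"
    using bounce_compI[OF comp_path_Dyck[OF assms] assms] h by auto
  show "bpt (comp_path \<alpha>) k = psum \<alpha> k" if "k \<le> length \<alpha>" for k
    using bpt_psum[of \<alpha> "comp_path \<alpha>" k] h that by auto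
qed

lemma lessThan_add_split:
  fixes g :: "nat \<Rightarrow> nat"
  shows "(\<Sum>j<a + b. g j) = (\<Sum>j<a. g j) + (\<Sum>j<b. g (a + j))"
  by (induction b) (simp_all add: add.assoc)

lemma comp_bounce_psum: "comp_bounce \<alpha> = (\<Sum>k<length \<alpha>. sum_list \<alpha> - psum \<alpha> (Suc k))"
proof (induction \<alpha>)
  case (Cons a \<alpha>)
  then show ?case by (simp add: sum.lessThan_Suc_shift del: sum.lessThan_Suc)
qed simp

lemma sum_atLeast1:
  fixes g :: "nat \<Rightarrow> 'a :: comm_monoid_add"
  shows "(\<Sum>j = 1..n. g j) = (\<Sum>j<n. g (Suc j))"
  by (induction n) (simp_all add: add.commute)

lemma bounce_comp_bounce:
  assumes "p \<in> Dyck n"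
  shows "bounce p = int (comp_bounce (bounce_comp p))"
proof -
  let ?a = "bounce_comp p"
  note b = bounce_comp_props[OF assms]
  have s: "sum_list ?a = n" using b(1) by (simp add: compositions_def)
  have "bounce p = (\<Sum>k<length ?a. int n - int (bpt p (Suc k)))"
    by (simp add: bounce_def sum_atLeast1 Dyck_semilength[OF assms] b(2) del: bpt.simps One_nat_def)
  also have "\<dots> = (\<Sum>k<length ?a. int (sum_list ?a - psum ?a (Suc k)))"
    using s psum_le b(2,3) by (intro sum.cong) (auto simp: of_nat_diff simp del: bpt.simps)
  finally show ?thesis by (simp add: comp_bounce_psum)
qed

text \<open>The number of cells between \<open>p\<close> and its bounce path.\<close>

definition excess :: "path \<Rightarrow> nat" where
  "excess p = (\<Sum>j = 1..semilength p. comp_xcoord (bounce_comp p) j - xcoord p j)"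

text \<open>The room for extra cells in row \<open>j\<close>: one less than the part before the
  block of \<open>j\<close>, since a row reaching further left would change the bounce composition.
  The argument \<open>c\<close> is the room in the first block, which is 0 in the
  application.\<close>

primrec row_cap :: "nat \<Rightarrow> nat list \<Rightarrow> nat \<Rightarrow> nat" where
  "row_cap c [] j = 0"
| "row_cap c (a # \<alpha>) j = (if j \<le> a then c else row_cap (a - 1) \<alpha> (j - a))"

lemma row_cap_first: "j \<le> psum \<alpha> 1 \<Longrightarrow> \<alpha> \<noteq> [] \<Longrightarrow> row_cap c \<alpha> j = c"
  by (cases \<alpha>) auto

lemma row_cap_block:
  assumes "psum \<alpha> (Suc k) < j" "j \<le> psum \<alpha> (Suc (Suc k))" "Suc k < length \<alpha>"
  shows "row_cap c \<alpha> j = \<alpha> ! k - 1"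
  using assms
proof (induction \<alpha> arbitrary: j k c)
  case (Cons a \<alpha>)
  show ?case
  proof (cases k)
    case 0
    then show ?thesis using Cons.prems row_cap_first[of "j - a" \<alpha> "a - 1"] by auto
  next
    case (Suc k')
    then show ?thesis using Cons.prems Cons.IH[of k' "j - a" "a - 1"] by auto
  qed
qed simp

lemma sum_row_cap: "(\<Sum>j<sum_list \<alpha>. row_cap c \<alpha> (Suc j)) = c * (if \<alpha> = [] then 0 else hd \<alpha>) + (\<Sum>j<sum_list (tl \<alpha>). row_cap (hd \<alpha> - 1) (tl \<alpha>) (Suc j))"
proof (cases \<alpha>)
  case (Cons a \<beta>)
  have "(\<Sum>j<a. row_cap c (a # \<beta>) (Suc j)) = (\<Sum>j<a. c)" by (intro sum.cong) auto
  then show ?thesis using Cons by (simp add: lessThan_add_split)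
qed simp

text \<open>The caps contribute (\<alpha>_k - 1) \<alpha>_{k+1} for adjacent parts only, whereas the
  deficit sums such products over all pairs of parts.\<close>

lemma sum_row_cap_le: "(\<Sum>j<sum_list \<alpha>. row_cap c \<alpha> (Suc j)) \<le> c * sum_list \<alpha> + comp_deficit \<alpha>"
proof (induction \<alpha> arbitrary: c)
  case (Cons a \<alpha>)
  then show ?case using Cons.IH[of "a - 1"] unfolding sum_row_cap[of c "a # \<alpha>"]
    by (simp add: algebra_simps)
qed simp

lemma xcoord_le_comp_xcoord:
  assumes "p \<in> Dyck n" "j \<in> {1..n}"
  shows "xcoord p j \<le> comp_xcoord (bounce_comp p) j"
proof -
  let ?a = "bounce_comp p"
  have s: "sum_list ?a = n" using bounce_comp_props(1)[OF assms(1)] by (simp add: compositions_def)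
  obtain k where k: "k < length ?a" "psum ?a k < j" "j \<le> psum ?a (Suc k)"
    using ex_block[of j ?a] s assms(2) by auto
  then have "xcoord p j < psum ?a k + 1"
    using Dyck_galois[OF assms(1) _ assms(2), of "psum ?a k + 1"] height_bounce_comp[OF assms(1) k(1)]
      assms(2) by simp
  then show ?thesis using comp_xcoord_block[OF k(2,3)] by simp
qed

lemma comp_xcoord_minus_xcoord_le_row_cap:
  assumes "p \<in> Dyck n" "j \<in> {1..n}"
  shows "comp_xcoord (bounce_comp p) j - xcoord p j \<le> row_cap 0 (bounce_comp p) j"
proof -
  let ?a = "bounce_comp p"
  have s: "sum_list ?a = n" "0 \<notin> set ?a"
    using bounce_comp_props(1)[OF assms(1)] by (auto simp: compositions_def)
  obtain k where k: "k < length ?a" "psum ?a k < j" "j \<le> psum ?a (Suc k)"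
    using ex_block[of j ?a] s assms(2) by auto
  show ?thesis
  proof (cases k)
    case 0
    then show ?thesis using comp_xcoord_block[OF k(2,3)] by simp
  next
    case (Suc i)
    have "psum ?a i < psum ?a k" using psum_less[OF s(2), of i k] k Suc by simp
    then have "psum ?a i + 1 \<in> {1..n}" using k(2) assms(2) by auto
    then have "\<not> xcoord p j < psum ?a i + 1"
      using Dyck_galois[OF assms(1) _ assms(2), of "psum ?a i + 1"] height_bounce_comp[OF assms(1), of i] k Suc
      by simp
    moreover have "psum ?a k = psum ?a i + ?a ! i" using Suc k(1) by (simp add: psum_Suc)
    ultimately show ?thesis using comp_xcoord_block[OF k(2,3)] row_cap_block[of i ?a j 0] k Suc by simp
  qed
qed

text \<open>Guarantees that subtracting the excess from the deficit of the bounce composition is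
  never truncated.\<close>

lemma excess_le_comp_deficit:
  assumes "p \<in> Dyck n"
  shows "excess p \<le> comp_deficit (bounce_comp p)"
proof -
  let ?a = "bounce_comp p"
  have s: "sum_list ?a = n" using bounce_comp_props(1)[OF assms] by (simp add: compositions_def)
  have "excess p \<le> (\<Sum>j = 1..n. row_cap 0 ?a j)"
    unfolding excess_def Dyck_semilength[OF assms]
    by (intro sum_mono comp_xcoord_minus_xcoord_le_row_cap[OF assms])
  also have "\<dots> \<le> 0 * sum_list ?a + comp_deficit ?a"
    using sum_row_cap_le[of 0 ?a] s by (simp add: sum_atLeast1 del: One_nat_def)
  finally show ?thesis by simp
qed

lemma sum_comp_xcoord: "(\<Sum>j<sum_list \<alpha>. j - comp_xcoord \<alpha> (Suc j)) = comp_area \<alpha>"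
proof (induction \<alpha>)
  case (Cons a \<alpha>)
  have "(\<Sum>j<a. j - comp_xcoord (a # \<alpha>) (Suc j)) = (\<Sum>j<a. j)" by (intro sum.cong) auto
  also have "\<dots> = a choose 2" by (induction a) (simp_all add: choose_two_Suc)
  finally show ?case using Cons by (simp add: lessThan_add_split comp_area_simps Suc_diff_le)
qed (simp add: comp_area_simps)

lemma area_comp_area:
  assumes "p \<in> Dyck n"
  shows "area p = int (comp_area (bounce_comp p)) + int (excess p)"
proof -
  let ?a = "bounce_comp p"
  have s: "sum_list ?a = n" using bounce_comp_props(1)[OF assms] by (simp add: compositions_def)
  have "area p = (\<Sum>j<n. int j - int (xcoord p (Suc j)))"
    by (simp add: area_def Dyck_semilength[OF assms] sum_atLeast1 del: One_nat_def)
  also have "\<dots> = (\<Sum>j<n. int (j - comp_xcoord ?a (Suc j)) + int (comp_xcoord ?a (Suc j) - xcoord p (Suc j)))"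
  proof (rule sum.cong[OF refl])
    fix j assume "j \<in> {..<n}"
    then have "xcoord p (Suc j) \<le> comp_xcoord ?a (Suc j)" using xcoord_le_comp_xcoord[OF assms] by simp
    moreover have "comp_xcoord ?a (Suc j) \<le> j" using comp_xcoord_less[of "Suc j" ?a] by simp
    ultimately show "int j - int (xcoord p (Suc j)) =
        int (j - comp_xcoord ?a (Suc j)) + int (comp_xcoord ?a (Suc j) - xcoord p (Suc j))" by simp
  qed
  also have "\<dots> = int (comp_area ?a) + int (excess p)"
    using sum_comp_xcoord[of ?a] s
    by (simp add: sum.distrib excess_def sum_atLeast1 Dyck_semilength[OF assms] flip: of_nat_sum del: One_nat_def)
  finally show ?thesis .
qed

lemma excess_0_imp_comp_path:
  assumes "p \<in> Dyck n" "excess p = 0"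
  shows "p = comp_path (bounce_comp p)"
proof (rule Dyck_eqI[OF assms(1)])
  note b = bounce_comp_props(1)[OF assms(1)]
  show "comp_path (bounce_comp p) \<in> Dyck n" by (rule comp_path_Dyck[OF b])
  fix j assume j: "j \<in> {1..n}"
  have "comp_xcoord (bounce_comp p) j - xcoord p j = 0"
    using assms(2) j unfolding excess_def Dyck_semilength[OF assms(1)] by (simp only: sum_eq_0_iff finite_atLeastAtMost)
  then show "xcoord p j = xcoord (comp_path (bounce_comp p)) j"
    using xcoord_le_comp_xcoord[OF assms(1) j] xcoord_comp_path[OF b j] by simp
qed

lemma excess_comp_path:
  assumes "\<alpha> \<in> compositions n"
  shows "excess (comp_path \<alpha>) = 0"
  unfolding excess_def Dyck_semilength[OF comp_path_Dyck[OF assms]] bounce_comp_comp_path(1)[OF assms]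
  using xcoord_comp_path[OF assms] by simp

text \<open>The first condition makes column \<open>psum \<alpha> k + 1\<close> reach height
  \<open>psum \<alpha> (Suc k)\<close>; the second stops it there, since the next row starts to the
  right of \<open>psum \<alpha> k\<close>.\<close>

lemma bounce_compI_xcoord:
  assumes "p \<in> Dyck n" "\<alpha> \<in> compositions n"
    and x: "\<And>j. j \<in> {1..n} \<Longrightarrow> xcoord p j \<le> comp_xcoord \<alpha> j"
    and b: "\<And>k. Suc k < length \<alpha> \<Longrightarrow> psum \<alpha> k < xcoord p (psum \<alpha> (Suc k) + 1)"
  shows "bounce_comp p = \<alpha>"
proof (rule bounce_compI(1)[OF assms(1,2)])
  have s: "sum_list \<alpha> = n" "0 \<notin> set \<alpha>" using assms(2) by (auto simp: compositions_def)
  fix k assume k: "k < length \<alpha>"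
  have lt: "psum \<alpha> k < psum \<alpha> (Suc k)" using psum_less[OF s(2), of k "Suc k"] k by simp
  have le: "psum \<alpha> (Suc k) \<le> n" using psum_le[of "Suc k" \<alpha>] s by simp
  show "height p (psum \<alpha> k + 1) = psum \<alpha> (Suc k)"
  proof (rule Dyck_heightI[OF assms(1) _ le])
    show "psum \<alpha> k + 1 \<in> {1..n}" using lt le by simp
    fix j assume j: "j \<in> {1..n}"
    show "xcoord p j < psum \<alpha> k + 1 \<longleftrightarrow> j \<le> psum \<alpha> (Suc k)"
    proof
      assume "j \<le> psum \<alpha> (Suc k)"
      then show "xcoord p j < psum \<alpha> k + 1" using comp_xcoord_le[of j k \<alpha>] x[OF j] by simp
    next
      assume lt': "xcoord p j < psum \<alpha> k + 1"
      show "j \<le> psum \<alpha> (Suc k)"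
      proof (rule ccontr)
        assume gt: "\<not> j \<le> psum \<alpha> (Suc k)"
        then have "Suc k < length \<alpha>" using j s k by (cases "Suc k = length \<alpha>") auto
        then have "psum \<alpha> k < xcoord p (psum \<alpha> (Suc k) + 1)" by (rule b)
        also have "\<dots> \<le> xcoord p j" using gt j by (intro Dyck_xcoord_mono[OF assms(1)]) auto
        finally show False using lt' by simp
      qed
    qed
  qed
qed

text \<open>Builds a path from prescribed numbers \<open>d\<close> of extra cells. The first block
  has no room; the bound by the preceding part preserves the bounce composition, as in
  \<open>row_cap\<close>; the decrease within a block makes the row coordinates increase. Between
  blocks this is automatic, since a shifted row stays to the right of the start of the preceding
  block.\<close>

lemma ex_path_excess:
  assumes a: "\<alpha> \<in> compositions n"
    and d0: "\<And>r. r \<in> {1..psum \<alpha> 1} \<Longrightarrow> d r = 0"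
    and d1: "\<And>k r. Suc k < length \<alpha> \<Longrightarrow> r \<in> {1..\<alpha> ! Suc k} \<Longrightarrow> d (psum \<alpha> (Suc k) + r) < \<alpha> ! k"
    and d2: "\<And>k r s. k < length \<alpha> \<Longrightarrow> 1 \<le> r \<Longrightarrow> r \<le> s \<Longrightarrow> s \<le> \<alpha> ! k \<Longrightarrow>
      d (psum \<alpha> k + s) \<le> d (psum \<alpha> k + r)"
  shows "\<exists>p \<in> Dyck n. bounce_comp p = \<alpha> \<and> (\<forall>j \<in> {1..n}. comp_xcoord \<alpha> j = xcoord p j + d j)"
proof -
  have s: "sum_list \<alpha> = n" "0 \<notin> set \<alpha>" using a by (auto simp: compositions_def)
  let ?x = "\<lambda>j. comp_xcoord \<alpha> j - d j"
  have bd: "psum \<alpha> (k - 1) \<le> ?x j \<and> d j \<le> comp_xcoord \<alpha> j \<and> (1 \<le> k \<longrightarrow> psum \<alpha> (k - 1) < ?x j)"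
    if k: "k < length \<alpha>" "psum \<alpha> k < j" "j \<le> psum \<alpha> (Suc k)" for k j
  proof (cases k)
    case 0
    then show ?thesis using d0[of j] k by simp
  next
    case (Suc i)
    have "d (psum \<alpha> (Suc i) + (j - psum \<alpha> k)) < \<alpha> ! i"
      using k Suc by (intro d1) (auto simp: psum_Suc)
    then have "d j < \<alpha> ! i" using k Suc by simp
    moreover have "comp_xcoord \<alpha> j = psum \<alpha> i + \<alpha> ! i"
      using comp_xcoord_block[OF k(2,3)] psum_Suc[of i \<alpha>] k Suc by simp
    ultimately show ?thesis using Suc by auto
  qed
  have "\<exists>p \<in> Dyck n. \<forall>j \<in> {1..n}. xcoord p j = ?x j"
  proof (rule ex_Dyck_xcoord)
    fix j assume "j \<in> {1..n}"
    then show "?x j < j" using comp_xcoord_less[of j \<alpha>] by simp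
  next
    fix i j :: nat assume ij: "1 \<le> i" "i \<le> j" "j \<le> n"
    obtain k where k: "k < length \<alpha>" "psum \<alpha> k < i" "i \<le> psum \<alpha> (Suc k)"
      using ex_block[of i \<alpha>] s ij by auto
    obtain k' where k': "k' < length \<alpha>" "psum \<alpha> k' < j" "j \<le> psum \<alpha> (Suc k')"
      using ex_block[of j \<alpha>] s ij by auto
    show "?x i \<le> ?x j"
    proof (cases "k = k'")
      case True
      have "d (psum \<alpha> k + (j - psum \<alpha> k)) \<le> d (psum \<alpha> k + (i - psum \<alpha> k))"
        using k k' True ij by (intro d2) (auto simp: psum_Suc)
      then show ?thesis using comp_xcoord_block[OF k(2,3)] comp_xcoord_block[OF k'(2,3)] True k k' by simp
    next
      case False
      have "\<not> k' < k"
      proof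
        assume "k' < k"
        then have "psum \<alpha> (Suc k') \<le> psum \<alpha> k" by (intro psum_mono) simp
        then show False using k k' ij by simp
      qed
      then have "k \<le> k' - 1" using False by simp
      then have "psum \<alpha> k \<le> psum \<alpha> (k' - 1)" by (rule psum_mono)
      also have "\<dots> \<le> ?x j" using bd[OF k'] by simp
      finally show ?thesis using comp_xcoord_block[OF k(2,3)] by simp
    qed
  qed
  then obtain p where p: "p \<in> Dyck n" "\<And>j. j \<in> {1..n} \<Longrightarrow> xcoord p j = ?x j" by blast
  have eq: "comp_xcoord \<alpha> j = xcoord p j + d j" if j: "j \<in> {1..n}" for j
  proof -
    obtain k where k: "k < length \<alpha>" "psum \<alpha> k < j" "j \<le> psum \<alpha> (Suc k)"
      using ex_block[of j \<alpha>] s j by auto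
    then show ?thesis using bd[OF k] p(2)[OF j] by simp
  qed
  have "bounce_comp p = \<alpha>"
  proof (rule bounce_compI_xcoord[OF p(1) a])
    show "xcoord p j \<le> comp_xcoord \<alpha> j" if "j \<in> {1..n}" for j using eq[OF that] by simp
    fix k assume k: "Suc k < length \<alpha>"
    have lt: "psum \<alpha> (Suc k) < psum \<alpha> (Suc (Suc k))" using psum_less[OF s(2), of "Suc k" "Suc (Suc k)"] k by simp
    have le: "psum \<alpha> (Suc (Suc k)) \<le> n" using psum_le[of "Suc (Suc k)" \<alpha>] s by simp
    show "psum \<alpha> k < xcoord p (psum \<alpha> (Suc k) + 1)"
      using bd[of "Suc k" "psum \<alpha> (Suc k) + 1"] p(2)[of "psum \<alpha> (Suc k) + 1"] k lt le by simp
  qed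
  then show ?thesis using p(1) eq by blast
qed


section \<open>Minimal paths\<close>

definition deficit :: "path \<Rightarrow> nat" where
  "deficit p = comp_deficit (bounce_comp p) - excess p"

lemma ab_deficit:
  assumes "p \<in> Dyck n"
  shows "ab p + int (deficit p) = int (n choose 2)"
  using bounce_comp_bounce[OF assms] area_comp_area[OF assms] excess_le_comp_deficit[OF assms]
    comp_stats[OF bounce_comp_props(1)[OF assms]]
  by (simp add: ab_def deficit_def)

lemma ab_eq_iff:
  assumes "p \<in> Dyck n" "q \<in> Dyck n"
  shows "ab p = ab q \<longleftrightarrow> deficit p = deficit q"
  using ab_deficit[OF assms(1)] ab_deficit[OF assms(2)] by linarith

lemma excess_eq:
  assumes "p \<in> Dyck n" "\<And>j. j \<in> {1..n} \<Longrightarrow> comp_xcoord (bounce_comp p) j = xcoord p j + d j"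
  shows "excess p = (\<Sum>j = 1..n. d j)"
  unfolding excess_def Dyck_semilength[OF assms(1)] by (intro sum.cong) (use assms(2) in auto)

text \<open>The surplus \<open>comp_deficit l - D\<close> is absorbed by extra cells. With at most
  one part the deficit is 0 and there is no surplus.\<close>

lemma bounce_optimal_ex_path:
  assumes "bounce_optimal n D l"
  shows "\<exists>p \<in> Dyck n. bounce_comp p = l \<and> deficit p = D"
proof -
  have l: "l \<in> compositions n" "D \<le> comp_deficit l" using assms by (auto simp: bounce_optimal_def)
  show ?thesis
  proof (cases "1 < length l")
    case False
    then have "comp_deficit l = 0" by (cases l; cases "tl l") auto
    then have "deficit (comp_path l) = D"
      using l excess_comp_path[OF l(1)] bounce_comp_comp_path(1)[OF l(1)] by (simp add: deficit_def)
    then show ?thesis using bounce_comp_comp_path(1)[OF l(1)] comp_path_Dyck[OF l(1)] by blast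
  next
    case True
    define e where "e = comp_deficit l - D"
    \<comment> \<open>All \<open>e\<close> cells go to the first row of the second block; the gap
      between the two largest parts leaves room for them.\<close>
    let ?d = "\<lambda>j. if j = psum l 1 + 1 then e else 0"
    have gap: "e + l ! 1 < l ! 0"
      using bounce_optimal_gap[OF assms, of 0] True l(2) by (simp add: e_def)
    have "\<exists>p \<in> Dyck n. bounce_comp p = l \<and> (\<forall>j \<in> {1..n}. comp_xcoord l j = xcoord p j + ?d j)"
    proof (rule ex_path_excess[OF l(1)])
      fix r assume "r \<in> {1..psum l 1}"
      then show "?d r = 0" by simp
    next
      fix k r assume k: "Suc k < length l" "r \<in> {1..l ! Suc k}"
      have pos: "0 < l ! k" using l(1) k by (metis Suc_lessD compositions_def gr0I mem_Collect_eq nth_mem)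
      have "k = 0" if "psum l (Suc k) + r = psum l 1 + 1"
      proof (rule ccontr)
        assume "k \<noteq> 0"
        then have "psum l 1 < psum l (Suc k)" using l(1) k by (intro psum_less) (auto simp: compositions_def)
        then show False using that k by simp
      qed
      then show "?d (psum l (Suc k) + r) < l ! k" using gap pos by auto
    next
      fix k r s assume k: "k < length l" "1 \<le> r" "r \<le> s" "s \<le> l ! k"
      show "?d (psum l k + s) \<le> ?d (psum l k + r)"
      proof (cases "psum l k + s = psum l 1 + 1 \<and> r \<noteq> s")
        case True
        then have "psum l k < psum l 1" using k by simp
        have "k = 0"
        proof (rule ccontr)
          assume "k \<noteq> 0"
          then have "psum l 1 \<le> psum l k" by (intro psum_mono) simp
          then show False using \<open>psum l k < psum l 1\<close> by simp
        qed
        then show ?thesis using True k psum_Suc[of 0 l] by simp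
      qed auto
    qed
    then obtain p where p: "p \<in> Dyck n" "bounce_comp p = l"
      "\<And>j. j \<in> {1..n} \<Longrightarrow> comp_xcoord l j = xcoord p j + ?d j" by blast
    have "psum l 1 < psum l 2" using l(1) True by (intro psum_less) (auto simp: compositions_def)
    also have "\<dots> \<le> n" using psum_le[of 2 l] l(1) by (simp add: compositions_def)
    finally have "excess p = e"
      using excess_eq[OF p(1), of ?d] p(2,3) by (simp add: sum.delta)
    then show ?thesis using p l(2) by (intro bexI[of _ p]) (auto simp: deficit_def e_def)
  qed
qed

text \<open>Fixing \<open>ab\<close> fixes the deficit D of the path, and then \<delta> of its
  bounce composition is at least D. Conversely an optimal composition is the bounce composition of
  some path of deficit exactly D, so paths and compositions have the same least bounce.\<close>

lemma bounce_minimal_iff: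
  "p \<in> bounce_minimal n \<longleftrightarrow> p \<in> Dyck n \<and> bounce_optimal n (deficit p) (bounce_comp p)"
proof
  assume b: "p \<in> bounce_minimal n"
  then have p: "p \<in> Dyck n" by (simp add: bounce_minimal_def)
  let ?a = "bounce_comp p"
  have a: "?a \<in> compositions n" "deficit p \<le> comp_deficit ?a"
    using bounce_comp_props(1)[OF p] by (auto simp: deficit_def)
  obtain l where l: "bounce_optimal n (deficit p) l" "comp_bounce l \<le> comp_bounce ?a" using ex_bounce_optimal[OF a] by blast
  obtain q where q: "q \<in> Dyck n" "bounce_comp q = l" "deficit q = deficit p"
    using bounce_optimal_ex_path[OF l(1)] by blast
  then have "bounce p \<le> bounce q" using b ab_eq_iff[OF q(1) p] by (simp add: bounce_minimal_def)
  then have "comp_bounce ?a \<le> comp_bounce l" using bounce_comp_bounce[OF p] bounce_comp_bounce[OF q(1)] q(2) by simp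
  then have "bounce_optimal n (deficit p) ?a" using l a unfolding bounce_optimal_def by auto
  then show "p \<in> Dyck n \<and> bounce_optimal n (deficit p) ?a" using p by blast
next
  assume r: "p \<in> Dyck n \<and> bounce_optimal n (deficit p) (bounce_comp p)"
  then have p: "p \<in> Dyck n" by blast
  have "bounce p \<le> bounce q" if q: "q \<in> Dyck n" "ab q = ab p" for q
  proof -
    have "deficit p \<le> comp_deficit (bounce_comp q)" using ab_eq_iff[OF q(1) p] q(2) by (simp add: deficit_def)
    then show ?thesis using r bounce_comp_props(1)[OF q(1)] bounce_comp_bounce[OF p] bounce_comp_bounce[OF q(1)]
      by (simp add: bounce_optimal_def)
  qed
  then show "p \<in> bounce_minimal n" using p by (simp add: bounce_minimal_def)
qed

text \<open>Comparison with a composition path of least area and of exactly the same deficit leaves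
  no extra cells, so the path is itself a composition path.\<close>

lemma area_minimal_iff:
  "p \<in> area_minimal n \<longleftrightarrow> (\<exists>\<alpha>. p = comp_path \<alpha> \<and> area_optimal n (comp_deficit \<alpha>) \<alpha>)"
proof
  assume m: "p \<in> area_minimal n"
  then have p: "p \<in> Dyck n" by (simp add: area_minimal_def)
  let ?a = "bounce_comp p"
  have a: "?a \<in> compositions n" "deficit p \<le> comp_deficit ?a"
    using bounce_comp_props(1)[OF p] by (auto simp: deficit_def)
  obtain \<beta> where \<beta>: "area_optimal n (deficit p) \<beta>" "comp_deficit \<beta> = deficit p" using area_optimal_ex_exact[OF a] by blast
  have c: "\<beta> \<in> compositions n" using \<beta>(1) by (simp add: area_optimal_def)
  note q = comp_path_Dyck[OF c] excess_comp_path[OF c] bounce_comp_comp_path(1)[OF c]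
  have "deficit (comp_path \<beta>) = deficit p" using q \<beta>(2) by (simp add: deficit_def)
  then have "area p \<le> area (comp_path \<beta>)"
    using m ab_eq_iff[OF q(1) p] q(1) by (simp add: area_minimal_def)
  then have "comp_area ?a + excess p \<le> comp_area \<beta>" using area_comp_area[OF p] area_comp_area[OF q(1)] q(2,3) by simp
  moreover have "comp_area \<beta> \<le> comp_area ?a" using \<beta>(1) a by (simp add: area_optimal_def)
  ultimately have e: "excess p = 0" "comp_area ?a = comp_area \<beta>" by auto
  then have "area_optimal n (comp_deficit ?a) ?a" using \<beta>(1) a by (auto simp: area_optimal_def deficit_def)
  then show "\<exists>\<alpha>. p = comp_path \<alpha> \<and> area_optimal n (comp_deficit \<alpha>) \<alpha>" using excess_0_imp_comp_path[OF p e(1)] by blast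
next
  assume "\<exists>\<alpha>. p = comp_path \<alpha> \<and> area_optimal n (comp_deficit \<alpha>) \<alpha>"
  then obtain \<alpha> where \<alpha>: "p = comp_path \<alpha>" "area_optimal n (comp_deficit \<alpha>) \<alpha>" by blast
  then have c: "\<alpha> \<in> compositions n" by (simp add: area_optimal_def)
  note q = comp_path_Dyck[OF c] excess_comp_path[OF c] bounce_comp_comp_path(1)[OF c]
  have "area p \<le> area r" if r: "r \<in> Dyck n" "ab r = ab p" for r
  proof -
    have "comp_deficit \<alpha> \<le> comp_deficit (bounce_comp r)"
      using ab_eq_iff[OF r(1) q(1)] r(2) q(2,3) \<alpha>(1) by (simp add: deficit_def)
    then have "comp_area \<alpha> \<le> comp_area (bounce_comp r)" using \<alpha>(2) bounce_comp_props(1)[OF r(1)] by (simp add: area_optimal_def)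
    then show ?thesis using area_comp_area[OF r(1)] area_comp_area[OF q(1)] q(2,3) \<alpha>(1) by simp
  qed
  then show "p \<in> area_minimal n" using q(1) \<alpha>(1) by (simp add: area_minimal_def)
qed

section \<open>Operators\<close>

lemma shift_rowI:
  assumes "p \<in> Dyck n" "q \<in> Dyck n" "i \<in> {1..n}"
    and "\<And>j. j \<in> {1..n} \<Longrightarrow> int (xcoord q j) = int (xcoord p j) + (if j = i then d else 0)"
  shows "shift_row d i p = Some q"
proof -
  let ?P = "\<lambda>\<tau>. \<tau> \<in> Dyck n \<and> (\<forall>j \<in> {1..n}. int (xcoord \<tau> j) = int (xcoord p j) + (if j = i then d else 0))"
  have P: "?P q" using assms by blast
  have "(THE \<tau>. ?P \<tau>) = q"
  proof (rule the_equality)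
    show "?P q" by (rule P)
  next
    fix \<tau> assume \<tau>: "?P \<tau>"
    have "xcoord \<tau> j = xcoord q j" if "j \<in> {1..n}" for j
    proof -
      have "int (xcoord \<tau> j) = int (xcoord q j)" using \<tau> assms(4) that by (metis (no_types, lifting))
      then show ?thesis by simp
    qed
    then show "\<tau> = q" using \<tau> assms(2) by (intro Dyck_eqI) auto
  qed
  then show ?thesis using P assms(3) unfolding shift_row_def Let_def Dyck_semilength[OF assms(1)]
    by (metis (no_types, lifting))
qed

lemma shift_rowD:
  assumes "p \<in> Dyck n" "shift_row d i p = Some q"
  shows "q \<in> Dyck n" "i \<in> {1..n}"
    "\<And>j. j \<in> {1..n} \<Longrightarrow> int (xcoord q j) = int (xcoord p j) + (if j = i then d else 0)"
proof -
  let ?P = "\<lambda>\<tau>. \<tau> \<in> Dyck n \<and> (\<forall>j \<in> {1..n}. int (xcoord \<tau> j) = int (xcoord p j) + (if j = i then d else 0))"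
  have i: "i \<in> {1..n}" and ex: "\<exists>\<tau>. ?P \<tau>"
    using assms(2) unfolding shift_row_def Let_def Dyck_semilength[OF assms(1)]
    by (auto split: if_splits)
  then obtain \<tau> where \<tau>: "?P \<tau>" by blast
  then have "shift_row d i p = Some \<tau>" by (intro shift_rowI[OF assms(1) _ i]) blast+
  then have "q = \<tau>" using assms(2) by simp
  then show "q \<in> Dyck n" "\<And>j. j \<in> {1..n} \<Longrightarrow> int (xcoord q j) = int (xcoord p j) + (if j = i then d else 0)"
    using \<tau> by auto
  show "i \<in> {1..n}" by (rule i)
qed

lemma shift_colI:
  assumes "p \<in> Dyck n" "q \<in> Dyck n" "i \<in> {1..n}"
    and "\<And>j. j \<in> {1..n} \<Longrightarrow> int (height q j) = int (height p j) + (if j = i then d else 0)"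
  shows "shift_col d i p = Some q"
proof -
  let ?P = "\<lambda>\<tau>. \<tau> \<in> Dyck n \<and> (\<forall>j \<in> {1..n}. int (height \<tau> j) = int (height p j) + (if j = i then d else 0))"
  have P: "?P q" using assms by blast
  have "(THE \<tau>. ?P \<tau>) = q"
  proof (rule the_equality)
    show "?P q" by (rule P)
  next
    fix \<tau> assume \<tau>: "?P \<tau>"
    have "height \<tau> j = height q j" if "j \<in> {1..n}" for j
    proof -
      have "int (height \<tau> j) = int (height q j)" using \<tau> assms(4) that by (metis (no_types, lifting))
      then show ?thesis by simp
    qed
    then show "\<tau> = q" using \<tau> assms(2) by (intro Dyck_eqI_height) auto
  qed
  then show ?thesis using P assms(3) unfolding shift_col_def Let_def Dyck_semilength[OF assms(1)]
    by (metis (no_types, lifting))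
qed

text \<open>A power of an operator passes through intermediate paths, each of which must be Dyck.
  Between two Dyck paths that differ in one row, every value in between is admissible.\<close>

lemma interpolate_xcoord:
  assumes "p \<in> Dyck n" "q \<in> Dyck n" "\<And>j. j \<in> {1..n} \<Longrightarrow> j \<noteq> i \<Longrightarrow> xcoord q j = xcoord p j"
    "xcoord p i \<le> y" "y \<le> xcoord q i" "i \<in> {1..n}"
  shows "\<exists>r \<in> Dyck n. \<forall>j \<in> {1..n}. xcoord r j = (if j = i then y else xcoord p j)"
proof (rule ex_Dyck_xcoord)
  fix j assume "j \<in> {1..n}"
  then show "(if j = i then y else xcoord p j) < j"
    using Dyck_xcoord_less[OF assms(1), of j] Dyck_xcoord_less[OF assms(2), of j] assms(5) by auto
next
  fix k j assume kj: "1 \<le> k" "k \<le> j" "j \<le> n"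
  have m: "xcoord p k \<le> xcoord p j" "xcoord q k \<le> xcoord q j"
    using Dyck_xcoord_mono[OF assms(1) kj] Dyck_xcoord_mono[OF assms(2) kj] by auto
  have e: "xcoord q k = xcoord p k" if "k \<noteq> i" using that assms(3)[of k] kj by simp
  have e': "xcoord q j = xcoord p j" if "j \<noteq> i" using that assms(3)[of j] kj by simp
  show "(if k = i then y else xcoord p k) \<le> (if j = i then y else xcoord p j)"
    using m assms(4,5) e e' by (cases "k = i"; cases "j = i") auto
qed

lemma opA_simps: "opA i None = None" "opA i (Some p) = shift_row (- 1) i p"
  by (simp_all add: opA_def)

lemma opA_pow:
  assumes "p \<in> Dyck n" "q \<in> Dyck n" "i \<in> {1..n}"
    and "\<And>j. j \<in> {1..n} \<Longrightarrow> xcoord p j = xcoord q j + (if j = i then k else 0)"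
  shows "(opA i ^^ k) (Some p) = Some q"
  using assms(2,4)
proof (induction k arbitrary: q)
  case 0
  then show ?case using Dyck_eqI[OF assms(1), of q] by simp
next
  case (Suc k)
  have "\<exists>r \<in> Dyck n. \<forall>j \<in> {1..n}. xcoord r j = (if j = i then xcoord q i + 1 else xcoord q j)"
    using Suc.prems assms by (intro interpolate_xcoord[of q n p]) auto
  then obtain r where r: "r \<in> Dyck n" "\<And>j. j \<in> {1..n} \<Longrightarrow> xcoord r j = (if j = i then xcoord q i + 1 else xcoord q j)"
    by blast
  have "(opA i ^^ k) (Some p) = Some r" using Suc.prems r by (intro Suc.IH) auto
  moreover have "shift_row (- 1) i r = Some q" using r Suc.prems assms(3) by (intro shift_rowI[of _ n]) auto
  ultimately show ?case by (simp add: opA_simps)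
qed

lemma opA_inv_pow:
  assumes "p \<in> Dyck n" "q \<in> Dyck n" "i \<in> {1..n}"
    and "\<And>j. j \<in> {1..n} \<Longrightarrow> xcoord q j = xcoord p j + (if j = i then k else 0)"
  shows "(opA_inv i ^^ k) (Some p) = Some q"
  using assms(2,4)
proof (induction k arbitrary: q)
  case 0
  then show ?case using Dyck_eqI[OF assms(1), of q] by simp
next
  case (Suc k)
  have "\<exists>r \<in> Dyck n. \<forall>j \<in> {1..n}. xcoord r j = (if j = i then xcoord p i + k else xcoord p j)"
    using Suc.prems assms by (intro interpolate_xcoord[of p n q]) auto
  then obtain r where r: "r \<in> Dyck n" "\<And>j. j \<in> {1..n} \<Longrightarrow> xcoord r j = (if j = i then xcoord p i + k else xcoord p j)"
    by blast
  have "(opA_inv i ^^ k) (Some p) = Some r" using Suc.prems r by (intro Suc.IH) auto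
  moreover have "shift_row 1 i r = Some q" using r Suc.prems assms(3) by (intro shift_rowI[of _ n]) auto
  ultimately show ?case by (simp add: opA_inv_def[of _ "Some r"])
qed

lemma interpolate_height:
  assumes "p \<in> Dyck n" "q \<in> Dyck n" "\<And>j. j \<in> {1..n} \<Longrightarrow> j \<noteq> i \<Longrightarrow> height q j = height p j"
    "height p i \<le> y" "y \<le> height q i" "i \<in> {1..n}"
  shows "\<exists>r \<in> Dyck n. \<forall>j \<in> {1..n}. height r j = (if j = i then y else height p j)"
proof (rule ex_Dyck_height)
  fix j assume j: "j \<in> {1..n}"
  then show "j \<le> (if j = i then y else height p j) \<and> (if j = i then y else height p j) \<le> n"
    using Dyck_height_ge[OF assms(1), of j] Dyck_height_le[OF assms(1), of j]
      Dyck_height_le[OF assms(2), of j] assms(4,5) by auto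
next
  fix k j assume kj: "1 \<le> k" "k \<le> j" "j \<le> n"
  have m: "height p k \<le> height p j" "height q k \<le> height q j"
    using Dyck_height_mono[OF assms(1) kj] Dyck_height_mono[OF assms(2) kj] by auto
  have e: "height q k = height p k" if "k \<noteq> i" using that assms(3)[of k] kj by simp
  have e': "height q j = height p j" if "j \<noteq> i" using that assms(3)[of j] kj by simp
  show "(if k = i then y else height p k) \<le> (if j = i then y else height p j)"
    using m assms(4,5) e e' by (cases "k = i"; cases "j = i") auto
qed

lemma opC_pow:
  assumes "p \<in> Dyck n" "q \<in> Dyck n" "i \<in> {1..n}"
    and "\<And>j. j \<in> {1..n} \<Longrightarrow> height q j = height p j + (if j = i then k else 0)"
  shows "(opC i ^^ k) (Some p) = Some q"
  using assms(2,4)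
proof (induction k arbitrary: q)
  case 0
  then show ?case using Dyck_eqI_height[OF assms(1), of q] by simp
next
  case (Suc k)
  have "\<exists>r \<in> Dyck n. \<forall>j \<in> {1..n}. height r j = (if j = i then height p i + k else height p j)"
    using Suc.prems assms by (intro interpolate_height[of p n q]) auto
  then obtain r where r: "r \<in> Dyck n" "\<And>j. j \<in> {1..n} \<Longrightarrow> height r j = (if j = i then height p i + k else height p j)"
    by blast
  have "(opC i ^^ k) (Some p) = Some r" using Suc.prems r by (intro Suc.IH) auto
  moreover have "shift_col 1 i r = Some q" using r Suc.prems assms(3) by (intro shift_colI[of _ n]) auto
  ultimately show ?case by (simp add: opC_def[of _ "Some r"])
qed

lemma opA_None: "(opA i ^^ k) None = None"
  by (induction k) (auto simp: opA_simps)

lemma opA_pow_SomeD: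
  assumes "p \<in> Dyck n" "(opA i ^^ k) (Some p) = Some q"
  shows "q \<in> Dyck n \<and> (\<forall>j \<in> {1..n}. xcoord p j = xcoord q j + (if j = i then k else 0))"
  using assms(2)
proof (induction k arbitrary: q)
  case 0
  then show ?case using assms(1) by simp
next
  case (Suc k)
  obtain r where r: "(opA i ^^ k) (Some p) = Some r" "shift_row (- 1) i r = Some q"
    using Suc.prems by (cases "(opA i ^^ k) (Some p)") (auto simp: opA_simps)
  have IH: "r \<in> Dyck n" "\<forall>j \<in> {1..n}. xcoord p j = xcoord r j + (if j = i then k else 0)"
    using Suc.IH[OF r(1)] by auto
  note s = shift_rowD[OF IH(1) r(2)]
  show ?case
  proof (intro conjI ballI)
    show "q \<in> Dyck n" by (rule s(1))
    fix j assume j: "j \<in> {1..n}"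
    then show "xcoord p j = xcoord q j + (if j = i then Suc k else 0)"
      using s(3)[OF j] IH(2) by (auto split: if_splits)
  qed
qed

lemma fold_opA_SomeD:
  assumes "p \<in> Dyck n" "fold (\<lambda>x. opA (g x) ^^ f x) xs (Some p) = Some q"
  shows "q \<in> Dyck n \<and> (\<forall>j \<in> {1..n}. xcoord p j = xcoord q j + sum_list (map (\<lambda>x. if g x = j then f x else 0) xs))"
  using assms
proof (induction xs arbitrary: p)
  case Nil
  then show ?case by simp
next
  case (Cons x xs)
  have None: "fold (\<lambda>x. opA (g x) ^^ f x) ys None = None" for ys
    by (induction ys) (auto simp: opA_None)
  obtain r where r: "(opA (g x) ^^ f x) (Some p) = Some r"
    using Cons.prems(2) None by (cases "(opA (g x) ^^ f x) (Some p)") auto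
  note r' = opA_pow_SomeD[OF Cons.prems(1) r]
  have "fold (\<lambda>x. opA (g x) ^^ f x) xs (Some r) = Some q" using Cons.prems(2) r by simp
  from Cons.IH[OF _ this] r' show ?case by auto
qed

text \<open>Rows are lowered in ascending order, so the intermediate path agrees with
  \<open>q\<close> up to the current row and with \<open>p\<close> above it. It is a Dyck path
  because the coordinates of \<open>q\<close> are at most those of \<open>p\<close>.\<close>

lemma fold_opA:
  assumes "p \<in> Dyck n" "q \<in> Dyck n" "sorted_wrt (<) (map g xs)" "g ` set xs \<subseteq> {1..n}"
    and "\<And>j. j \<in> {1..n} \<Longrightarrow> j \<notin> g ` set xs \<Longrightarrow> xcoord p j = xcoord q j"
    and "\<And>x. x \<in> set xs \<Longrightarrow> xcoord p (g x) = xcoord q (g x) + f x"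
  shows "fold (\<lambda>x. opA (g x) ^^ f x) xs (Some p) = Some q"
  using assms
proof (induction xs arbitrary: p)
  case Nil
  then show ?case using Dyck_eqI[of p n q] by simp
next
  case (Cons x xs)
  have gx: "g x \<in> {1..n}" using Cons.prems(4) by simp
  have lt: "\<And>y. y \<in> set xs \<Longrightarrow> g x < g y" using Cons.prems(3) by auto
  let ?x = "\<lambda>j. if j = g x then xcoord q j else xcoord p j"
  have le: "xcoord q j \<le> xcoord p j" if "j \<in> {1..n}" for j
    using Cons.prems(5)[of j] Cons.prems(6) that by (cases "j \<in> g ` set (x # xs)") auto
  have "\<exists>r \<in> Dyck n. \<forall>j \<in> {1..n}. xcoord r j = ?x j"
  proof (rule ex_Dyck_xcoord)
    fix j assume "j \<in> {1..n}"
    then show "?x j < j" using Dyck_xcoord_less[OF Cons.prems(1)] Dyck_xcoord_less[OF Cons.prems(2)] by auto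
  next
    fix i j assume ij: "1 \<le> i" "i \<le> j" "j \<le> n"
    have m: "xcoord p i \<le> xcoord p j" "xcoord q i \<le> xcoord q j"
      using Dyck_xcoord_mono[OF Cons.prems(1) ij] Dyck_xcoord_mono[OF Cons.prems(2) ij] by auto
    have "xcoord p i = xcoord q i" if "i < g x"
    proof -
      have "i \<notin> g ` set (x # xs)" using that lt by fastforce
      then show ?thesis using Cons.prems(5)[of i] ij by simp
    qed
    then show "?x i \<le> ?x j" using m le[of i] ij by (cases "i = g x"; cases "j = g x") auto
  qed
  then obtain r where r: "r \<in> Dyck n" "\<And>j. j \<in> {1..n} \<Longrightarrow> xcoord r j = ?x j" by blast
  have "(opA (g x) ^^ f x) (Some p) = Some r"
    using Cons.prems(6)[of x] gx r by (intro opA_pow[OF Cons.prems(1)]) auto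
  moreover have "fold (\<lambda>x. opA (g x) ^^ f x) xs (Some r) = Some q"
  proof (rule Cons.IH[OF r(1) Cons.prems(2)])
    show "sorted_wrt (<) (map g xs)" "g ` set xs \<subseteq> {1..n}" using Cons.prems(3,4) by auto
    fix j assume "j \<in> {1..n}" "j \<notin> g ` set xs"
    then show "xcoord r j = xcoord q j" using r(2)[of j] Cons.prems(5)[of j] by auto
  next
    fix y assume y: "y \<in> set xs"
    then have "g y \<in> {1..n}" "g y \<noteq> g x" using Cons.prems(4) lt[OF y] by auto
    then show "xcoord r (g y) = xcoord q (g y) + f y" using r(2)[of "g y"] Cons.prems(6)[of y] y by auto
  qed
  ultimately show ?case by simp
qed


section \<open>Moving parts of a composition\<close>

lemma comp_xcoord_append:
  "comp_xcoord (w @ v) j = (if j \<le> sum_list w then comp_xcoord w j else sum_list w + comp_xcoord v (j - sum_list w))"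
proof (induction w arbitrary: j)
  case (Cons a w)
  then show ?case by (cases "j \<le> a") (auto simp: diff_diff_left)
qed (cases "j = 0"; cases v; auto)

lemma height_comp_path_psum:
  assumes "\<alpha> \<in> compositions n" "k \<le> length \<alpha>"
  shows "height (comp_path \<alpha>) (psum \<alpha> k) = psum \<alpha> k"
proof (cases k)
  case 0
  then show ?thesis by (simp add: height_def)
next
  case (Suc i)
  then show ?thesis using assms psum_less[of \<alpha> i k]
    by (intro height_comp_path[OF assms(1), of i, folded Suc]) (auto simp: compositions_def)
qed

text \<open>On a composition path the height at a bounce point is the bounce point itself, so the
  number s in the definition of S is the next part \<open>b\<close>. Moving row b_i to the right by
  \<open>b\<close> takes one row off the block; raising column b_i by \<open>b\<close> then adds a
  column to the next block.\<close>

lemma opS_comp_path: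
  assumes a: "w @ Suc b # b # u \<in> compositions n"
  shows "opS (length w + 1) (Some (comp_path (w @ Suc b # b # u))) = Some (comp_path (w @ b # Suc b # u))"
proof -
  let ?a = "w @ Suc b # b # u" and ?b = "w @ b # Suc b # u"
  let ?p = "comp_path ?a" and ?q = "comp_path ?b" and ?S = "sum_list w"
  have b: "?b \<in> compositions n" and b1: "1 \<le> b" using a by (auto simp: compositions_def)
  have n: "?S + b + Suc b \<le> n" using a by (auto simp: compositions_def)
  note pD = comp_path_Dyck[OF a] and qD = comp_path_Dyck[OF b]
  note ca = bounce_comp_comp_path[OF a]
  have bp: "bpt ?p (length w) = ?S" "bpt ?p (length w + 1) = ?S + Suc b"
      "bpt ?p (length w + 2) = ?S + b + Suc b"
    using ca(3)[of "length w"] ca(3)[of "length w + 1"] ca(3)[of "length w + 2"] by simp_all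
  have h: "height ?p ?S = ?S" "height ?p (?S + Suc b) = ?S + Suc b"
    using height_comp_path_psum[OF a, of "length w"] height_comp_path_psum[OF a, of "length w + 1"]
    by simp_all
  let ?i = "?S + Suc b"
  \<comment> \<open>The path between the two powers: only row \<open>?i\<close> has moved, by
    \<open>b\<close> to the right.\<close>
  let ?x = "\<lambda>j. if j = ?i then ?S + b else comp_xcoord ?a j"
  have bs: "comp_xcoord ?a j = (if j \<le> ?S then comp_xcoord w j else if j \<le> ?S + Suc b then ?S else
      if j \<le> ?S + b + Suc b then ?S + Suc b else ?S + b + Suc b + comp_xcoord u (j - (?S + b + Suc b)))" for j
    by (auto simp: comp_xcoord_append diff_diff_left algebra_simps)
  have bs': "comp_xcoord ?b j = (if j \<le> ?S then comp_xcoord w j else if j \<le> ?S + b then ?S else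
      if j \<le> ?S + b + Suc b then ?S + b else ?S + b + Suc b + comp_xcoord u (j - (?S + b + Suc b)))" for j
    by (auto simp: comp_xcoord_append diff_diff_left algebra_simps)
  have sum_a: "sum_list ?a = n" using a by (simp add: compositions_def)
  have bw: "comp_xcoord w j \<le> ?S" for j
    by (induction w arbitrary: j) auto
  have "\<exists>r \<in> Dyck n. \<forall>j \<in> {1..n}. xcoord r j = ?x j"
  proof (rule ex_Dyck_xcoord)
    fix j assume "j \<in> {1..n}"
    then show "?x j < j" using comp_xcoord_less[of j ?a] by auto
  next
    fix j k assume jk: "1 \<le> j" "j \<le> k" "k \<le> n"
    have "comp_xcoord ?a j \<le> comp_xcoord ?a k" using comp_xcoord_mono[of j k ?a] jk sum_a by simp
    moreover have "comp_xcoord ?a k \<ge> ?S + b" if "k > ?i"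
      using that by (simp add: bs)
    moreover have "comp_xcoord ?a j \<le> ?S" if "j \<le> ?i"
      using that bw[of j] by (simp add: bs)
    ultimately show "?x j \<le> ?x k" using jk by (cases "j = ?i"; cases "k = ?i") fastforce+
  qed
  then obtain r where r: "r \<in> Dyck n" "\<And>j. j \<in> {1..n} \<Longrightarrow> xcoord r j = ?x j" by blast
  have A: "(opA_inv ?i ^^ b) (Some ?p) = Some r"
    using n r xcoord_comp_path[OF a] by (intro opA_inv_pow[OF pD r(1)]) (auto simp: bs)
  have C: "(opC ?i ^^ b) (Some r) = Some ?q"
  proof (rule opC_pow[OF r(1) qD])
    show "?i \<in> {1..n}" using n by simp
    fix i assume i: "i \<in> {1..n}"
    have hi: "height ?q ?i = ?S + b + Suc b"
      using height_comp_path[OF b, of "length w + 1" ?i] b1 by simp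
    have "height r i = height ?q i - (if i = ?i then b else 0)"
    proof (rule Dyck_heightI[OF r(1) i])
      show "height ?q i - (if i = ?i then b else 0) \<le> n"
        using Dyck_height_le[OF qD i] by simp
      fix j assume j: "j \<in> {1..n}"
      have g: "comp_xcoord ?b j < i \<longleftrightarrow> j \<le> height ?q i"
        using Dyck_galois[OF qD i j] xcoord_comp_path[OF b j] by simp
      show "xcoord r j < i \<longleftrightarrow> j \<le> height ?q i - (if i = ?i then b else 0)"
      proof (cases "i = ?i")
        case True
        then show ?thesis using hi r(2)[OF j] bw[of j] by (auto simp: bs)
      next
        case False
        then show ?thesis unfolding r(2)[OF j] using g by (auto simp: bs bs' split: if_splits)
      qed
    qed
    then show "height ?q i = height r i + (if i = ?i then b else 0)" using hi by auto
  qed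
  have nb: "num_bounces ?p = length w + 2 + length u" using ca(2) by simp
  have s: "bpt ?p (length w + 1 + 1) - height ?p (bpt ?p (length w + 1)) = b"
    using bp h by simp
  have ne: "height ?p (bpt ?p (length w + 1 - 1)) \<noteq> bpt ?p (length w + 1)"
    using bp h by simp
  show ?thesis
    using nb s ne A C bp(2) unfolding opS_def by (simp del: bpt.simps)
qed

lemma fold_opS:
  assumes "w @ Suc b # replicate k b @ u \<in> compositions n"
  shows "fold (\<lambda>j. opS (length w + j)) [1..<Suc k] (Some (comp_path (w @ Suc b # replicate k b @ u)))
    = Some (comp_path (w @ replicate k b @ Suc b # u))"
  using assms
proof (induction k arbitrary: u)
  case (Suc k)
  have rep: "replicate (Suc k) b = replicate k b @ [b]" by (simp add: replicate_append_same)
  have "fold (\<lambda>j. opS (length w + j)) [1..<Suc k] (Some (comp_path (w @ Suc b # replicate k b @ b # u)))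
    = Some (comp_path (w @ replicate k b @ Suc b # b # u))"
    using Suc.prems by (intro Suc.IH) (simp only: rep append_assoc append_Cons append_Nil)
  moreover have "opS (length (w @ replicate k b) + 1) (Some (comp_path ((w @ replicate k b) @ Suc b # b # u)))
    = Some (comp_path ((w @ replicate k b) @ b # Suc b # u))"
    using Suc.prems by (intro opS_comp_path) (auto simp: compositions_def)
  ultimately show ?case by (simp add: replicate_app_Cons_same)
qed simp

text \<open>The first \<open>k\<close> exponents c_j are 1 and use up the budget, so m \<ge> k and d
  = 0. When parts of size at least \<open>Suc b\<close> follow, m exceeds \<open>k\<close>, but the
  additional exponents are 0.\<close>

lemma opB_comp_path:
  assumes a: "w @ Suc b # replicate k b @ u \<in> compositions n" and ne: "replicate k b @ u \<noteq> []"
  shows "opB (length w + 1) k (Some (comp_path (w @ Suc b # replicate k b @ u)))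
    = Some (comp_path (w @ replicate k b @ Suc b # u))"
proof -
  let ?a = "w @ Suc b # replicate k b @ u" and ?i = "length w + 1"
  define c where "c = (\<lambda>j. ?a ! (?i - 1) - ?a ! (?i + j - 1))"
  define M where "M = Max {m. m \<le> length ?a - ?i \<and> (\<Sum>j = 1..m. c j) \<le> k}"
  have c1: "c j = 1" if "j \<in> {1..k}" for j
    using that by (cases j) (auto simp: c_def nth_append)
  have sk: "(\<Sum>j = 1..k. c j) = k" using c1 by simp
  have fin: "finite {m. m \<le> length ?a - ?i \<and> (\<Sum>j = 1..m. c j) \<le> k}" by simp
  have kin: "k \<in> {m. m \<le> length ?a - ?i \<and> (\<Sum>j = 1..m. c j) \<le> k}" using sk by simp
  have kM: "k \<le> M" unfolding M_def by (rule Max_ge[OF fin kin])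
  have Min: "M \<in> {m. m \<le> length ?a - ?i \<and> (\<Sum>j = 1..m. c j) \<le> k}"
    unfolding M_def using fin kin by (intro Max_in) auto
  have split: "(\<Sum>j = 1..M. c j) = (\<Sum>j = 1..k. c j) + (\<Sum>j = Suc k..M. c j)"
    using kM by (subst sum.union_disjoint[symmetric]) (auto intro!: sum.cong)
  then have z: "(\<Sum>j = Suc k..M. c j) = 0" "(\<Sum>j = 1..M. c j) = k" using Min sk by auto
  have c0: "c j = 0" if "j \<in> {Suc k..M}" for j using z(1) that by (simp add: sum_eq_0_iff)
  have id: "fold (\<lambda>j. opS (?i + j - 1) ^^ c j) [Suc k..<Suc M] s = s" for s
  proof -
    have "fold (\<lambda>j. opS (?i + j - 1) ^^ c j) [Suc k..<Suc M] s = fold (\<lambda>j. id) [Suc k..<Suc M] s"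
      using c0 by (intro fold_cong refl) (auto simp del: upt_Suc)
    then show ?thesis by (simp add: fold_id del: upt_Suc)
  qed
  have f1: "fold (\<lambda>j. opS (?i + j - 1) ^^ c j) [1..<Suc k] s = fold (\<lambda>j. opS (length w + j)) [1..<Suc k] s" for s
    using c1 by (intro fold_cong refl) (auto simp: fun_eq_iff simp del: upt_Suc)
  have up: "[1..<Suc M] = [1..<Suc k] @ [Suc k..<Suc M]"
    using kM upt_add_eq_append[of 1 "Suc k" "M - k"] by (simp del: upt_Suc)
  have "opB ?i k (Some (comp_path ?a)) =
      (opS (?i + M) ^^ (k - (\<Sum>j = 1..M. c j))) (fold (\<lambda>j. opS (?i + j - 1) ^^ c j) [1..<Suc M] (Some (comp_path ?a)))"
    using ne unfolding opB_def bind.bind_lunit Let_def bounce_comp_comp_path(1)[OF a] c_def M_def by auto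
  also have "\<dots> = fold (\<lambda>j. opS (length w + j)) [1..<Suc k] (Some (comp_path ?a))"
    unfolding z(2) up fold_append comp_apply id f1 by simp
  also have "\<dots> = Some (comp_path (w @ replicate k b @ Suc b # u))" by (rule fold_opS[OF a])
  finally show ?thesis .
qed

text \<open>\<open>run c k t y \<alpha>\<close>: starting from \<open>take t c @ y\<close>, the parts at positions \<open>t, t - 1, \<dots>, 1\<close> are
  successively moved to the right, the one at position \<open>s\<close> past \<open>k s\<close> parts smaller by one; the
  result is \<open>\<alpha>\<close>.\<close>

inductive run :: "nat list \<Rightarrow> (nat \<Rightarrow> nat) \<Rightarrow> nat \<Rightarrow> nat list \<Rightarrow> nat list \<Rightarrow> bool" for c k where
  run_0: "run c k 0 y y"
| run_Suc: "run c k t (replicate (k (Suc t)) b @ Suc b # u) \<alpha> \<Longrightarrow> c ! t = Suc b \<Longrightarrow>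
    run c k (Suc t) (replicate (k (Suc t)) b @ u) \<alpha>"

text \<open>Positions are treated from right to left, so when position \<open>s\<close> has its turn
  only parts to its right have moved, and \<open>opB s\<close> meets the intended part.\<close>

lemma run_fold_opB:
  assumes "run c k t y \<alpha>" "t \<le> length c" "y \<noteq> []" "take t c @ y \<in> compositions n"
  shows "fold (\<lambda>s. opB s (k s)) (rev [1..<Suc t]) (Some (comp_path (take t c @ y))) = Some (comp_path \<alpha>)"
  using assms
proof (induction rule: run.induct)
  case (run_Suc t b u \<alpha>)
  have tk: "take (Suc t) c = take t c @ [Suc b]" "length (take t c) = t"
    using run_Suc.prems(1) run_Suc.hyps(2) by (auto simp: take_Suc_conv_app_nth)
  have cc: "take t c @ Suc b # replicate (k (Suc t)) b @ u \<in> compositions n"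
    using run_Suc.prems(3) tk by simp
  have "opB (Suc t) (k (Suc t)) (Some (comp_path (take t c @ Suc b # replicate (k (Suc t)) b @ u)))
    = Some (comp_path (take t c @ replicate (k (Suc t)) b @ Suc b # u))"
    using opB_comp_path[OF cc] run_Suc.prems(2) tk(2) by simp
  moreover have "rev [1..<Suc (Suc t)] = Suc t # rev [1..<Suc t]" by simp
  moreover have "take t c @ replicate (k (Suc t)) b @ Suc b # u \<in> compositions n"
    using cc by (auto simp: compositions_def)
  ultimately show ?case using run_Suc.IH run_Suc.prems(1) tk(1) by (simp del: upt_Suc)
qed simp

text \<open>Moving b + 1 back by k places adds k (b + 1) to the bounce, and advancing the k passed
  parts b by one place each removes k b.\<close>

lemma run_stats:
  assumes "run c k t y \<alpha>" "t \<le> length c"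
  shows "comp_bounce \<alpha> = comp_bounce (take t c @ y) + (\<Sum>s = 1..t. k s) \<and> mset \<alpha> = mset (take t c @ y)"
  using assms
proof (induction rule: run.induct)
  case (run_Suc t b u \<alpha>)
  have tk: "take (Suc t) c = take t c @ [Suc b]"
    using run_Suc.prems(1) run_Suc.hyps(2) by (auto simp: take_Suc_conv_app_nth)
  then show ?case using run_Suc by (simp add: comp_bounce_append sum_list_replicate algebra_simps)
qed simp

text \<open>The moves are undone starting from the last. In the list obtained after a move, the
  moved \<open>Suc b\<close> is preceded by exactly the passed copies of \<open>b\<close>, so their
  number is the length of the leading run of \<open>b\<close>.\<close>

lemma run_inj:
  assumes "run c k t y \<alpha>" "run c k' t y' \<alpha>"
  shows "y = y' \<and> (\<forall>s \<in> {1..t}. k s = k' s)"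
  using assms
proof (induction arbitrary: y' rule: run.induct)
  case (run_0 y)
  from run_0.prems show ?case by cases auto
next
  case (run_Suc t b u \<alpha>)
  from run_Suc.prems obtain b' u' where y': "y' = replicate (k' (Suc t)) b' @ u'" "c ! t = Suc b'"
    "run c k' t (replicate (k' (Suc t)) b' @ Suc b' # u') \<alpha>"
    by cases auto
  have bb: "b' = b" using y'(2) run_Suc.hyps(2) by simp
  have IH: "replicate (k (Suc t)) b @ Suc b # u = replicate (k' (Suc t)) b @ Suc b # u'"
    "\<forall>s \<in> {1..t}. k s = k' s"
    using run_Suc.IH[OF y'(3)] bb by auto
  have tw: "takeWhile (\<lambda>a. a = b) (replicate m b @ Suc b # v) = replicate m b" for m v
    by (induction m) auto
  have "replicate (k (Suc t)) b = replicate (k' (Suc t)) b"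
    using tw[of "k (Suc t)" u] tw[of "k' (Suc t)" u'] IH(1) by simp
  then have "k (Suc t) = k' (Suc t)" by (metis length_replicate)
  moreover from this have "u = u'" using IH(1) by simp
  ultimately show ?case using y'(1) bb IH(2) by (auto simp: le_Suc_eq)
qed

lemma run_cong:
  assumes "run c k t y \<alpha>" "\<And>s. s \<in> {1..t} \<Longrightarrow> k s = k' s"
  shows "run c k' t y \<alpha>"
  using assms
proof (induction rule: run.induct)
  case (run_Suc t b u \<alpha>)
  have "k (Suc t) = k' (Suc t)" using run_Suc.prems by simp
  moreover have "run c k' t (replicate (k (Suc t)) b @ Suc b # u) \<alpha>" using run_Suc by simp
  ultimately show ?case using run.run_Suc[of c k' t b u \<alpha>] run_Suc.hyps(2) by simp
qed (rule run.run_0)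

text \<open>Decodes \<alpha>: for growing \<open>T\<close>, the largest remaining part
  \<open>c ! T\<close> is removed at its first occurrence. The parts in front of it are smaller, and
  by near-sortedness only by one, so their number can serve as \<open>k (Suc T)\<close>. The leading
  run is part of the induction because it forces monotonicity: an equal part cannot occur inside the
  run left by its predecessor.\<close>

lemma ex_run_to:
  assumes "sorted_wrt (\<ge>) c" "mset \<alpha> = mset c" "sorted_wrt (\<lambda>a b. b \<le> Suc a) \<alpha>"
    "T \<le> length c" "\<forall>t<T. 2 \<le> c ! t"
  shows "\<exists>k y. run c k T y \<alpha> \<and> mset y = mset (drop T c) \<and> sorted_wrt (\<lambda>a b. b \<le> Suc a) y \<and>
     (1 \<le> T \<longrightarrow> (\<exists>u. y = replicate (k T) (c ! (T - 1) - 1) @ u)) \<and>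
     (\<forall>t. 1 \<le> t \<longrightarrow> t < T \<longrightarrow> c ! t = c ! (t - 1) \<longrightarrow> k t \<le> k (Suc t))"
  using assms(4,5)
proof (induction T)
  case 0
  show ?case by (intro exI[of _ "\<lambda>_. 0"] exI[of _ \<alpha>]) (use assms(2,3) in \<open>auto intro: run_0\<close>)
next
  case (Suc T)
  then obtain k y where k: "run c k T y \<alpha>" "mset y = mset (drop T c)" "sorted_wrt (\<lambda>a b. b \<le> Suc a) y"
    "1 \<le> T \<Longrightarrow> \<exists>u. y = replicate (k T) (c ! (T - 1) - 1) @ u"
    "\<And>t. 1 \<le> t \<Longrightarrow> t < T \<Longrightarrow> c ! t = c ! (t - 1) \<Longrightarrow> k t \<le> k (Suc t)"
    by fastforce
  obtain b where b: "c ! T = Suc b" using Suc.prems(2) by (cases "c ! T") auto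
  have dr: "drop T c = Suc b # drop (Suc T) c" using b Suc.prems(1) by (metis Cons_nth_drop_Suc Suc_le_lessD)
  have sety: "set y = insert (Suc b) (set (drop (Suc T) c))" using mset_eq_setD[OF k(2)] dr by simp
  then obtain u1 u2 where y: "y = u1 @ Suc b # u2" "Suc b \<notin> set u1" by (metis insertI1 split_list_first)
  have "sorted_wrt (\<ge>) (drop T c)" using assms(1) by (rule sorted_wrt_drop)
  then have le: "a \<le> Suc b" if "a \<in> set y" for a using that sety dr by auto
  have "a = b" if "a \<in> set u1" for a
  proof -
    have "a \<noteq> Suc b" "a \<le> Suc b" using that y le by auto
    moreover have "Suc b \<le> Suc a" using k(3) y(1) that by (auto simp: sorted_wrt_append)
    ultimately show ?thesis by simp
  qed
  then have u1: "u1 = replicate (length u1) b" by (simp add: replicate_length_same)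
  let ?k = "k(Suc T := length u1)"
  have y': "y = replicate (?k (Suc T)) b @ Suc b # u2" using y u1 by simp
  have "run c ?k T y \<alpha>" using run_cong[OF k(1), of ?k] by simp
  then have "run c ?k (Suc T) (replicate (?k (Suc T)) b @ u2) \<alpha>"
    using run_Suc[of c ?k T b u2 \<alpha>] y' b by simp
  then have r: "run c ?k (Suc T) (u1 @ u2) \<alpha>" using u1 by simp
  have m: "mset (u1 @ u2) = mset (drop (Suc T) c)" using k(2) y(1) dr by simp
  have s: "sorted_wrt (\<lambda>a b. b \<le> Suc a) (u1 @ u2)" using k(3) y(1) by (auto simp: sorted_wrt_append)
  have mono: "k T \<le> length u1" if T: "1 \<le> T" "c ! T = c ! (T - 1)"
  proof -
    have "c ! (T - 1) - 1 = b" using T(2) b by simp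
    then obtain u where u: "y = replicate (k T) b @ u" using k(4)[OF T(1)] by metis
    show ?thesis
    proof (rule ccontr)
      assume "\<not> k T \<le> length u1"
      then have "y ! length u1 = b" using u by (simp add: nth_append)
      then show False using y(1) by simp
    qed
  qed
  show ?case
  proof (intro exI conjI)
    show "run c ?k (Suc T) (u1 @ u2) \<alpha>" by (rule r)
    show "mset (u1 @ u2) = mset (drop (Suc T) c)" by (rule m)
    show "sorted_wrt (\<lambda>a b. b \<le> Suc a) (u1 @ u2)" by (rule s)
    show "1 \<le> Suc T \<longrightarrow> (\<exists>u. u1 @ u2 = replicate (?k (Suc T)) (c ! (Suc T - 1) - 1) @ u)"
      using b u1 by auto
    show "\<forall>t. 1 \<le> t \<longrightarrow> t < Suc T \<longrightarrow> c ! t = c ! (t - 1) \<longrightarrow> ?k t \<le> ?k (Suc t)"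
      using k(5) mono by (auto simp: less_Suc_eq)
  qed
qed

text \<open>Shows that each part finds enough smaller parts to pass. Invariant \<open>i1\<close> is
  the run left by the preceding move, which serves a part whose right neighbour has the same size.
  Invariant \<open>i2\<close> says that unmoved equal parts still stand at the front of
  \<open>y\<close>; together with \<open>h3\<close> it serves the last part of each size.\<close>

lemma ex_run_from_aux:
  assumes "T < length c"
    and h1: "\<And>t. t < T \<Longrightarrow> 2 \<le> c ! t"
    and h2: "\<And>t. Suc t < T \<Longrightarrow> c ! Suc t = c ! t \<Longrightarrow> k (Suc t) \<le> k (Suc (Suc t))"
    and h3: "\<And>t. t < T \<Longrightarrow> Suc t = T \<or> c ! Suc t \<noteq> c ! t \<Longrightarrow> c ! t = Suc (c ! Suc t) \<and>
      (\<forall>j \<in> {1..k (Suc t)}. Suc t + j \<le> length c \<and> k (Suc t + j) = 0 \<and> c ! (t + j) = c ! Suc t)"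
    and t: "t \<le> T"
    and i1: "t < T \<Longrightarrow> \<exists>u. y = replicate (k (Suc t)) (c ! t - 1) @ u"
    and i2: "\<And>z. t + z \<le> length c \<Longrightarrow> (\<forall>j \<in> {1..z}. k (t + j) = 0 \<and> c ! (t + j - 1) = c ! t) \<Longrightarrow>
      \<exists>u. y = replicate z (c ! t) @ u"
  shows "\<exists>\<alpha>. run c k t y \<alpha>"
  using t i1 i2
proof (induction t arbitrary: y)
  case 0
  show ?case using run_0 by blast
next
  case (Suc t)
  have tT: "t < T" using Suc.prems(1) by simp
  obtain b where b: "c ! t = Suc b" using h1[OF tT] by (cases "c ! t") auto
  let ?m = "k (Suc t)"
  have "\<exists>u. y = replicate ?m b @ u"
  proof (cases "Suc t = T \<or> c ! Suc t \<noteq> c ! t")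
    case True
    note h = h3[OF tT True]
    have le: "Suc t + ?m \<le> length c"
    proof (cases "?m = 0")
      case True
      then show ?thesis using Suc.prems(1) assms(1) by simp
    next
      case False
      then have "?m \<in> {1..?m}" by simp
      then show ?thesis using h by blast
    qed
    have "\<exists>u. y = replicate ?m (c ! Suc t) @ u"
      using h by (intro Suc.prems(3)[OF le]) auto
    then show ?thesis using h b by simp
  next
    case False
    then have "Suc t < T" using Suc.prems(1) by simp
    then obtain u where u: "y = replicate (k (Suc (Suc t))) b @ u"
      using Suc.prems(2) False b by auto
    have "?m \<le> k (Suc (Suc t))" using h2[OF \<open>Suc t < T\<close>] False by simp
    then have "replicate (k (Suc (Suc t))) b = replicate ?m b @ replicate (k (Suc (Suc t)) - ?m) b"
      by (metis le_add_diff_inverse replicate_add)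
    then show ?thesis using u by auto
  qed
  then obtain u where u: "y = replicate ?m b @ u" by blast
  have "\<exists>\<alpha>. run c k t (replicate ?m b @ Suc b # u) \<alpha>"
  proof (rule Suc.IH)
    show "t \<le> T" using tT by simp
    show "\<exists>v. replicate ?m b @ Suc b # u = replicate (k (Suc t)) (c ! t - 1) @ v" using b by auto
    fix z assume z: "t + z \<le> length c" "\<forall>j \<in> {1..z}. k (t + j) = 0 \<and> c ! (t + j - 1) = c ! t"
    show "\<exists>v. replicate ?m b @ Suc b # u = replicate z (c ! t) @ v"
    proof (cases z)
      case (Suc z')
      have m0: "?m = 0" using z(2)[rule_format, of 1] Suc by simp
      have "\<exists>v. y = replicate z' (Suc b) @ v"
      proof (cases "z' = 0")
        case False
        have e: "c ! Suc t = c ! t" using z(2)[rule_format, of 2] Suc False by simp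
        have "\<exists>v. y = replicate z' (c ! Suc t) @ v"
        proof (rule Suc.prems(3))
          show "Suc t + z' \<le> length c" using z(1) Suc by simp
          show "\<forall>j \<in> {1..z'}. k (Suc t + j) = 0 \<and> c ! (Suc t + j - 1) = c ! Suc t"
          proof
            fix j assume "j \<in> {1..z'}"
            then show "k (Suc t + j) = 0 \<and> c ! (Suc t + j - 1) = c ! Suc t"
              using z(2)[rule_format, of "Suc j"] Suc e by simp
          qed
        qed
        then show ?thesis using e b by simp
      qed simp
      then show ?thesis using m0 u Suc b by simp
    qed simp
  qed
  then show ?case using run_Suc[of c k t b u] b u by auto
qed

lemma ex_run_from:
  assumes "T < length c"
    and "\<And>t. t < T \<Longrightarrow> 2 \<le> c ! t"
    and "\<And>t. Suc t < T \<Longrightarrow> c ! Suc t = c ! t \<Longrightarrow> k (Suc t) \<le> k (Suc (Suc t))"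
    and "\<And>t. t < T \<Longrightarrow> Suc t = T \<or> c ! Suc t \<noteq> c ! t \<Longrightarrow> c ! t = Suc (c ! Suc t) \<and>
      (\<forall>j \<in> {1..k (Suc t)}. Suc t + j \<le> length c \<and> k (Suc t + j) = 0 \<and> c ! (t + j) = c ! Suc t)"
    and one: "\<And>t. T \<le> t \<Longrightarrow> t < length c \<Longrightarrow> c ! t = 1"
  shows "\<exists>\<alpha>. run c k T (drop T c) \<alpha>"
proof (rule ex_run_from_aux[OF assms(1-4)])
  have dr: "drop T c = replicate (length c - T) 1"
    using one by (intro nth_equalityI) auto
  fix z assume z: "T + z \<le> length c"
  have "replicate (length c - T) (1::nat) = replicate z 1 @ replicate (length c - T - z) 1"
    using z by (simp flip: replicate_add)
  then show "\<exists>u. drop T c = replicate z (c ! T) @ u" using dr one[of T] assms(1) by auto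
qed auto


section \<open>Distinct parts and conjugation\<close>

abbreviation dlist :: "nat list \<Rightarrow> nat list" where
  "dlist l \<equiv> sorted_list_of_set (set l)"

lemma dpart_nth: "1 \<le> i \<Longrightarrow> i \<le> num_dparts l \<Longrightarrow> dpart l i = dlist l ! (num_dparts l - i)"
  by (simp add: dpart_def num_dparts_def rev_nth)

lemma dpart_in: "1 \<le> i \<Longrightarrow> i \<le> num_dparts l \<Longrightarrow> dpart l i \<in> set l"
  using nth_mem[of "num_dparts l - i" "dlist l"] by (simp add: dpart_nth num_dparts_def)

lemma dpart_strict:
  assumes "1 \<le> i" "i < j" "j \<le> num_dparts l"
  shows "dpart l j < dpart l i"
  using assms sorted_wrt_nth_less[OF strict_sorted_list_of_set[of "set l"], of "num_dparts l - j" "num_dparts l - i"]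
  by (simp add: dpart_nth num_dparts_def)

lemma dpart_surj:
  assumes "a \<in> set l"
  obtains i where "1 \<le> i" "i \<le> num_dparts l" "a = dpart l i"
proof -
  have "a \<in> set (dlist l)" using assms by simp
  then obtain j where j: "j < num_dparts l" "a = dlist l ! j"
    by (metis in_set_conv_nth length_sorted_list_of_set num_dparts_def)
  then show ?thesis using that[of "num_dparts l - j"] by (simp add: dpart_nth)
qed

lemma dparts_ge:
  assumes "1 \<le> i" "i \<le> num_dparts l"
  shows "dpart l ` {1..i} = {a \<in> set l. dpart l i \<le> a}"
proof (intro equalityI subsetI)
  fix a assume "a \<in> dpart l ` {1..i}"
  then obtain j where j: "1 \<le> j" "j \<le> i" "a = dpart l j" by auto
  then show "a \<in> {a \<in> set l. dpart l i \<le> a}"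
    using dpart_in[of j l] dpart_strict[of j i l] assms by (cases "j = i") auto
next
  fix a assume "a \<in> {a \<in> set l. dpart l i \<le> a}"
  then obtain j where j: "1 \<le> j" "j \<le> num_dparts l" "a = dpart l j" "dpart l i \<le> a"
    using dpart_surj by blast
  then have "j \<le> i" using dpart_strict[of i j l] assms by (cases "j \<le> i") auto
  then show "a \<in> dpart l ` {1..i}" using j by auto
qed

text \<open>Covers both index functions: \<open>F\<close> is the identity for \<open>row\<close> and
  constantly 1 for \<open>bnc\<close>.\<close>

lemma sum_dmult:
  fixes F :: "nat \<Rightarrow> nat"
  assumes "1 \<le> i" "i \<le> num_dparts l"
  shows "(\<Sum>j = 1..i. dmult l j * F (dpart l j)) = sum_list (map F (filter (\<lambda>a. dpart l i \<le> a) l))"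
proof -
  have "inj_on (dpart l) {1..i}"
  proof (rule inj_onI)
    fix x y assume "x \<in> {1..i}" "y \<in> {1..i}" "dpart l x = dpart l y"
    then show "x = y" using dpart_strict[of x y l] dpart_strict[of y x l] assms
      by (cases x y rule: linorder_cases) auto
  qed
  then have "(\<Sum>j = 1..i. dmult l j * F (dpart l j)) = (\<Sum>a \<in> dpart l ` {1..i}. count_list l a * F a)"
    by (simp add: sum.reindex dmult_def)
  also have "\<dots> = (\<Sum>a \<in> {a \<in> set l. dpart l i \<le> a}. count_list l a * F a)"
    by (simp only: dparts_ge[OF assms])
  also have "\<dots> = (\<Sum>a \<in> set (filter (\<lambda>a. dpart l i \<le> a) l). count_list (filter (\<lambda>a. dpart l i \<le> a) l) a * F a)"
  proof (rule sum.cong)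
    fix a assume "a \<in> set (filter (\<lambda>a. dpart l i \<le> a) l)"
    then have "dpart l i \<le> a" by simp
    then have "count_list (filter (\<lambda>a. dpart l i \<le> a) xs) a = count_list xs a" for xs
      by (induction xs) auto
    then show "count_list l a * F a = count_list (filter (\<lambda>a. dpart l i \<le> a) l) a * F a" by simp
  qed simp
  also have "\<dots> = sum_list (map F (filter (\<lambda>a. dpart l i \<le> a) l))"
    by (rule sum_list_map_eq_sum_count[symmetric])
  finally show ?thesis .
qed

lemma filter_ge_take:
  "sorted_wrt (\<ge>) l \<Longrightarrow> filter (\<lambda>a. t \<le> a) l = take (count_ge l t) (l :: nat list)"
proof (induction l)
  case (Cons a l)
  show ?case
  proof (cases "t \<le> a")
    case True
    then show ?thesis using Cons by (simp add: count_ge_def)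
  next
    case False
    then have "filter (\<lambda>a. t \<le> a) (a # l) = []" using Cons.prems by (fastforce simp: filter_empty_conv)
    then show ?thesis by (simp add: count_ge_def)
  qed
qed simp

lemma count_ge_strict:
  assumes "sorted_wrt (\<ge>) l" "a \<in> set l" "a < b"
  shows "count_ge l b < count_ge l a"
proof -
  obtain i where i: "i < length l" "l ! i = a" using assms(2) by (metis in_set_conv_nth)
  then show ?thesis using count_ge_galois[OF assms(1) i(1), of a] count_ge_galois[OF assms(1) i(1), of b] assms(3) by simp
qed

lemma set_conjugate:
  assumes "l \<in> Par n"
  shows "set (conjugate l) = count_ge l ` set l"
proof (cases "l = []")
  case False
  have l: "sorted_wrt (\<ge>) l" "0 \<notin> set l" using assms by (auto simp: Par_def)
  have s: "set (conjugate l) = count_ge l ` {1..hd l}"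
    using False by (simp add: conjugate_count_ge atLeastLessThanSuc_atLeastAtMost del: upt_Suc)
  show ?thesis unfolding s
  proof (intro equalityI subsetI)
    fix v assume "v \<in> count_ge l ` {1..hd l}"
    then obtain t where t: "t \<le> hd l" "v = count_ge l t" by auto
    \<comment> \<open>The conjugate part at \<open>t\<close> depends only on the least part of
      \<open>l\<close> that is at least \<open>t\<close>.\<close>
    let ?A = "{a \<in> set l. t \<le> a}"
    have ne: "?A \<noteq> {}" "finite ?A" using t False by (auto intro: exI[of _ "hd l"])
    then have m: "Min ?A \<in> ?A" by (intro Min_in) auto
    have "t \<le> a \<longleftrightarrow> Min ?A \<le> a" if "a \<in> set l" for a
    proof
      assume "t \<le> a"
      then show "Min ?A \<le> a" using ne(2) that by (intro Min_le) auto
    next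
      assume "Min ?A \<le> a"
      moreover have "t \<le> Min ?A" using m by blast
      ultimately show "t \<le> a" by (rule order.trans[rotated])
    qed
    then have "filter (\<lambda>a. t \<le> a) l = filter (\<lambda>a. Min ?A \<le> a) l"
      by (intro filter_cong refl)
    then have "v = count_ge l (Min ?A)" using t by (simp add: count_ge_def)
    then show "v \<in> count_ge l ` set l" using m by blast
  next
    fix v assume "v \<in> count_ge l ` set l"
    then obtain a where "a \<in> set l" "v = count_ge l a" by auto
    moreover have "1 \<le> a" using l(2) \<open>a \<in> set l\<close> by (cases a) auto
    ultimately show "v \<in> count_ge l ` {1..hd l}" using sorted_ge_le_hd[OF l(1)] by auto
  qed
qed (simp add: conjugate_def)

lemma count_ge_inj_on: "sorted_wrt (\<ge>) l \<Longrightarrow> inj_on (count_ge l) (set l)"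
  by (rule inj_onI) (metis count_ge_strict less_irrefl linorder_neqE_nat)

lemma num_dparts_conjugate: "l \<in> Par n \<Longrightarrow> num_dparts (conjugate l) = num_dparts l"
  using card_image[OF count_ge_inj_on[of l]] by (simp add: num_dparts_def set_conjugate Par_def)

text \<open>\<open>count_ge l\<close> is an order-reversing bijection from the distinct parts of
  \<lambda> to those of the conjugate; this is the source of the index \<ell> - i in the
  multiplicities.\<close>

lemma dlist_conjugate:
  assumes "l \<in> Par n"
  shows "dlist (conjugate l) = rev (map (count_ge l) (dlist l))"
proof (rule sorted_distinct_set_unique)
  have l: "sorted_wrt (\<ge>) l" using assms by (simp add: Par_def)
  show "sorted (rev (map (count_ge l) (dlist l)))"
    unfolding sorted_wrt_rev sorted_wrt_map
    by (rule sorted_wrt_mono_rel[OF _ sorted_sorted_list_of_set]) (rule count_ge_antimono)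
  show "distinct (rev (map (count_ge l) (dlist l)))" using count_ge_inj_on[OF l] by (simp add: distinct_map)
  show "set (dlist (conjugate l)) = set (rev (map (count_ge l) (dlist l)))"
    using set_conjugate[OF assms] by simp
qed auto

lemma dpart_conjugate:
  assumes "l \<in> Par n" "1 \<le> i" "i < num_dparts l"
  shows "dpart (conjugate l) (num_dparts l - i) = count_ge l (dpart l (Suc i))"
proof -
  have "dpart (conjugate l) (num_dparts l - i) = dlist (conjugate l) ! i"
    using assms num_dparts_conjugate[OF assms(1)] by (simp add: dpart_nth)
  also have "\<dots> = count_ge l (dlist l ! (num_dparts l - Suc i))"
    using assms by (simp add: dlist_conjugate rev_nth num_dparts_def)
  finally show ?thesis using assms by (simp add: dpart_nth)
qed

lemma count_list_count_ge: "count_list c v = count_ge c v - count_ge c (Suc v)"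
proof (induction c)
  case (Cons a c)
  have "count_ge c (Suc v) \<le> count_ge c v" by (rule count_ge_antimono) simp
  then show ?case using Cons by (auto simp: count_ge_def)
qed (simp add: count_ge_def)

lemma count_ge_conjugate:
  assumes "l \<in> Par n" "i < length l"
  shows "count_ge (conjugate l) (Suc i) = l ! i"
proof -
  have ne: "l \<noteq> []" using assms by auto
  then have "hd l \<noteq> 0" using assms by (cases l) (auto simp: Par_def)
  then have ne': "conjugate l \<noteq> []" using ne by (simp add: conjugate_def)
  have "length (conjugate (conjugate l)) = length l" "conjugate (conjugate l) ! i = l ! i"
    using conjugate_conjugate[OF assms(1)] by auto
  then show ?thesis using assms(2) ne' by (simp add: conjugate_count_ge[OF ne'] del: upt_Suc)
qed

lemma length_conjugate: "l \<noteq> [] \<Longrightarrow> length (conjugate l) = hd l"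
  by (simp add: conjugate_def)

lemma conjugate_nth: "l \<noteq> [] \<Longrightarrow> t < hd l \<Longrightarrow> conjugate l ! t = count_ge l (Suc t)"
  by (simp add: conjugate_count_ge del: upt_Suc)

text \<open>\<open>v\<close> counts the parts larger than \<open>dpart l (Suc i)\<close>, so the row
  lies in the first block of that size. The multiplicity fits into the block because it counts
  columns of the diagram of one height, all of which are at most
  \<open>dpart l (Suc i)\<close>.\<close>

lemma row_block:
  assumes l: "l \<in> Par n" and i: "1 \<le> i" "i < num_dparts l"
  defines "v \<equiv> count_ge l (dpart l i)"
  shows "row l i r = psum l v + r" "0 < v" "v < length l" "dpart l i \<le> l ! (v - 1)"
    "dmult (conjugate l) (num_dparts l - i) \<le> l ! v"
proof -
  have s: "sorted_wrt (\<ge>) l" using l by (simp add: Par_def)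
  have in1: "dpart l i \<in> set l" "dpart l (Suc i) \<in> set l"
    using dpart_in[of i l] dpart_in[of "Suc i" l] i by auto
  have lt: "dpart l (Suc i) < dpart l i" using dpart_strict[of i "Suc i" l] i by simp
  have v: "v < count_ge l (dpart l (Suc i))" unfolding v_def by (rule count_ge_strict[OF s in1(2) lt])
  show "row l i r = psum l v + r"
    using sum_dmult[of i l "\<lambda>a. a"] i filter_ge_take[OF s] by (simp add: row_def v_def)
  show v0: "0 < v" using in1(1) unfolding v_def count_ge_def by (auto simp: filter_empty_conv)
  show vl: "v < length l" using v count_ge_le_length[of l "dpart l (Suc i)"] by simp
  show "dpart l i \<le> l ! (v - 1)"
    using count_ge_galois[OF s, of "v - 1" "dpart l i"] v0 vl by (simp add: v_def)
  let ?t = "dpart l (Suc i)"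
  have ne: "l \<noteq> []" using vl by auto
  have "count_list (conjugate l) (count_ge l ?t) = length (filter (\<lambda>t. count_ge l ?t = count_ge l t) [1..<Suc (hd l)])"
    unfolding conjugate_count_ge[OF ne] count_list_eq_length_filter
    by (simp add: filter_map comp_def del: upt_Suc)
  also have "\<dots> = card ({t. count_ge l ?t = count_ge l t} \<inter> set [1..<Suc (hd l)])"
    by (rule distinct_length_filter) (rule distinct_upt)
  also have "\<dots> \<le> card {1..?t}"
  proof (rule card_mono)
    show "{t. count_ge l ?t = count_ge l t} \<inter> set [1..<Suc (hd l)] \<subseteq> {1..?t}"
    proof
      fix t assume t: "t \<in> {t. count_ge l ?t = count_ge l t} \<inter> set [1..<Suc (hd l)]"
      then have "count_ge l t = count_ge l ?t" "1 \<le> t" by (auto simp del: upt_Suc)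
      then show "t \<in> {1..?t}" using count_ge_strict[OF s in1(2), of t] by (cases "t \<le> ?t") auto
    qed
  qed simp
  also have "\<dots> = ?t" by simp
  also have "?t \<le> l ! v" using count_ge_galois[OF s vl, of ?t] v by simp
  finally show "dmult (conjugate l) (num_dparts l - i) \<le> l ! v"
    using dpart_conjugate[OF l i] by (simp add: dmult_def)
qed

lemma sorted_wrt_bnc_list:
  "sorted_wrt (\<lambda>(i, r) (i', r'). i < i' \<or> i = i' \<and> r < r') (bnc_list l)"
proof -
  have "sorted_wrt (<) is \<Longrightarrow> sorted_wrt (\<lambda>(i, r) (i', r'). i < i' \<or> i = i' \<and> r < r')
     (concat (map (\<lambda>i. map (\<lambda>r. (i, r)) [1..<Suc (m i)]) is))" for "is" :: "nat list" and m :: "nat \<Rightarrow> nat"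
  proof (induction "is")
    case (Cons i "is")
    have "sorted_wrt (<) [1..<Suc (m i)]" by (rule sorted_wrt_upt)
    then show ?case using Cons by (auto simp: sorted_wrt_append sorted_wrt_map simp del: upt_Suc)
  qed simp
  then show ?thesis unfolding bnc_list_def by (simp del: upt_Suc)
qed

lemma I_bnc_conjugate:
  assumes "l \<in> Par n"
  shows "(i, r) \<in> I_bnc (conjugate l) \<longleftrightarrow>
    1 \<le> i \<and> i < num_dparts l \<and> 1 \<le> r \<and> r \<le> dmult (conjugate l) (num_dparts l - i)"
  using num_dparts_conjugate[OF assms] by (simp add: I_bnc_def)

lemma row_block_bounds:
  assumes "l \<in> Par n" "(i, r) \<in> I_bnc (conjugate l)"
  defines "v \<equiv> count_ge l (dpart l i)"
  shows "psum l v < row l i r" "row l i r \<le> psum l (Suc v)"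
  using row_block[OF assms(1), of i] assms(2) psum_Suc[of v l]
  unfolding I_bnc_conjugate[OF assms(1)] v_def by (auto simp: le_trans)

lemma row_le:
  assumes "l \<in> Par n" "(i, r) \<in> I_bnc (conjugate l)"
  shows "row l i r \<in> {1..n}"
proof -
  have "psum l (Suc (count_ge l (dpart l i))) \<le> n" using assms(1) psum_le[of _ l] by (auto simp: Par_def)
  then show ?thesis using row_block_bounds[OF assms] by auto
qed

lemma row_strict:
  assumes l: "l \<in> Par n" and x: "(i, r) \<in> I_bnc (conjugate l)" "(i', r') \<in> I_bnc (conjugate l)"
    and lt: "i < i' \<or> i = i' \<and> r < r'"
  shows "row l i r < row l i' r'"
proof (cases "i = i'")
  case False
  then have lt: "i < i'" using lt by simp
  have s: "sorted_wrt (\<ge>) l" using l by (simp add: Par_def)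
  have i': "1 \<le> i" "i' < num_dparts l" using x by (auto simp: I_bnc_conjugate[OF l])
  have "count_ge l (dpart l i) < count_ge l (dpart l i')"
    using i' lt by (intro count_ge_strict[OF s] dpart_in dpart_strict) auto
  then have "psum l (Suc (count_ge l (dpart l i))) \<le> psum l (count_ge l (dpart l i'))" by (intro psum_mono) simp
  then show ?thesis using row_block_bounds[OF l x(1)] row_block_bounds[OF l x(2)] by simp
qed (use lt in \<open>auto simp: row_def\<close>)

lemma sorted_rows:
  assumes "l \<in> Par n"
  shows "sorted_wrt (<) (map (case_prod (row l)) (bnc_list (conjugate l)))"
  unfolding sorted_wrt_map
  by (rule sorted_wrt_mono_rel[OF _ sorted_wrt_bnc_list])
    (use row_strict[OF assms] in \<open>auto simp: set_bnc_list\<close>)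

lemma sum_list_row_select:
  fixes f :: "'a \<Rightarrow> nat"
  assumes "sorted_wrt (<) (map g xs)"
  shows "x \<in> set xs \<Longrightarrow> sum_list (map (\<lambda>y. if g y = g x then f y else 0) xs) = f x"
    and "j \<notin> g ` set xs \<Longrightarrow> sum_list (map (\<lambda>y. if g y = (j::nat) then f y else 0) xs) = 0"
proof -
  show z: "j \<notin> g ` set xs \<Longrightarrow> sum_list (map (\<lambda>y. if g y = j then f y else 0) xs) = 0" for xs and j
    by (induction xs) auto
  show "x \<in> set xs \<Longrightarrow> sum_list (map (\<lambda>y. if g y = g x then f y else 0) xs) = f x"
    using assms
  proof (induction xs)
    case (Cons a xs)
    show ?case
    proof (cases "x = a")
      case True
      then have "g x \<notin> g ` set xs" using Cons.prems(2) by auto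
      then show ?thesis using True z[of "g x" xs] by simp
    next
      case False
      then show ?thesis using Cons by auto
    qed
  qed simp
qed

text \<open>The total exponent of A_j in the product A^f, that is, the number of extra cells it puts
  into row j.\<close>

definition rowsum :: "(nat \<times> nat \<Rightarrow> nat) \<Rightarrow> nat list \<Rightarrow> nat \<Rightarrow> nat" where
  "rowsum f l j = sum_list (map (\<lambda>x. if case_prod (row l) x = j then f x else 0) (bnc_list (conjugate l)))"

lemma rowsum_row:
  assumes "l \<in> Par n" "(i, r) \<in> I_bnc (conjugate l)"
  shows "rowsum f l (row l i r) = f (i, r)"
  using sum_list_row_select(1)[OF sorted_rows[OF assms(1)], of "(i, r)" f] assms(2)
  by (simp add: set_bnc_list rowsum_def)

lemma rowsum_other:
  assumes "l \<in> Par n" "\<And>i r. (i, r) \<in> I_bnc (conjugate l) \<Longrightarrow> row l i r \<noteq> j"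
  shows "rowsum f l j = 0"
  unfolding rowsum_def
  using assms(2) by (intro sum_list_row_select(2)[OF sorted_rows[OF assms(1)]]) (auto simp: set_bnc_list)

lemma A_prod_eq:
  "A_prod f l = fold (\<lambda>x. opA (case_prod (row l) x) ^^ f x) (bnc_list (conjugate l)) (Some (comp_path l))"
  unfolding A_prod_def by (intro fold_cong refl) auto

text \<open>The bound on \<open>f (i, 1)\<close> keeps the first row of every block to the right of
  the preceding bounce point, so the bounce composition is still \<lambda>, and \<open>f\<close>
  lists the extra cells. Thus the path determines (f, \<lambda>), which makes \<Phi> well
  defined.\<close>

lemma A_prod_SomeD:
  assumes F: "(f, l) \<in> F_set n" and A: "A_prod f l = Some p"
  shows "p \<in> Dyck n" "bounce_comp p = l"
    "\<And>x. x \<in> I_bnc (conjugate l) \<Longrightarrow> f x = comp_xcoord l (case_prod (row l) x) - xcoord p (case_prod (row l) x)"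
proof -
  have l: "l \<in> Par n" using F by (simp add: F_set_def)
  note c = Par_compositions[OF l]
  have fb: "f (i, 1) < dpart l i" if "1 \<le> i" "i < num_dparts l" for i
    using F that by (simp add: F_set_def)
  have *: "p \<in> Dyck n \<and> (\<forall>j \<in> {1..n}. xcoord (comp_path l) j = xcoord p j + rowsum f l j)"
    unfolding rowsum_def by (rule fold_opA_SomeD[OF comp_path_Dyck[OF c] A[unfolded A_prod_eq]])
  then show p: "p \<in> Dyck n" by simp
  have x: "comp_xcoord l j = xcoord p j + rowsum f l j" if "j \<in> {1..n}" for j
    using * xcoord_comp_path[OF c that] that by simp
  show "f x = comp_xcoord l (case_prod (row l) x) - xcoord p (case_prod (row l) x)" if "x \<in> I_bnc (conjugate l)" for x
    using that x row_le[OF l] rowsum_row[OF l] by (cases x) auto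
  have s: "sum_list l = n" "0 \<notin> set l" using l by (auto simp: Par_def)
  show "bounce_comp p = l"
  proof (rule bounce_compI_xcoord[OF p c])
    show "xcoord p j \<le> comp_xcoord l j" if "j \<in> {1..n}" for j using x[OF that] by simp
    fix k assume k: "Suc k < length l"
    let ?j = "psum l (Suc k) + 1"
    have lt: "psum l (Suc k) < psum l (Suc (Suc k))" using psum_less[OF s(2), of "Suc k" "Suc (Suc k)"] k by simp
    have le: "psum l (Suc (Suc k)) \<le> n" using psum_le[of "Suc (Suc k)" l] s by simp
    have j: "?j \<in> {1..n}" using lt le by simp
    have b: "comp_xcoord l ?j = psum l k + l ! k"
      using comp_xcoord_block[of "Suc k" l ?j] lt k psum_Suc[of k l] by simp
    have "rowsum f l ?j < l ! k"
    proof (cases "\<exists>i r. (i, r) \<in> I_bnc (conjugate l) \<and> row l i r = ?j")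
      case True
      then obtain i r where ir: "(i, r) \<in> I_bnc (conjugate l)" "row l i r = ?j" by blast
      let ?v = "count_ge l (dpart l i)"
      have i: "1 \<le> i" "i < num_dparts l" "1 \<le> r" using ir(1) by (auto simp: I_bnc_conjugate[OF l])
      note rb = row_block[OF l i(1,2)]
      \<comment> \<open>The row is the first one of block \<open>Suc k\<close>, which leaves only
        \<open>r = 1\<close>, the index bounded by \<open>dpart l i\<close>.\<close>
      have "?v = Suc k"
      proof (cases ?v "Suc k" rule: linorder_cases)
        case less
        then have "psum l (Suc ?v) \<le> psum l (Suc k)" by (intro psum_mono) simp
        then show ?thesis using row_block_bounds[OF l ir(1)] ir(2) by simp
      next
        case greater
        then have "psum l (Suc (Suc k)) \<le> psum l ?v" by (intro psum_mono) simp
        then show ?thesis using row_block_bounds[OF l ir(1)] ir(2) lt by simp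
      qed
      then have "r = 1" "dpart l i \<le> l ! k" using rb(1)[of r] rb(4) ir(2) by auto
      then show ?thesis using rowsum_row[OF l ir(1), of f] ir(2) fb[OF i(1,2)] by simp
    next
      case False
      then have "rowsum f l ?j = 0" by (intro rowsum_other[OF l]) auto
      moreover have "0 < l ! k" using s(2) k by (metis Suc_lessD gr0I nth_mem)
      ultimately show ?thesis by simp
    qed
    then show "psum l k < xcoord p ?j" using x[OF j] b by simp
  qed
qed

lemma F_set_unique:
  assumes "(f, l) \<in> F_set n" "A_prod f l = Some p" "(f', l') \<in> F_set n" "A_prod f' l' = Some p"
  shows "f = f' \<and> l = l'"
proof -
  have l: "l = l'" using A_prod_SomeD(2)[OF assms(1,2)] A_prod_SomeD(2)[OF assms(3,4)] by simp
  have "f = f'"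
  proof (rule extensionalityI[of f "I_bnc (conjugate l)"])
    show "f \<in> extensional (I_bnc (conjugate l))" "f' \<in> extensional (I_bnc (conjugate l))"
      using assms(1,3) l by (auto simp: F_set_def PiE_def)
    show "f x = f' x" if "x \<in> I_bnc (conjugate l)" for x
      using A_prod_SomeD(3)[OF assms(1,2) that] A_prod_SomeD(3)[OF assms(3,4)] that l by simp
  qed
  then show ?thesis using l by simp
qed

lemma Phi_eq:
  assumes "(f, l) \<in> F_set n" "A_prod f l = Some p" "B_prod f l = Some q"
  shows "Phi n p = q"
  unfolding Phi_def
proof (rule the_equality)
  show "\<exists>(f, l) \<in> F_set n. A_prod f l = Some p \<and> B_prod f l = Some q" using assms by blast
  fix \<sigma> assume "\<exists>(f, l) \<in> F_set n. A_prod f l = Some p \<and> B_prod f l = Some \<sigma>"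
  then obtain f' l' where "(f', l') \<in> F_set n" "A_prod f' l' = Some p" "B_prod f' l' = Some \<sigma>" by blast
  then show "\<sigma> = q" using F_set_unique[OF assms(1,2), of f' l'] assms(3) by simp
qed


section \<open>The correspondence\<close>

lemma A_prod_eqI:
  assumes l: "l \<in> Par n" and p: "p \<in> Dyck n"
    and x: "\<And>j. j \<in> {1..n} \<Longrightarrow> comp_xcoord l j = xcoord p j + rowsum f l j"
  shows "A_prod f l = Some p"
  unfolding A_prod_eq
proof (rule fold_opA)
  note c = Par_compositions[OF l]
  show "comp_path l \<in> Dyck n" by (rule comp_path_Dyck[OF c])
  show "p \<in> Dyck n" by (rule p)
  show "sorted_wrt (<) (map (case_prod (row l)) (bnc_list (conjugate l)))" by (rule sorted_rows[OF l])
  show "case_prod (row l) ` set (bnc_list (conjugate l)) \<subseteq> {1..n}"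
    using row_le[OF l] by (auto simp: set_bnc_list)
  fix j assume j: "j \<in> {1..n}" "j \<notin> case_prod (row l) ` set (bnc_list (conjugate l))"
  then have "rowsum f l j = 0" by (intro rowsum_other[OF l]) (force simp: set_bnc_list)
  then show "xcoord (comp_path l) j = xcoord p j" using x[OF j(1)] xcoord_comp_path[OF c j(1)] by simp
next
  note c = Par_compositions[OF l]
  fix y assume "y \<in> set (bnc_list (conjugate l))"
  then obtain i r where y: "y = (i, r)" "(i, r) \<in> I_bnc (conjugate l)"
    unfolding set_bnc_list by (metis surj_pair)
  then show "xcoord (comp_path l) (case_prod (row l) y) = xcoord p (case_prod (row l) y) + f y"
    using x[OF row_le[OF l y(2)]] xcoord_comp_path[OF c row_le[OF l y(2)]] rowsum_row[OF l y(2), of f] by simp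
qed

lemma sum_rowsum:
  assumes "l \<in> Par n"
  shows "(\<Sum>j = 1..n. rowsum f l j) = sum_list (map f (bnc_list (conjugate l)))"
proof -
  have "(\<Sum>j = 1..n. sum_list (map (\<lambda>x. if g x = j then f x else 0) xs)) = sum_list (map f xs)"
    if "g ` set xs \<subseteq> {1..n}" for g :: "nat \<times> nat \<Rightarrow> nat" and xs
    using that
  proof (induction xs)
    case (Cons x xs)
    have "(\<Sum>j = 1..n. if g x = j then f x else 0) = f x" using Cons.prems by (simp add: sum.delta')
    then show ?case using Cons by (simp add: sum.distrib)
  qed simp
  moreover have "case_prod (row l) ` set (bnc_list (conjugate l)) \<subseteq> {1..n}"
    using row_le[OF assms] by (auto simp: set_bnc_list)
  ultimately show ?thesis unfolding rowsum_def by blast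
qed

section \<open>Strict partitions: positions in the conjugate and the tuples f\<close>

locale strict_partition =
  fixes n :: nat and l :: "nat list"
  assumes Par: "l \<in> Par n" and strict: "sorted_wrt (>) l" and nonempty: "l \<noteq> []"
begin

abbreviation c :: "nat list" where "c \<equiv> conjugate l"
abbreviation L :: nat where "L \<equiv> length l"

text \<open>Padding with zeros makes \<open>part i - part (Suc i)\<close> the multiplicity of
  \<open>Suc i\<close> in the conjugate for the last part too.\<close>

definition part :: "nat \<Rightarrow> nat" where "part i = (if i < L then l ! i else 0)"

text \<open>Inverse of \<open>bnc c\<close> on the positions up to \<open>part 1\<close>: the entry
  of \<open>c\<close> at position \<open>t\<close>, counted from 1, is \<open>i + 1\<close>, and
  \<open>r\<close> numbers the positions of this entry from right to left.\<close>

definition idx :: "nat \<Rightarrow> nat \<times> nat" where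
  "idx t = (count_ge l t - 1, Suc (part (count_ge l t - 1)) - t)"

lemma sorted_l: "sorted_wrt (\<ge>) l"
  using Par by (simp add: Par_def)

lemma pos: "i < L \<Longrightarrow> 0 < l ! i"
  using Par nth_mem[of i l] by (cases "l ! i") (auto simp: Par_def)

lemma part_strict: "i < j \<Longrightarrow> i < L \<Longrightarrow> part j < part i"
  using pos sorted_wrt_nth_less[OF strict, of i j] by (simp add: part_def)

lemma part_antimono: "i \<le> j \<Longrightarrow> part j \<le> part i"
  using part_strict[of i j] by (cases "i < L"; cases "i = j") (auto simp: part_def)

lemma num_dparts_l: "num_dparts l = L"
proof -
  have "distinct l" using strict by (auto simp: distinct_conv_nth sorted_wrt_iff_nth_less) (metis less_irrefl nat_neq_iff)
  then show ?thesis by (simp add: num_dparts_def distinct_card)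
qed

lemma dpart_l:
  assumes "1 \<le> i" "i \<le> L"
  shows "dpart l i = l ! (i - 1)"
proof -
  have "dlist l = rev l"
  proof (rule sorted_distinct_set_unique)
    show "sorted (rev l)" using sorted_l by (simp add: sorted_wrt_rev)
    show "distinct (rev l)" using num_dparts_l by (simp add: num_dparts_def card_distinct)
  qed auto
  then show ?thesis by (simp add: dpart_def)
qed

lemma count_ge_l_level:
  assumes "1 \<le> t" "t \<le> part 0"
  shows "count_ge l t = Suc i \<longleftrightarrow> part (Suc i) < t \<and> t \<le> part i"
proof -
  have g: "j < count_ge l t \<longleftrightarrow> t \<le> part j" for j
    using count_ge_galois[OF sorted_l, of j t] count_ge_le_length[of l t] assms(1) by (cases "j < L") (auto simp: part_def)
  show ?thesis using g[of i] g[of "Suc i"] by auto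
qed

lemma count_ge_l_pos:
  assumes "t \<le> part 0"
  shows "0 < count_ge l t"
  using count_ge_galois[OF sorted_l, of 0 t] assms nonempty by (simp add: part_def)

lemma count_ge_l_nth: "k < L \<Longrightarrow> count_ge l (l ! k) = Suc k"
  using count_ge_l_level[of "l ! k" k] pos[of k] part_strict[of k "Suc k"] part_antimono[of 0 k] by (simp add: part_def)

lemma length_c: "length c = part 0"
  using nonempty by (simp add: length_conjugate part_def hd_conv_nth)

lemma c_nth: "t < part 0 \<Longrightarrow> c ! t = count_ge l (Suc t)"
  using nonempty by (simp add: conjugate_nth part_def hd_conv_nth)

lemma set_c: "set c \<subseteq> {1..L}"
proof
  fix v assume "v \<in> set c"
  then obtain t where "t < part 0" "v = c ! t" by (metis in_set_conv_nth length_c)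
  then show "v \<in> {1..L}" using count_ge_l_pos[of "Suc t"] count_ge_le_length[of l "Suc t"] by (simp add: c_nth)
qed

lemma count_ge_c: "count_ge c (Suc i) = part i"
proof (cases "i < L")
  case True
  then show ?thesis using count_ge_conjugate[OF Par True] by (simp add: part_def)
next
  case False
  then have "filter (\<lambda>a. Suc i \<le> a) c = []" using set_c by (fastforce simp: filter_empty_conv)
  then show ?thesis using False by (simp add: count_ge_def part_def)
qed

lemma count_c: "count_list c (Suc i) = part i - part (Suc i)"
  by (simp add: count_list_count_ge count_ge_c)

lemma dpart_c: "1 \<le> i \<Longrightarrow> i < L \<Longrightarrow> dpart c (L - i) = Suc i"
  using dpart_conjugate[OF Par, of i] dpart_l[of "Suc i"] count_ge_l_nth[of i] by (simp add: num_dparts_l)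

lemma dmult_c: "1 \<le> i \<Longrightarrow> i < L \<Longrightarrow> dmult c (L - i) = part i - part (Suc i)"
  by (simp add: dmult_def dpart_c count_c)

lemma I_bnc_c: "(i, r) \<in> I_bnc c \<longleftrightarrow> 1 \<le> i \<and> i < L \<and> 1 \<le> r \<and> r \<le> part i - part (Suc i)"
  using dmult_c by (auto simp: I_bnc_conjugate[OF Par] num_dparts_l)

lemma row_l: "1 \<le> i \<Longrightarrow> i < L \<Longrightarrow> row l i r = psum l i + r"
  using row_block(1)[OF Par, of i r] dpart_l[of i] count_ge_l_nth[of "i - 1"] by (simp add: num_dparts_l)

lemma bnc_c:
  assumes "1 \<le> i" "i < L"
  shows "bnc c i r = Suc (part i) - r"
proof -
  have "num_dparts c = L" using num_dparts_conjugate[OF Par] num_dparts_l by simp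
  then have "(\<Sum>j = 1..L - i. dmult c j) = count_ge c (Suc i)"
    using sum_dmult[of "L - i" c "\<lambda>_. 1"] assms dpart_c[OF assms] by (simp add: count_ge_def sum_list_triv)
  then show ?thesis using \<open>num_dparts c = L\<close> by (simp add: bnc_def count_ge_c)
qed

lemma part_1_less: "part 1 < part 0"
  using part_strict[of 0 1] nonempty by simp

lemma bnc_idx:
  assumes "(i, r) \<in> I_bnc c"
  shows "bnc c i r \<in> {1..part 1}" "idx (bnc c i r) = (i, r)"
proof -
  have i: "1 \<le> i" "i < L" "1 \<le> r" "r \<le> part i - part (Suc i)" using assms by (auto simp: I_bnc_c)
  have b: "bnc c i r = Suc (part i) - r" by (rule bnc_c[OF i(1,2)])
  have "part i \<le> part 1" using i by (intro part_antimono)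
  then show m: "bnc c i r \<in> {1..part 1}" using b i by auto
  have "count_ge l (bnc c i r) = Suc i"
    using count_ge_l_level[of "bnc c i r" i] m part_1_less b i by auto
  then show "idx (bnc c i r) = (i, r)" using b i by (simp add: idx_def)
qed

lemma idx_in:
  assumes "t \<in> {1..part 1}" "count_ge l t = Suc i"
  shows "1 \<le> i" "i < L" "idx t = (i, Suc (part i) - t)" "idx t \<in> I_bnc c" "case_prod (bnc c) (idx t) = t"
proof -
  have t: "1 \<le> t" "t \<le> part 0" using assms(1) part_1_less by auto
  have lv: "part (Suc i) < t" "t \<le> part i" using count_ge_l_level[OF t, of i] assms(2) by auto
  show i: "1 \<le> i"
  proof (rule ccontr)
    assume "\<not> 1 \<le> i"
    then have "i = 0" by simp
    then show False using lv(1) assms(1) by simp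
  qed
  show iL: "i < L" using lv t by (simp add: part_def split: if_splits)
  show id: "idx t = (i, Suc (part i) - t)" using assms(2) by (simp add: idx_def)
  show "idx t \<in> I_bnc c" unfolding id I_bnc_c using i iL lv by auto
  show "case_prod (bnc c) (idx t) = t" unfolding id using bnc_c[OF i iL] lv by simp
qed

text \<open>The factors of B_f thus act on the positions of \<open>c\<close> from right to left, the
  order built into \<open>run\<close>. Positions beyond \<open>part 1\<close> hold parts 1, which
  nothing can be moved past.\<close>

lemma bnc_list_c: "map (case_prod (bnc c)) (bnc_list c) = rev [1..<Suc (part 1)]"
proof -
  have seg: "map (\<lambda>r. Suc (part i) - r) [1..<Suc (part i - part (Suc i))] = rev [Suc (part (Suc i))..<Suc (part i)]" for i
    by (intro nth_equalityI) (auto simp: rev_nth simp del: upt_Suc)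
  have run: "concat (map (\<lambda>i. rev [Suc (part (Suc i))..<Suc (part i)]) [1..<Suc m]) = rev [Suc (part (Suc m))..<Suc (part 1)]" for m
  proof (induction m)
    case (Suc m)
    have up: "[1..<Suc (Suc m)] = [1..<Suc m] @ [Suc m]" by simp
    have "[Suc (part (Suc (Suc m)))..<Suc (part 1)] =
        [Suc (part (Suc (Suc m)))..<Suc (part (Suc m))] @ [Suc (part (Suc m))..<Suc (part 1)]"
      using upt_add_eq_append[of "Suc (part (Suc (Suc m)))" "Suc (part (Suc m))" "part 1 - part (Suc m)"]
        part_antimono[of "Suc m" "Suc (Suc m)"] part_antimono[of 1 "Suc m"] by (simp del: upt_Suc)
    then show ?case unfolding up map_append concat_append Suc.IH by (simp del: upt_Suc)
  qed simp
  have "num_dparts c = L" using num_dparts_conjugate[OF Par] num_dparts_l by simp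
  then have "map (case_prod (bnc c)) (bnc_list c)
      = concat (map (\<lambda>i. map (bnc c i) [1..<Suc (dmult c (L - i))]) [1..<L])"
    by (simp add: bnc_list_def map_concat comp_def del: upt_Suc)
  also have "\<dots> = concat (map (\<lambda>i. rev [Suc (part (Suc i))..<Suc (part i)]) [1..<L])"
  proof (intro arg_cong[where f = concat] map_cong refl)
    fix i assume "i \<in> set [1..<L]"
    then have i: "1 \<le> i" "i < L" by auto
    show "map (bnc c i) [1..<Suc (dmult c (L - i))] = rev [Suc (part (Suc i))..<Suc (part i)]"
      unfolding dmult_c[OF i] seg[of i, symmetric] by (intro map_cong refl) (rule bnc_c[OF i])
  qed
  also have "\<dots> = rev [Suc (part L)..<Suc (part 1)]"
    using run[of "L - 1"] nonempty by (simp del: upt_Suc)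
  finally show ?thesis by (simp add: part_def del: upt_Suc)
qed

lemma B_prod_run:
  assumes "run c (\<lambda>t. f (idx t)) (part 1) (drop (part 1) c) \<alpha>"
  shows "B_prod f l = Some (comp_path \<alpha>)"
proof -
  have "B_prod f l = fold (\<lambda>x. opB (case_prod (bnc c) x) (f (idx (case_prod (bnc c) x)))) (bnc_list c) (Some (comp_path c))"
    unfolding B_prod_def using bnc_idx(2) by (intro fold_cong refl) (auto simp: set_bnc_list)
  also have "\<dots> = fold (\<lambda>t. opB t (f (idx t))) (map (case_prod (bnc c)) (bnc_list c)) (Some (comp_path c))"
    by (simp add: fold_map comp_def)
  also have "\<dots> = Some (comp_path \<alpha>)"
    using run_fold_opB[OF assms, of n] part_1_less Par_compositions[OF conjugate_Par[OF Par]]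
    unfolding bnc_list_c by (simp add: length_c del: upt_Suc)
  finally show ?thesis .
qed

lemma sum_idx:
  fixes f :: "nat \<times> nat \<Rightarrow> nat"
  shows "(\<Sum>t = 1..part 1. f (idx t)) = sum_list (map f (bnc_list c))"
proof -
  have "map f (bnc_list c) = map (\<lambda>t. f (idx t)) (map (case_prod (bnc c)) (bnc_list c))"
    using bnc_idx(2) by (auto simp: set_bnc_list)
  then have "sum_list (map f (bnc_list c)) = sum_list (map (\<lambda>t. f (idx t)) [1..<Suc (part 1)])"
    unfolding bnc_list_c by (simp only: rev_map[symmetric] sum_list_rev)
  then show ?thesis by (simp only: sum_list_map_upt)
qed

lemma rowsum_block:
  assumes "k < L" "1 \<le> r" "r \<le> l ! k"
  shows "rowsum f l (psum l k + r) = (if (k, r) \<in> I_bnc c then f (k, r) else 0)"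
proof (cases "(k, r) \<in> I_bnc c")
  case True
  then show ?thesis using rowsum_row[OF Par True, of f] row_l[of k r] by (simp add: I_bnc_c)
next
  case False
  have "rowsum f l (psum l k + r) = 0"
  proof (rule rowsum_other[OF Par])
    fix i s assume si: "(i, s) \<in> I_bnc c"
    then have i: "1 \<le> i" "i < L" "1 \<le> s" "s \<le> l ! i" by (auto simp: I_bnc_c part_def split: if_splits)
    show "row l i s \<noteq> psum l k + r"
    proof (cases i k rule: linorder_cases)
      case less
      then have "psum l (Suc i) \<le> psum l k" by (intro psum_mono) simp
      then show ?thesis using psum_Suc[of i l] i assms row_l[OF i(1,2)] by simp
    next
      case equal
      then show ?thesis using row_l[OF i(1,2)] si False by auto
    next
      case greater
      then have "psum l (Suc k) \<le> psum l i" by (intro psum_mono) simp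
      then show ?thesis using psum_Suc[of k l] i assms row_l[OF i(1,2)] by simp
    qed
  qed
  then show ?thesis using False by simp
qed

lemma le_rowsum_total:
  fixes f :: "nat \<times> nat \<Rightarrow> nat"
  assumes "(i, r) \<in> I_bnc c"
  shows "f (i, r) \<le> sum_list (map f (bnc_list c))"
proof (rule member_le_sum_list)
  show "f (i, r) \<in> set (map f (bnc_list c))" using assms by (simp add: set_bnc_list)
qed simp

lemma correspondence:
  assumes ext: "f \<in> extensional (I_bnc c)"
    and gap: "\<And>i. Suc i < L \<Longrightarrow> e + l ! Suc i < l ! i"
    and anti: "\<And>i r. (i, Suc r) \<in> I_bnc c \<Longrightarrow> 1 \<le> r \<Longrightarrow> f (i, Suc r) \<le> f (i, r)"
    and e: "sum_list (map f (bnc_list c)) = e"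
    and p: "p \<in> Dyck n" "\<And>j. j \<in> {1..n} \<Longrightarrow> comp_xcoord l j = xcoord p j + rowsum f l j"
    and r: "run c (\<lambda>t. f (idx t)) (part 1) (drop (part 1) c) \<alpha>"
  shows "(f, l) \<in> F_set n" "A_prod f l = Some p" "B_prod f l = Some (comp_path \<alpha>)"
    "mset \<alpha> = mset c" "comp_deficit \<alpha> = comp_deficit l - e"
proof -
  show "A_prod f l = Some p" by (rule A_prod_eqI[OF Par p])
  show B: "B_prod f l = Some (comp_path \<alpha>)" by (rule B_prod_run[OF r])
  have st: "comp_bounce \<alpha> = comp_bounce c + e" "mset \<alpha> = mset c"
    using run_stats[OF r] part_1_less sum_idx[of f] e length_c by auto
  show "mset \<alpha> = mset c" by (rule st(2))
  have cc: "c \<in> compositions n" using conjugate_Par[OF Par] by (rule Par_compositions)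
  have \<alpha>: "\<alpha> \<in> compositions n"
    using cc sum_list_mset_eq[OF st(2)] mset_eq_setD[OF st(2)] by (simp add: compositions_def)
  show "comp_deficit \<alpha> = comp_deficit l - e"
    using comp_stats[OF cc] comp_stats[OF \<alpha>] st(1) comp_area_mset_eq[OF st(2)] comp_deficit_conjugate[OF Par] by simp
  \<comment> \<open>A single value is at most the total \<open>e\<close>, which is below the gap
    after the part and hence below the part.\<close>
  have F: "f (i, 1) < dpart l i" if i: "1 \<le> i" "i < L" for i
  proof -
    have "(i, 1) \<in> I_bnc c" using i part_strict[of i "Suc i"] by (simp add: I_bnc_c)
    then have "f (i, 1) \<le> e" using le_rowsum_total e by blast
    then show ?thesis using gap[of "i - 1"] i dpart_l[of i] by simp
  qed
  have M: "f (i, r + 1) \<le> f (i, r)" if "1 \<le> i" "i < L" "r \<in> {1..<dmult c (L - i)}" for i r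
    using that dmult_c[OF that(1,2)] by (simp add: anti I_bnc_c)
  show "(f, l) \<in> F_set n"
    unfolding F_set_def using Par ext F M B \<alpha>
    by (auto simp: PiE_def num_dparts_l comp_paths_def)
qed

lemma mono_of_adjacent:
  assumes anti: "\<And>i r. (i, Suc r) \<in> I_bnc c \<Longrightarrow> 1 \<le> r \<Longrightarrow> f (i, Suc r) \<le> f (i, r)"
    and "(i, s) \<in> I_bnc c" "1 \<le> r" "r \<le> s"
  shows "f (i, s) \<le> (f (i, r) :: nat)"
  using assms(4,2)
proof (induction s rule: dec_induct)
  case (step m)
  have "(i, m) \<in> I_bnc c" using step assms(3) by (auto simp: I_bnc_c)
  then have "f (i, m) \<le> f (i, r)" by (rule step.IH)
  moreover have "f (i, Suc m) \<le> f (i, m)" using step assms(3) by (intro anti) auto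
  ultimately show ?case by simp
qed simp

text \<open>Only the last copy of a value i + 1, at position \<open>part i\<close>, must pass parts
  that were not left there by the preceding move: the copies of i right after it. They have to be
  sufficiently many and still unmoved; both follow since the exponents total \<open>e\<close>, less
  than the number of copies.\<close>

lemma ex_run_of_f:
  assumes gap: "\<And>i. Suc i < L \<Longrightarrow> e + l ! Suc i < l ! i"
    and mono: "\<And>i r s. (i, s) \<in> I_bnc c \<Longrightarrow> 1 \<le> r \<Longrightarrow> r \<le> s \<Longrightarrow> f (i, s) \<le> f (i, r)"
    and e: "sum_list (map f (bnc_list c)) = e"
  shows "\<exists>\<alpha>. run c (\<lambda>t. f (idx t)) (part 1) (drop (part 1) c) \<alpha>"
proof -
  \<comment> \<open>The default 0 records that positions beyond \<open>part 1\<close> are unmoved,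
    as the conditions of \<open>ex_run_from\<close> on those positions require.\<close>
  define k where "k t = (if t \<in> {1..part 1} then f (idx t) else 0)" for t
  have sum_k: "(\<Sum>t = 1..part 1. k t) = e" using sum_idx[of f] e by (simp add: k_def)
  have k_mono: "k s \<le> k t" if st: "1 \<le> s" "s \<le> t" "t \<le> part 1" and lv: "count_ge l s = count_ge l t" for s t
  proof -
    obtain i where i: "count_ge l t = Suc i" using count_ge_l_pos[of t] st part_1_less by (cases "count_ge l t") auto
    note i_s = idx_in[of s i] and i_t = idx_in[of t i]
    have "idx s = (i, Suc (part i) - s)" "idx t = (i, Suc (part i) - t)" "idx s \<in> I_bnc c" "idx t \<in> I_bnc c"
      using i_s i_t st i lv by auto
    then show ?thesis using mono[of i "Suc (part i) - s" "Suc (part i) - t"] st by (auto simp: k_def I_bnc_c)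
  qed
  have "\<exists>\<alpha>. run c k (part 1) (drop (part 1) c) \<alpha>"
  proof (rule ex_run_from)
    show "part 1 < length c" using part_1_less by (simp add: length_c)
  next
    fix t assume t: "t < part 1"
    then have "1 < L" by (cases "1 < L") (auto simp: part_def)
    then show "2 \<le> c ! t" using t part_1_less count_ge_galois[OF sorted_l, of 1 "Suc t"] by (simp add: c_nth part_def)
  next
    fix t assume "Suc t < part 1" "c ! Suc t = c ! t"
    then show "k (Suc t) \<le> k (Suc (Suc t))" using part_1_less by (intro k_mono) (auto simp: c_nth)
  next
    fix t assume t: "part 1 \<le> t" "t < length c"
    then show "c ! t = 1" using count_ge_l_level[of "Suc t" 0] by (simp add: c_nth length_c)
  next
    fix t assume t: "t < part 1" and ch: "Suc t = part 1 \<or> c ! Suc t \<noteq> c ! t"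
    have t0: "Suc t \<le> part 0" "Suc (Suc t) \<le> part 0" using t part_1_less by auto
    obtain i where i: "count_ge l (Suc t) = Suc i" using count_ge_l_pos[of "Suc t"] t0 by (cases "count_ge l (Suc t)") auto
    have i1: "1 \<le> i" "i < L" using idx_in[of "Suc t" i] i t by auto
    have lv: "part (Suc i) < Suc t" "Suc t \<le> part i" using count_ge_l_level[of "Suc t" i] i t0 by auto
    \<comment> \<open>A change of value in \<open>c\<close>, or the end of the moved range, happens
      exactly at the last position of a level.\<close>
    have top: "Suc t = part i"
    proof (rule ccontr)
      assume "Suc t \<noteq> part i"
      then have "Suc (Suc t) \<le> part i" using lv by simp
      then have "count_ge l (Suc (Suc t)) = Suc i" using count_ge_l_level[of "Suc (Suc t)" i] lv t0 by simp
      then have "c ! Suc t = c ! t" using i t0 by (simp add: c_nth)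
      then have "Suc t = part 1" using ch by simp
      then show False using \<open>Suc (Suc t) \<le> part i\<close> part_antimono[of 1 i] i1 by simp
    qed
    obtain m where m: "i = Suc m" using i1 by (cases i) auto
    have gm: "e + part i < part m" using gap[of m] m i1 by (simp add: part_def)
    have level: "count_ge l (Suc t + j) = i" if "1 \<le> j" "part i + j \<le> part m" for j
      using count_ge_l_level[of "Suc t + j" m] that top m part_antimono[of 0 m] by simp
    have ke: "k (Suc t) \<le> e"
      using member_le_sum[of "Suc t" "{1..part 1}" k] t sum_k by simp
    show "c ! t = Suc (c ! Suc t) \<and>
      (\<forall>j \<in> {1..k (Suc t)}. Suc t + j \<le> length c \<and> k (Suc t + j) = 0 \<and> c ! (t + j) = c ! Suc t)"
    proof (intro conjI ballI)
      have c1: "c ! Suc t = i" using level[of 1] gm t0 by (simp add: c_nth)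
      then show "c ! t = Suc (c ! Suc t)" using i t0 by (simp add: c_nth)
      fix j assume j: "j \<in> {1..k (Suc t)}"
      have jm: "part i + j \<le> part m" using j ke gm by simp
      then show le: "Suc t + j \<le> length c" using top part_antimono[of 0 m] by (simp add: length_c)
      show "c ! (t + j) = c ! Suc t" using level[of j] j jm le c1 by (simp add: c_nth length_c)
      \<comment> \<open>Otherwise \<open>k\<close> is positive on the rest of the level, and its sum exceeds the gap.\<close>
      show "k (Suc t + j) = 0"
      proof (rule ccontr)
        assume nz: "k (Suc t + j) \<noteq> 0"
        then have jT: "Suc t + j \<le> part 1" by (auto simp: k_def split: if_splits)
        have "m \<noteq> 0"
        proof
          assume "m = 0"
          then show False using jT top m j by simp
        qed
        then have mT: "part m \<le> part 1" by (intro part_antimono) simp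
        let ?S = "{part i + j..part m}"
        have ge: "1 \<le> k s" if "s \<in> ?S" for s
        proof -
          have "count_ge l s = i" "count_ge l (Suc t + j) = i"
            using level[of "s - part i"] level[of j] that j jm top by auto
          then have "k (Suc t + j) \<le> k s" using that mT top by (intro k_mono) auto
          then show ?thesis using nz by simp
        qed
        have "card ?S \<le> (\<Sum>s \<in> ?S. k s)" using sum_mono[of ?S "\<lambda>_. 1" k] ge by simp
        then have "k (part i) + (part m + 1 - (part i + j)) \<le> k (part i) + (\<Sum>s \<in> ?S. k s)" by simp
        also have "\<dots> = (\<Sum>s \<in> insert (part i) ?S. k s)" using j by (subst sum.insert) auto
        also have "\<dots> \<le> (\<Sum>s = 1..part 1. k s)" using mT top t by (intro sum_mono2) auto
        finally have "k (part i) + (part m + 1 - (part i + j)) \<le> e" using sum_k by simp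
        \<comment> \<open>With this bound the left-hand side above is at least
          \<open>part m + 1 - part i\<close>, more than the gap allows.\<close>
        moreover have "j \<le> k (part i)" using j top by simp
        ultimately show False using gm jm by linarith
      qed
    qed
  qed
  then obtain \<alpha> where "run c k (part 1) (drop (part 1) c) \<alpha>" by blast
  then have "run c (\<lambda>t. f (idx t)) (part 1) (drop (part 1) c) \<alpha>" by (rule run_cong) (simp add: k_def)
  then show ?thesis by blast
qed

text \<open>The multiplicities of \<open>c\<close> below the largest value are gaps of \<lambda> and
  so exceed the inversion weight. Hence \<alpha> is nearly sorted and can be decoded; as each pass
  costs one unit of bounce, the values of \<open>f\<close> add up to the inversion weight.\<close>

lemma ex_f_of_composition:
  assumes gap: "\<And>i. Suc i < L \<Longrightarrow> inv_weight \<alpha> + l ! Suc i < l ! i" and m: "mset \<alpha> = mset c"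
  shows "\<exists>f \<in> extensional (I_bnc c). run c (\<lambda>t. f (idx t)) (part 1) (drop (part 1) c) \<alpha> \<and>
    sum_list (map f (bnc_list c)) = inv_weight \<alpha> \<and>
    (\<forall>i r. (i, Suc r) \<in> I_bnc c \<longrightarrow> 1 \<le> r \<longrightarrow> f (i, Suc r) \<le> f (i, r))"
proof -
  have cs: "sorted_wrt (\<ge>) c" using conjugate_Par[OF Par] by (simp add: Par_def)
  have count_ge: "count_list \<alpha> v = count_list c v" for v using m by (metis count_mset)
  have near: "sorted_wrt (\<lambda>a b. b \<le> Suc a) \<alpha>"
  proof (rule sorted_wrt_near)
    show "set \<alpha> \<subseteq> {1..L}" using set_c mset_eq_setD[OF m] by simp
    fix v assume "v \<in> {1..<L}"
    then obtain i where i: "v = Suc i" "Suc i < L" by (cases v) auto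
    then show "inv_weight \<alpha> < count_list \<alpha> v" using gap[of i] by (simp add: count_ge count_c part_def)
  qed
  have two: "\<forall>t<part 1. 2 \<le> c ! t"
  proof (intro allI impI)
    fix t assume t: "t < part 1"
    then have "1 < L" by (cases "1 < L") (auto simp: part_def)
    then show "2 \<le> c ! t" using t part_1_less count_ge_galois[OF sorted_l, of 1 "Suc t"] by (simp add: c_nth part_def)
  qed
  have T: "part 1 \<le> length c" using part_1_less by (simp add: length_c)
  obtain k y where k: "run c k (part 1) y \<alpha>" "mset y = mset (drop (part 1) c)"
    "\<forall>t. 1 \<le> t \<longrightarrow> t < part 1 \<longrightarrow> c ! t = c ! (t - 1) \<longrightarrow> k t \<le> k (Suc t)"
    using ex_run_to[OF cs m near T two] by (elim exE conjE) (rule that)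
  have one: "a = 1" if a: "a \<in> set (drop (part 1) c)" for a
  proof -
    obtain t where t: "t < length (drop (part 1) c)" "drop (part 1) c ! t = a"
      using a unfolding in_set_conv_nth by blast
    then have "part 1 + t < length c" "a = c ! (part 1 + t)" using T by auto
    then show ?thesis using count_ge_l_level[of "Suc (part 1 + t)" 0] by (simp add: c_nth length_c)
  qed
  have ones: "replicate (length z) 1 = z" if "set z = set (drop (part 1) c)" for z
    using that one by (intro replicate_length_same) auto
  have "length y = length (drop (part 1) c)" using k(2) by (rule mset_eq_length)
  then have y: "y = drop (part 1) c" using ones[OF mset_eq_setD[OF k(2)]] ones[OF refl] by simp
  \<comment> \<open>The decoded numbers carried over to index pairs; \<open>restrict\<close>
    supplies the value outside the index set that \<open>extensional\<close> prescribes.\<close>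
  define f where "f = restrict (\<lambda>x. k (case_prod (bnc c) x)) (I_bnc c)"
  have fk: "f (idx t) = k t" if t: "t \<in> {1..part 1}" for t
  proof -
    obtain i where i: "count_ge l t = Suc i" using count_ge_l_pos[of t] t part_1_less by (cases "count_ge l t") auto
    show ?thesis using idx_in[OF t i] by (simp add: f_def)
  qed
  have r: "run c (\<lambda>t. f (idx t)) (part 1) (drop (part 1) c) \<alpha>"
    using run_cong[OF k(1), of "\<lambda>t. f (idx t)"] fk y by simp
  have "comp_bounce \<alpha> = comp_bounce c + inv_weight \<alpha>" by (rule comp_bounce_mset_eq_sorted[OF m cs])
  then have s: "sum_list (map f (bnc_list c)) = inv_weight \<alpha>"
    using run_stats[OF r T] sum_idx[of f] by simp
  have a: "f (i, Suc s) \<le> f (i, s)" if si: "(i, Suc s) \<in> I_bnc c" "1 \<le> s" for i s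
  proof -
    have si': "(i, s) \<in> I_bnc c" using si by (simp add: I_bnc_c)
    have i: "1 \<le> i" "i < L" "Suc s \<le> part i - part (Suc i)" using si(1) by (auto simp: I_bnc_c)
    \<comment> \<open>Raising the second index by one means going one position to the left within a
      level, so the claim is the monotonicity of \<open>k\<close> at equal neighbours.\<close>
    let ?t = "part i - s"
    have b: "bnc c i (Suc s) = ?t" "bnc c i s = Suc ?t" using bnc_c[OF i(1,2)] i(3) by auto
    have t: "1 \<le> ?t" "Suc ?t \<le> part 1" "part (Suc i) < ?t"
      using bnc_idx(1)[OF si(1)] bnc_idx(1)[OF si'] b i(3) by auto
    have "count_ge l ?t = Suc i" "count_ge l (Suc ?t) = Suc i"
      using count_ge_l_level[of ?t i] count_ge_l_level[of "Suc ?t" i] t part_1_less si(2) i(3) by auto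
    moreover have "Suc (?t - 1) = ?t" using t(1) by simp
    ultimately have "c ! ?t = c ! (?t - 1)" using t part_1_less c_nth[of ?t] c_nth[of "?t - 1"] by simp
    then have "k ?t \<le> k (Suc ?t)" using t by (intro k(3)[rule_format]) auto
    then show ?thesis using si(1) si' b by (simp add: f_def)
  qed
  show ?thesis using r s a by (intro bexI[of _ f]) (auto simp: f_def)
qed

end

lemma bounce_optimal_strict_partition:
  assumes "bounce_optimal n D l" "1 \<le> n"
  shows "strict_partition n l"
proof
  show "l \<in> Par n" by (rule bounce_optimal_Par[OF assms(1)])
  show "sorted_wrt (>) l" by (rule bounce_optimal_strict[OF assms(1)])
  show "l \<noteq> []" using assms by (auto simp: bounce_optimal_def compositions_def)
qed

text \<open>\<open>f\<close> is read off from the extra cells of the path. The conclusion retains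
  the run because injectivity of \<Phi> recovers \<open>f\<close> from it.\<close>

lemma bounce_minimal_correspondence:
  assumes p: "p \<in> bounce_minimal n" and n: "1 \<le> n"
  shows "\<exists>f l \<alpha>. strict_partition n l \<and> (f, l) \<in> F_set n \<and> A_prod f l = Some p \<and>
    B_prod f l = Some (comp_path \<alpha>) \<and> mset \<alpha> = mset (conjugate l) \<and> area_optimal n (comp_deficit \<alpha>) \<alpha> \<and>
    run (conjugate l) (\<lambda>t. f (strict_partition.idx l t)) (strict_partition.part l 1)
      (drop (strict_partition.part l 1) (conjugate l)) \<alpha>"
proof -
  define l where "l = bounce_comp p"
  define e where "e = excess p"
  have pD: "p \<in> Dyck n" and cr: "bounce_optimal n (deficit p) l"
    using p by (auto simp: bounce_minimal_iff l_def)
  interpret strict_partition n l by (rule bounce_optimal_strict_partition[OF cr n])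
  have de: "deficit p = comp_deficit l - e" "e \<le> comp_deficit l"
    using excess_le_comp_deficit[OF pD] by (auto simp: deficit_def l_def e_def)
  have gap: "e + l ! Suc i < l ! i" if "Suc i < L" for i using bounce_optimal_gap[OF cr that] de by simp
  define d where "d j = comp_xcoord l j - xcoord p j" for j
  have xd: "comp_xcoord l j = xcoord p j + d j" if "j \<in> {1..n}" for j
    using xcoord_le_comp_xcoord[OF pD that] by (simp add: d_def l_def)
  have sum_d: "(\<Sum>j = 1..n. d j) = e"
    unfolding e_def excess_def Dyck_semilength[OF pD] d_def l_def ..
  have sl: "sum_list l = n" using Par by (simp add: Par_def)
  have in_n: "psum l k + r \<in> {1..n}" "comp_xcoord l (psum l k + r) = psum l k"
    if "k < L" "1 \<le> r" "r \<le> l ! k" for k r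
    using psum_Suc[OF that(1)] psum_le[of "Suc k" l] sl that comp_xcoord_block[of k l "psum l k + r"] by auto
  have d_anti: "d (psum l k + s) \<le> d (psum l k + r)" if "k < L" "1 \<le> r" "r \<le> s" "s \<le> l ! k" for k r s
    using in_n[of k r] in_n[of k s] that Dyck_xcoord_mono[OF pD, of "psum l k + r" "psum l k + s"]
    by (simp add: d_def)
  \<comment> \<open>Rows outside the index set lie deeper in their block than the gap. An extra cell
    there would, by the decrease within the block, put one into each of the \<open>r\<close> rows
    from the start of the block, and \<open>r\<close> is larger than the total
    \<open>e\<close>.\<close>
  have d_zero: "d (psum l k + r) = 0" if k: "k < L" "1 \<le> r" "r \<le> l ! k" "(k, r) \<notin> I_bnc c" for k r
  proof (cases "k = 0")
    case True
    then show ?thesis using in_n(2)[OF k(1-3)] by (simp add: d_def)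
  next
    case False
    then have rk: "part k - part (Suc k) < r" using k by (auto simp: I_bnc_c)
    then have Sk: "Suc k < L" using k by (auto simp: part_def split: if_splits)
    then have er: "e < r" using rk gap[of k] k(1) by (simp add: part_def)
    show ?thesis
    proof (rule ccontr)
      assume nz: "d (psum l k + r) \<noteq> 0"
      let ?S = "{psum l k + 1..psum l k + r}"
      have "1 \<le> d j" if j: "j \<in> ?S" for j
      proof -
        have "d (psum l k + r) \<le> d (psum l k + (j - psum l k))" using j k by (intro d_anti) auto
        then show ?thesis using j nz by simp
      qed
      then have "card ?S \<le> (\<Sum>j \<in> ?S. d j)" using sum_mono[of ?S "\<lambda>_. 1" d] by simp
      also have "\<dots> \<le> (\<Sum>j = 1..n. d j)" using in_n(1)[OF k(1-3)] by (intro sum_mono2) auto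
      finally show False using sum_d er by simp
    qed
  qed
  define f where "f = restrict (\<lambda>x. d (case_prod (row l) x)) (I_bnc c)"
  have rs: "rowsum f l j = d j" if j: "j \<in> {1..n}" for j
  proof -
    obtain k where k: "k < L" "psum l k < j" "j \<le> psum l (Suc k)"
      using ex_block[of j l] j sl by auto
    define r where "r = j - psum l k"
    have r: "j = psum l k + r" "1 \<le> r" "r \<le> l ! k" using k psum_Suc[of k l] by (auto simp: r_def)
    show ?thesis
    proof (cases "(k, r) \<in> I_bnc c")
      case True
      then have "row l k r = j" using row_l[of k r] r by (simp add: I_bnc_c)
      then show ?thesis using rowsum_block[OF k(1) r(2,3), of f] True r(1) by (simp add: f_def)
    next
      case False
      then show ?thesis using rowsum_block[OF k(1) r(2,3), of f] d_zero[OF k(1) r(2,3)] r(1) by simp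
    qed
  qed
  have e: "sum_list (map f (bnc_list c)) = e" using sum_rowsum[OF Par, of f] rs sum_d by simp
  have mono: "f (i, s) \<le> f (i, r)" if "(i, s) \<in> I_bnc c" "1 \<le> r" "r \<le> s" for i r s
  proof -
    have i: "1 \<le> i" "i < L" "s \<le> l ! i" using that by (auto simp: I_bnc_c part_def split: if_splits)
    moreover have "(i, r) \<in> I_bnc c" using that by (auto simp: I_bnc_c)
    ultimately show ?thesis using that d_anti[OF i(2) that(2,3) i(3)] by (simp add: f_def row_l)
  qed
  obtain \<alpha> where r: "run c (\<lambda>t. f (idx t)) (part 1) (drop (part 1) c) \<alpha>"
    using ex_run_of_f[OF gap mono e] by blast
  have "f \<in> extensional (I_bnc c)" by (simp add: f_def)
  note co = correspondence[OF this gap _ e pD _ r]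
  have co: "(f, l) \<in> F_set n" "A_prod f l = Some p" "B_prod f l = Some (comp_path \<alpha>)"
    "mset \<alpha> = mset c" "comp_deficit \<alpha> = comp_deficit l - e"
    using co mono xd rs by auto
  have "area_optimal n (comp_deficit \<alpha>) \<alpha>" using bounce_optimal_imp_area_optimal[of n "comp_deficit \<alpha>" l \<alpha>] cr co(4,5) de by simp
  then show ?thesis using co r strict_partition_axioms by blast
qed

text \<open>Surjectivity. The parts of \<alpha> dictate \<open>l\<close>, the conjugate of their
  sorted list, and decoding \<alpha> gives \<open>f\<close>; the path with \<open>f\<close> as its
  extra cells has total excess \<open>inv_weight \<alpha>\<close>, which is precisely the surplus of
  \<open>l\<close> over the deficit of \<alpha>.\<close>

lemma area_minimal_correspondence:
  assumes cA: "area_optimal n (comp_deficit \<alpha>) \<alpha>" and n: "1 \<le> n"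
  shows "\<exists>f l p. p \<in> bounce_minimal n \<and> (f, l) \<in> F_set n \<and> A_prod f l = Some p \<and>
    B_prod f l = Some (comp_path \<alpha>)"
proof -
  have \<alpha>: "\<alpha> \<in> compositions n" using cA by (simp add: area_optimal_def)
  define l where "l = conjugate (rev (sort \<alpha>))"
  note m = rev_sort_Par[OF \<alpha>]
  have cr: "bounce_optimal n (comp_deficit \<alpha>) l" unfolding l_def by (rule area_optimal_imp_bounce_optimal[OF cA])
  interpret strict_partition n l by (rule bounce_optimal_strict_partition[OF cr n])
  have c: "c = rev (sort \<alpha>)" unfolding l_def by (rule conjugate_conjugate[OF m])
  define e where "e = inv_weight \<alpha>"
  have comp_deficit: "comp_deficit l = comp_deficit \<alpha> + e" using comp_deficit_conjugate[OF m] comp_deficit_rev_sort[OF \<alpha>] by (simp add: l_def e_def)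
  have gap: "e + l ! Suc i < l ! i" if "Suc i < L" for i using bounce_optimal_gap[OF cr that] comp_deficit by simp
  have "mset \<alpha> = mset c" by (simp add: c)
  from ex_f_of_composition[OF gap[unfolded e_def] this] obtain f where
    f: "f \<in> extensional (I_bnc c)" "run c (\<lambda>t. f (idx t)) (part 1) (drop (part 1) c) \<alpha>"
      "sum_list (map f (bnc_list c)) = e"
      "\<And>i r. (i, Suc r) \<in> I_bnc c \<Longrightarrow> 1 \<le> r \<Longrightarrow> f (i, Suc r) \<le> f (i, r)"
    by (auto simp: e_def)
  have "\<exists>p \<in> Dyck n. bounce_comp p = l \<and> (\<forall>j \<in> {1..n}. comp_xcoord l j = xcoord p j + rowsum f l j)"
  proof (rule ex_path_excess[OF Par_compositions[OF Par]])
    fix r assume "r \<in> {1..psum l 1}"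
    then show "rowsum f l r = 0"
      using rowsum_block[of 0 r f] nonempty psum_Suc[of 0 l] by (simp add: I_bnc_c)
  next
    fix k r assume k: "Suc k < length l" "r \<in> {1..l ! Suc k}"
    show "rowsum f l (psum l (Suc k) + r) < l ! k"
      using rowsum_block[of "Suc k" r f] k gap[OF k(1)] le_rowsum_total[of "Suc k" r f] f(3) by auto
  next
    fix k r s assume k: "k < length l" "1 \<le> r" "r \<le> s" "s \<le> l ! k"
    show "rowsum f l (psum l k + s) \<le> rowsum f l (psum l k + r)"
    proof (cases "(k, s) \<in> I_bnc c")
      case True
      moreover from True have "(k, r) \<in> I_bnc c" using k by (auto simp: I_bnc_c)
      ultimately show ?thesis using rowsum_block[of k s f] rowsum_block[of k r f] k
          mono_of_adjacent[OF f(4) True k(2,3)] by simp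
    next
      case False
      then show ?thesis using rowsum_block[of k s f] k by simp
    qed
  qed
  then obtain p where p: "p \<in> Dyck n" "bounce_comp p = l"
    "\<And>j. j \<in> {1..n} \<Longrightarrow> comp_xcoord l j = xcoord p j + rowsum f l j" by blast
  have "excess p = e" using excess_eq[OF p(1), of "rowsum f l"] p(2,3) sum_rowsum[OF Par, of f] f(3) by simp
  then have "deficit p = comp_deficit \<alpha>" using comp_deficit p(2) by (simp add: deficit_def)
  then have "p \<in> bounce_minimal n" using cr p by (simp add: bounce_minimal_iff)
  moreover note correspondence[OF f(1) gap f(4) f(3) p(1,3) f(2)]
  ultimately show ?thesis by blast
qed

section \<open>Bijectivity of \<Phi>\<close>

lemma comp_path_inj:
  assumes "comp_path \<alpha> = comp_path \<beta>" "\<alpha> \<in> compositions n" "\<beta> \<in> compositions n"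
  shows "\<alpha> = \<beta>"
  using bounce_comp_comp_path(1)[OF assms(2)] bounce_comp_comp_path(1)[OF assms(3)]
  unfolding assms(1) by (rule trans[OF sym])

lemma sorted_mset_unique:
  assumes "sorted_wrt (\<ge>) xs" "sorted_wrt (\<ge>) ys" "mset xs = mset (ys :: nat list)"
  shows "xs = ys"
proof -
  have "sorted (rev xs)" "sorted (rev ys)" using assms by (auto simp: sorted_wrt_rev)
  then have "sort ys = rev xs" "sort ys = rev ys"
    using assms(3) by (intro properties_for_sort; simp)+
  then show ?thesis by simp
qed

theorem theorem4p12:
  fixes n :: nat
  assumes "n \<ge> 1"
  shows "bounce_minimal n \<subseteq> AF n \<and> bij_betw (Phi n) (bounce_minimal n) (area_minimal n)"
proof
  show "bounce_minimal n \<subseteq> AF n"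
  proof
    fix p assume "p \<in> bounce_minimal n"
    then obtain f l where "(f, l) \<in> F_set n" "A_prod f l = Some p"
      using bounce_minimal_correspondence[OF _ assms] by blast
    then show "p \<in> AF n" unfolding AF_def by blast
  qed
  show "bij_betw (Phi n) (bounce_minimal n) (area_minimal n)"
  proof (rule bij_betwI')
    fix p assume "p \<in> bounce_minimal n"
    then obtain f l \<alpha> where "(f, l) \<in> F_set n" "A_prod f l = Some p" "B_prod f l = Some (comp_path \<alpha>)"
      "area_optimal n (comp_deficit \<alpha>) \<alpha>"
      using bounce_minimal_correspondence[OF _ assms] by blast
    then show "Phi n p \<in> area_minimal n" using Phi_eq by (auto simp: area_minimal_iff)
  next
    fix q assume "q \<in> area_minimal n"
    then obtain \<alpha> where \<alpha>: "q = comp_path \<alpha>" "area_optimal n (comp_deficit \<alpha>) \<alpha>" by (auto simp: area_minimal_iff)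
    obtain f l p where "p \<in> bounce_minimal n" "(f, l) \<in> F_set n" "A_prod f l = Some p"
      "B_prod f l = Some (comp_path \<alpha>)"
      using area_minimal_correspondence[OF \<alpha>(2) assms] by blast
    then show "\<exists>p \<in> bounce_minimal n. q = Phi n p" using Phi_eq[of f l n p "comp_path \<alpha>"] \<alpha>(1) by (intro bexI[of _ p]) auto
  next
    fix p p' assume pp: "p \<in> bounce_minimal n" "p' \<in> bounce_minimal n"
    show "Phi n p = Phi n p' \<longleftrightarrow> p = p'"
    proof
      assume eq: "Phi n p = Phi n p'"
      obtain f l \<alpha> where 1: "strict_partition n l" "(f, l) \<in> F_set n" "A_prod f l = Some p"
        "B_prod f l = Some (comp_path \<alpha>)" "mset \<alpha> = mset (conjugate l)" "area_optimal n (comp_deficit \<alpha>) \<alpha>"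
        "run (conjugate l) (\<lambda>t. f (strict_partition.idx l t)) (strict_partition.part l 1)
          (drop (strict_partition.part l 1) (conjugate l)) \<alpha>"
        using bounce_minimal_correspondence[OF pp(1) assms] by blast
      obtain f' l' \<alpha>' where 2: "strict_partition n l'" "(f', l') \<in> F_set n" "A_prod f' l' = Some p'"
        "B_prod f' l' = Some (comp_path \<alpha>')" "mset \<alpha>' = mset (conjugate l')" "area_optimal n (comp_deficit \<alpha>') \<alpha>'"
        "run (conjugate l') (\<lambda>t. f' (strict_partition.idx l' t)) (strict_partition.part l' 1)
          (drop (strict_partition.part l' 1) (conjugate l')) \<alpha>'"
        using bounce_minimal_correspondence[OF pp(2) assms] by blast
      have "comp_path \<alpha> = comp_path \<alpha>'" using eq Phi_eq[OF 1(2-4)] Phi_eq[OF 2(2-4)] by simp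
      then have \<alpha>: "\<alpha> = \<alpha>'" using 1(6) 2(6) by (intro comp_path_inj) (auto simp: area_optimal_def)
      have P: "l \<in> Par n" "l' \<in> Par n" using 1(2) 2(2) by (auto simp: F_set_def)
      \<comment> \<open>Both conjugates are the decreasing rearrangement of the same
        \<alpha>.\<close>
      have "conjugate l = conjugate l'"
        using conjugate_Par[OF P(1)] conjugate_Par[OF P(2)] 1(5) 2(5) \<alpha>
        by (intro sorted_mset_unique) (auto simp: Par_def)
      then have "conjugate (conjugate l) = conjugate (conjugate l')" by (rule arg_cong)
      then have ll: "l = l'" unfolding conjugate_conjugate[OF P(1)] conjugate_conjugate[OF P(2)] .
      interpret strict_partition n l by (rule 1(1))
      \<comment> \<open>Two runs from the same \<open>c\<close> to the same \<alpha> move every part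
        equally far, so \<open>f\<close> and \<open>f'\<close> agree at all positions, hence at all
        indices.\<close>
      have k: "\<forall>t \<in> {1..part 1}. f (idx t) = f' (idx t)"
        using run_inj[OF 1(7), of "\<lambda>t. f' (idx t)"] 2(7) ll \<alpha> by blast
      have "f x = f' x" if "x \<in> I_bnc c" for x
        using that bnc_idx[of "fst x" "snd x"] k by (metis prod.collapse)
      then have "f = f'" using 1(2) 2(2) ll
        by (intro extensionalityI[of f "I_bnc c"]) (auto simp: F_set_def PiE_def)
      then show "p = p'" using 1(3) 2(3) ll by simp
    qed simp
  qed
qed

end
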